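(* Let $f\in\mathcal{E}_d$ be an eventually expanding $d$-modal piecewise affine map and let $[f]\subset\mathcal{E}_d$ be its conjugacy class. Then $[f]$ is contained in a codimension 1 submanifold of $\mathcal{E}_d$. In particular, if $g\in[f]$ and the essential slopes of $g$ are at least as big as the corresponding essential slopes of $f$, then they are in fact equal, i.e. $$\{|Dg(i)|\ge |Df(i)|,\ i\in B_f\}\ \Rightarrow\ \{Df(i)=Dg(i)\ \text{ for } i\in B_f\}.$$
   Context: Intervals always have positive length. A continuous map $f:N\to N$, $N=[a,b]$, is piecewise affine if there exist points $a=a_0<a_1<\dots<a_d<a_{d+1}=b$ such that each $f|[a_i,a_{i+1}]$ (the $i$-th branch) is affine, with slope $Df(i)$, and $Df(i)Df(i+1)<0$. The points $a_1,\dots,a_d$ are the critical points, and $f$ is called $d$-modal. $f$ is eventually expanding if there is an integer $n\ge1$ such that $|Df^n|>1$ whenever this derivative is defined. $\mathcal{E}_d$ is the family of $d$-modal eventually expanding piecewise affine maps; it is naturally parametrized by a submanifold of $\mathbb{R}^{2d+2}$, with which it is identified. Two maps $f:X\to X$ and $g:Y\to Y$ are topologically conjugate if there is a homeomorphism $h:X\to Y$ with $h\circ f=g\circ h$. The conjugacy class $[f]\subset\mathcal{E}_d$ is the set of maps in $\mathcal{E}_d$ topologically conjugate to $f$. A pair $(I,n)$, with $I\subset N$ an interval and $n\ge1$, is a renormalization of $f$ if $f^n(I)\subset I$, $\overline I\ne N$, and the interiors of $f^i(I)$, $i=0,\dots,n-1$, are pairwise disjoint. $f$ is renormalizable if it has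 a renormalization, otherwise non-renormalizable. The orbit $\bigcup_{i=0}^{n-1} f^i(I)$ is a cycle (of period $n$); it is minimal if $f^n|I$ is non-renormalizable. When $f$ itself is non-renormalizable, $N$ (with $n=1$) is regarded as its minimal cycle. The $i$-th branch of $f$ is essential if a minimal cycle intersects the interior of its domain; then the slope $Df(i)$ is also called essential. $B_f$ is the collection of essential branches (identified with their indices $i$); it is defined topologically.
   Formalization: Branches of f and g are matched through the conjugacy: same index if it is increasing, i ↔ d−i if decreasing (equal indices fail for the tent map and its reflection); a submanifold of E_d means the trace on E_d of a smooth hypersurface of R^{2d+2}, as E_d is not open. *)

theory Defs
  imports "HOL-Analysis.Analysis"
begin

section \<open>Piecewise affine maps\<close>

text \<open>
  The interval \<open>N = {a..b}\<close> is fixed. The breakpoints are \<open>c 0 = a < c 1 < \<dots> < c (d + 1) = b\<close>, and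
  \<open>s i\<close> is the slope on \<open>{c i..c (i + 1)}\<close>, for \<open>i \<le> d\<close>. The values of \<open>c\<close> and \<open>s\<close> at
  larger indices are irrelevant.
\<close>

definition affine_branches ::
    "real \<Rightarrow> real \<Rightarrow> nat \<Rightarrow> (real \<Rightarrow> real) \<Rightarrow> (nat \<Rightarrow> real) \<Rightarrow> (nat \<Rightarrow> real) \<Rightarrow> bool" where
  "affine_branches a b d f c s \<longleftrightarrow>
     c 0 = a \<and> c (Suc d) = b \<and> (\<forall>i\<le>d. c i < c (Suc i)) \<and>
     (\<forall>i\<le>d. \<forall>x\<in>{c i..c (Suc i)}. f x = f (c i) + s i * (x - c i)) \<and>
     (\<forall>i<d. s i * s (Suc i) < 0)"

text \<open>
  Self-maps of \<open>{a..b}\<close> are represented by extensional functions, so that equality of maps is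
  equality of functions.
\<close>

definition modal_affine_map :: "real \<Rightarrow> real \<Rightarrow> nat \<Rightarrow> (real \<Rightarrow> real) \<Rightarrow> bool" where
  "modal_affine_map a b d f \<longleftrightarrow>
     f \<in> {a..b} \<rightarrow>\<^sub>E {a..b} \<and> continuous_on {a..b} f \<and> (\<exists>c s. affine_branches a b d f c s)"

definition eventually_expanding :: "real set \<Rightarrow> (real \<Rightarrow> real) \<Rightarrow> bool" where
  "eventually_expanding N f \<longleftrightarrow>
     (\<exists>n\<ge>1. \<forall>x\<in>N. \<forall>D. ((f ^^ n) has_real_derivative D) (at x within N) \<longrightarrow> \<bar>D\<bar> > 1)"

definition exp_family :: "real \<Rightarrow> real \<Rightarrow> nat \<Rightarrow> (real \<Rightarrow> real) set" where
  "exp_family a b d = {f. modal_affine_map a b d f \<and> eventually_expanding {a..b} f}"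

definition breakpoint :: "real \<Rightarrow> real \<Rightarrow> nat \<Rightarrow> (real \<Rightarrow> real) \<Rightarrow> nat \<Rightarrow> real" where
  "breakpoint a b d f i = (THE x. \<exists>c s. affine_branches a b d f c s \<and> x = c i)"

definition slope :: "real \<Rightarrow> real \<Rightarrow> nat \<Rightarrow> (real \<Rightarrow> real) \<Rightarrow> nat \<Rightarrow> real" where
  "slope a b d f i = (THE m. \<exists>c s. affine_branches a b d f c s \<and> m = s i)"

lemma affine_branchesD:
  assumes "affine_branches a b d f c s"
  shows "i \<le> d \<Longrightarrow> c i < c (Suc i)"
    and "i \<le> d \<Longrightarrow> c i \<le> x \<Longrightarrow> x \<le> c (Suc i) \<Longrightarrow> f x = f (c i) + s i * (x - c i)"
    and "i < d \<Longrightarrow> s i * s (Suc i) < 0"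
  using assms unfolding affine_branches_def Ball_def atLeastAtMost_iff by blast+

text \<open>The alternation of the slopes makes breakpoints and slopes unique.\<close>

lemma affine_branches_slope_eq:
  assumes A: "affine_branches a b d f c s" and B: "affine_branches a b d f c' s'"
    and i: "i \<le> d" and eq: "c i = c' i"
  shows "s i = s' i"
proof -
  define x where "x = min (c (Suc i)) (c' (Suc i))"
  have lt: "c i < x"
    using affine_branchesD(1)[OF A i] affine_branchesD(1)[OF B i] eq by (simp add: x_def)
  have "f x = f (c i) + s i * (x - c i)"
    by (rule affine_branchesD(2)[OF A i]) (use lt in \<open>auto simp: x_def\<close>)
  moreover have "f x = f (c' i) + s' i * (x - c' i)"
    by (rule affine_branchesD(2)[OF B i]) (use lt eq in \<open>auto simp: x_def\<close>)
  ultimately have "s i * (x - c i) = s' i * (x - c i)"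
    unfolding eq by linarith
  then show ?thesis using lt eq by simp
qed

lemma affine_branches_breakpoint_not_less:
  assumes A: "affine_branches a b d f c s" and B: "affine_branches a b d f c' s'"
    and i: "i < d" and eq: "c i = c' i"
  shows "\<not> c (Suc i) < c' (Suc i)"
proof
  assume less: "c (Suc i) < c' (Suc i)"
  define p where "p = c (Suc i)"
  define x where "x = min (c (Suc (Suc i))) (c' (Suc i))"
  have s: "s i = s' i"
    using affine_branches_slope_eq[OF A B _ eq] i by simp
  have px: "p < x" and cp: "c i < p"
    using affine_branchesD(1)[OF A, of "Suc i"] affine_branchesD(1)[OF A, of i] i less
    by (auto simp: p_def x_def)
  have "f x = f p + s (Suc i) * (x - p)"
    unfolding p_def
    by (rule affine_branchesD(2)[OF A]) (use i px in \<open>auto simp: p_def x_def\<close>)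
  moreover have "f x = f (c i) + s i * (x - c i)"
    unfolding eq s
    by (rule affine_branchesD(2)[OF B]) (use i px cp eq in \<open>auto simp: x_def\<close>)
  moreover have "f p = f (c i) + s i * (p - c i)"
    by (rule affine_branchesD(2)[OF A]) (use i cp in \<open>auto simp: p_def\<close>)
  ultimately have "s (Suc i) * (x - p) = s i * (x - c i) - s i * (p - c i)"
    by linarith
  also have "\<dots> = s i * (x - p)"
    by (simp add: right_diff_distrib)
  finally have "s (Suc i) * (x - p) = s i * (x - p)" .
  then have "s (Suc i) = s i" using px by simp
  moreover have "s i * s (Suc i) < 0"
    using affine_branchesD(3)[OF A i] .
  ultimately show False by (simp add: mult_less_0_iff)
qed

lemma affine_branches_unique:
  assumes A: "affine_branches a b d f c s" and B: "affine_branches a b d f c' s'"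
  shows "i \<le> Suc d \<Longrightarrow> c i = c' i" and "i \<le> d \<Longrightarrow> s i = s' i"
proof -
  have main: "c i = c' i" if "i \<le> d" for i
    using that
  proof (induction i)
    case 0
    then show ?case using A B unfolding affine_branches_def by metis
  next
    case (Suc i)
    then show ?case
      using affine_branches_breakpoint_not_less[OF A B, of i]
        affine_branches_breakpoint_not_less[OF B A, of i] by simp
  qed
  show "c i = c' i" if "i \<le> Suc d"
  proof (cases "i = Suc d")
    case True
    then show ?thesis using A B unfolding affine_branches_def by metis
  next
    case False
    then show ?thesis using main that by simp
  qed
  show "s i = s' i" if "i \<le> d"
    using affine_branches_slope_eq[OF A B that main[OF that]] .
qed

lemma breakpoint_eq:
  assumes "affine_branches a b d f c s" "i \<le> Suc d"
  shows "breakpoint a b d f i = c i"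
  unfolding breakpoint_def
proof (rule the_equality)
  show "\<exists>c' s'. affine_branches a b d f c' s' \<and> c i = c' i"
    using assms(1) by blast
  show "x = c i" if "\<exists>c' s'. affine_branches a b d f c' s' \<and> x = c' i" for x
  proof -
    from that obtain c' s' where "affine_branches a b d f c' s'" "x = c' i" by blast
    then show ?thesis using affine_branches_unique(1)[OF _ assms(1) assms(2)] by simp
  qed
qed

lemma slope_eq:
  assumes "affine_branches a b d f c s" "i \<le> d"
  shows "slope a b d f i = s i"
  unfolding slope_def
proof (rule the_equality)
  show "\<exists>c' s'. affine_branches a b d f c' s' \<and> s i = s' i"
    using assms(1) by blast
  show "x = s i" if "\<exists>c' s'. affine_branches a b d f c' s' \<and> x = s' i" for x
  proof -
    from that obtain c' s' where "affine_branches a b d f c' s'" "x = s' i" by blast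
    then show ?thesis using affine_branches_unique(2)[OF _ assms(1) assms(2)] by simp
  qed
qed


section \<open>Parameter space and submanifolds\<close>

text \<open>
  The \<open>2 * d + 2\<close> parameters of a map are its critical points \<open>a\<^sub>1, \<dots>, a\<^sub>d\<close> and its values at
  \<open>a\<^sub>0, \<dots>, a\<^sub>d\<^sub>+\<^sub>1\<close>. The bijection \<open>e :: 'n \<Rightarrow> {..<2 * d + 2}\<close> numbers the coordinates of
  \<open>real ^ 'n\<close>.
\<close>

definition params ::
    "('n::finite \<Rightarrow> nat) \<Rightarrow> real \<Rightarrow> real \<Rightarrow> nat \<Rightarrow> (real \<Rightarrow> real) \<Rightarrow> real ^ 'n" where
  "params e a b d f =
     (\<chi> k. if e k < d then breakpoint a b d f (Suc (e k)) else f (breakpoint a b d f (e k - d)))"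

primrec Ck_on :: "nat \<Rightarrow> 'a::euclidean_space set \<Rightarrow> ('a \<Rightarrow> real) \<Rightarrow> bool" where
  "Ck_on 0 U \<phi> \<longleftrightarrow> continuous_on U \<phi>"
| "Ck_on (Suc k) U \<phi> \<longleftrightarrow>
     (\<forall>x\<in>U. \<phi> differentiable (at x)) \<and> (\<forall>v. Ck_on k U (\<lambda>x. frechet_derivative \<phi> (at x) v))"

definition smooth_hypersurface :: "'a::euclidean_space set \<Rightarrow> bool" where
  "smooth_hypersurface M \<longleftrightarrow>
     (\<forall>p\<in>M. \<exists>U \<phi>. open U \<and> p \<in> U \<and> (\<forall>k. Ck_on k U \<phi>) \<and>
        (\<forall>x\<in>U. \<exists>v. frechet_derivative \<phi> (at x) v \<noteq> 0) \<and>
        M \<inter> U = {x \<in> U. \<phi> x = 0})"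

text \<open>
  A codimension 1 submanifold of a full-dimensional set \<open>E\<close> in a Euclidean space is the trace on \<open>E\<close>
  of an embedded codimension 1 submanifold of the ambient space. For open \<open>E\<close> this is the usual
  notion; the set of parameters of \<^const>\<open>exp_family\<close> is full-dimensional but need not be open
  (for instance at maps taking the value \<open>a\<close> or \<open>b\<close>).
\<close>

definition codim1_submanifold_of :: "'a::euclidean_space set \<Rightarrow> 'a set \<Rightarrow> bool" where
  "codim1_submanifold_of E S \<longleftrightarrow> (\<exists>M. smooth_hypersurface M \<and> S = M \<inter> E)"


section \<open>Topological conjugacy\<close>

definition conjugacy ::
    "'a::topological_space set \<Rightarrow> ('a \<Rightarrow> 'a) \<Rightarrow> 'b::topological_space set \<Rightarrow> ('b \<Rightarrow> 'b) \<Rightarrow> ('a \<Rightarrow> 'b) \<Rightarrow> bool"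
  where
  "conjugacy X f Y g h \<longleftrightarrow> (\<exists>k. homeomorphism X Y h k) \<and> (\<forall>x\<in>X. h (f x) = g (h x))"

definition conjugacy_class :: "real \<Rightarrow> real \<Rightarrow> nat \<Rightarrow> (real \<Rightarrow> real) \<Rightarrow> (real \<Rightarrow> real) set" where
  "conjugacy_class a b d f = {g \<in> exp_family a b d. \<exists>h. conjugacy {a..b} f {a..b} g h}"

text \<open>
  The branch of \<open>g\<close> that corresponds under a conjugacy \<open>h\<close> to the \<open>i\<close>-th branch of \<open>f\<close>: an increasing
  \<open>h\<close> preserves the indices, a decreasing one reverses them. For a decreasing \<open>h\<close> one cannot compare
  slopes of equal indices: the tent map on \<open>{0..1}\<close> with slopes \<open>2, -2\<close> is conjugate by
  \<open>x \<mapsto> 1 - x\<close> to the map with slopes \<open>-2, 2\<close>.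
\<close>

definition corresponding_branch :: "real \<Rightarrow> real \<Rightarrow> nat \<Rightarrow> (real \<Rightarrow> real) \<Rightarrow> nat \<Rightarrow> nat" where
  "corresponding_branch a b d h i = (if h a < h b then i else d - i)"


section \<open>Renormalization\<close>

text \<open>
  The definition is also applied to a return map \<open>f ^^ n\<close> on an interval \<open>I\<close> that need not be
  closed; the interval \<open>J\<close> of a renormalization is then required to satisfy
  \<open>closure J \<noteq> closure I\<close>. For \<open>N = {a..b}\<close> the condition is \<open>closure I \<noteq> N\<close>.
\<close>

definition renormalization :: "real set \<Rightarrow> (real \<Rightarrow> real) \<Rightarrow> real set \<Rightarrow> nat \<Rightarrow> bool" where
  "renormalization N f I n \<longleftrightarrow>
     is_interval I \<and> interior I \<noteq> {} \<and> I \<subseteq> N \<and> n \<ge> 1 \<and>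
     (f ^^ n) ` I \<subseteq> I \<and> closure I \<noteq> closure N \<and>
     disjoint_family_on (\<lambda>i. interior ((f ^^ i) ` I)) {..<n}"

definition renormalizable :: "real set \<Rightarrow> (real \<Rightarrow> real) \<Rightarrow> bool" where
  "renormalizable N f \<longleftrightarrow> (\<exists>I n. renormalization N f I n)"

definition minimal_cycle :: "real set \<Rightarrow> (real \<Rightarrow> real) \<Rightarrow> real set \<Rightarrow> bool" where
  "minimal_cycle N f C \<longleftrightarrow>
     (\<exists>I n. renormalization N f I n \<and> \<not> renormalizable I (f ^^ n) \<and> C = (\<Union>i<n. (f ^^ i) ` I)) \<or>
     (\<not> renormalizable N f \<and> C = N)"

definition essential_branches :: "real \<Rightarrow> real \<Rightarrow> nat \<Rightarrow> (real \<Rightarrow> real) \<Rightarrow> nat set" where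
  "essential_branches a b d f =
     {i. i \<le> d \<and> (\<exists>C. minimal_cycle {a..b} f C \<and>
                    C \<inter> {breakpoint a b d f i<..<breakpoint a b d f (Suc i)} \<noteq> {})}"

end

theory Submission
  imports Defs
begin

text \<open>
  Let \<open>h\<close> conjugate \<open>f\<close> to \<open>g\<close>, with the essential slopes of \<open>g\<close> at least as big as those of \<open>f\<close>. On an
  interval inside a branch, \<open>\<bar>h I\<bar> / \<bar>I\<bar>\<close> then does not decrease when \<open>I\<close> is replaced by its image,
  and on an interval that is cut it is an average over the pieces. As short intervals grow under
  iteration, the supremum of these quotients over a minimal cycle is attained. Hence \<open>h\<close> is affine
  with maximal slope on some interval, and so on all images of that interval; these visit every
  essential branch met by the cycle, because the return map is not renormalizable.

  For the codimension, a map with the same order pattern of critical orbits as \<open>f\<close> satisfies, for each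
  critical point \<open>c k\<close>, a kneading equation: the point coded by the itinerary of \<open>f (c k)\<close> equals the
  critical value. The coded point is a power series in the parameters. Moving all critical values
  so that all slopes grow in modulus, some kneading equation is violated to first order; otherwise the
  velocities of the coded points would form a bounded vector field whose difference quotients
  grow forever under \<open>f\<close>, which is impossible by the growth argument above.
\<close>

section \<open>Expansion along orbits\<close>

text \<open>Expansion is assumed only for some iterate and only where its derivative exists, so
  single slopes may have modulus below one and critical points carry no information. Everything is
  therefore phrased with the inverse slope \<open>\<tau>\<close>, set to 0 at critical points: its
  products along orbits decay geometrically and uniformly. This yields both the growth of short
  intervals and the convergence of the series for coded points. Itineraries jump when parameters
  move. The code is therefore frozen, which makes the coded point a smooth function on an open set
  of parameters. The kneading equation that is violated to first order may differ from one map of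
  the class to the next, so all of them are merged into one function. A decreasing conjugacy
  reverses the order pattern, so the class may consist of two halves with different codes; each gets
  its own hypersurface, and the union is again one because disjoint open sets separate them.\<close>

lemma product_decay:
  fixes p :: "'b \<Rightarrow> real"
  assumes inv: "\<And>x. x \<in> X \<Longrightarrow> F x \<in> X"
    and bd: "\<And>x. x \<in> X \<Longrightarrow> \<bar>p x\<bar> \<le> T"
    and N: "N \<ge> 1" and \<rho>: "0 \<le> \<rho>" "\<rho> < 1"
    and win: "\<And>x. x \<in> X \<Longrightarrow> \<bar>\<Prod>j<N. p ((F ^^ j) x)\<bar> \<le> \<rho>"
  obtains C r where "0 \<le> C" "0 < r" "r < 1" "\<And>x n. x \<in> X \<Longrightarrow> \<bar>\<Prod>j<n. p ((F ^^ j) x)\<bar> \<le> C * r ^ n"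
proof -
  \<comment> \<open>The maximum with 1/2 keeps \<open>r\<close> positive also for
    \<open>\<rho> = 0\<close>, as \<open>C\<close> divides by it.\<close>
  define r where "r = root N (max \<rho> (1/2))"
  have r: "0 < r" "r < 1" using N \<rho> by (auto simp: r_def)
  have rN: "r ^ N = max \<rho> (1/2)" using N by (simp add: r_def)
  define T' where "T' = max T 1"
  \<comment> \<open>Products of length at most \<open>N\<close> are bounded factor by factor by
    \<open>T'\<close>, and this constant absorbs them; each further window contributes
    \<open>r ^ N\<close>.\<close>
  define C where "C = (T' / r) ^ N"
  have T': "T' \<ge> 1" by (simp add: T'_def)
  have T'r: "T' / r \<ge> 1" using T' r by (simp add: field_simps)
  have C: "C \<ge> 0" unfolding C_def using T' r by simp
  have invj: "(F ^^ j) x \<in> X" if "x \<in> X" for x j using that inv by (induction j) auto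
  have short: "\<bar>\<Prod>j<n. p ((F ^^ j) x)\<bar> \<le> C * r ^ n" if "x \<in> X" "n \<le> N" for x n
  proof -
    have "\<bar>\<Prod>j<n. p ((F ^^ j) x)\<bar> = (\<Prod>j<n. \<bar>p ((F ^^ j) x)\<bar>)" by (simp add: abs_prod)
    also have "\<dots> \<le> (\<Prod>j<n. T')"
      by (rule prod_mono) (use bd[OF invj[OF that(1)]] in \<open>auto simp: T'_def le_max_iff_disj\<close>)
    also have "\<dots> = (T' / r) ^ n * r ^ n" using r by (simp add: power_divide)
    also have "\<dots> \<le> C * r ^ n" unfolding C_def
      using T'r that(2) r by (intro mult_right_mono power_increasing) auto
    finally show ?thesis .
  qed
  have "\<bar>\<Prod>j<n. p ((F ^^ j) x)\<bar> \<le> C * r ^ n" if "x \<in> X" for x n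
    using that
  proof (induction n arbitrary: x rule: less_induct)
    case (less n)
    show ?case
    proof (cases "n \<le> N")
      case True then show ?thesis using short less by blast
    next
      case False
      define m where "m = n - N"
      have n: "n = N + m" "m < n" using False N by (auto simp: m_def)
      have "(\<Prod>j<n. p ((F ^^ j) x)) = (\<Prod>j<N. p ((F ^^ j) x)) * (\<Prod>j<m. p ((F ^^ j) ((F ^^ N) x)))"
      proof -
        have "(\<Prod>j<N+m. p ((F ^^ j) x)) = (\<Prod>j<N. p ((F ^^ j) x)) * (\<Prod>j<m. p ((F ^^ (N + j)) x))"
          by (induction m) auto
        then show ?thesis by (simp add: n(1) funpow_add add.commute[of N])
      qed
      then have "\<bar>\<Prod>j<n. p ((F ^^ j) x)\<bar> = \<bar>\<Prod>j<N. p ((F ^^ j) x)\<bar> * \<bar>\<Prod>j<m. p ((F ^^ j) ((F ^^ N) x))\<bar>"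
        by (simp add: abs_mult)
      also have "\<dots> \<le> r ^ N * (C * r ^ m)"
        by (rule mult_mono) (use win[OF less.prems] rN less.IH[OF n(2) invj[OF less.prems]] r C in auto)
      also have "\<dots> = C * r ^ n" by (simp add: n(1) power_add)
      finally show ?thesis .
    qed
  qed
  then show ?thesis using that C r by blast
qed

section \<open>Branches, critical points and derivatives of iterates\<close>

locale piecewise_affine =
  fixes a b :: real and d :: nat and f :: "real \<Rightarrow> real" and c s :: "nat \<Rightarrow> real"
  assumes ab: "a < b"
    and f_in: "x \<in> {a..b} \<Longrightarrow> f x \<in> {a..b}"
    and f_cont: "continuous_on {a..b} f"
    and branches: "affine_branches a b d f c s"
begin

lemma c_ends: "c 0 = a" "c (Suc d) = b"
  using branches unfolding affine_branches_def by metis+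

lemma c_less: "i < j \<Longrightarrow> j \<le> Suc d \<Longrightarrow> c i < c j"
proof (induction j)
  case (Suc j)
  have "c j < c (Suc j)" using affine_branchesD(1)[OF branches, of j] Suc by simp
  then show ?case using Suc by (cases "i = j") (auto simp: less_Suc_eq)
qed simp

lemma c_le: "i \<le> j \<Longrightarrow> j \<le> Suc d \<Longrightarrow> c i \<le> c j"
  using c_less[of i j] by (cases "i = j") auto

lemma c_in: "i \<le> Suc d \<Longrightarrow> c i \<in> {a..b}"
  using c_le[of 0 i] c_le[of i "Suc d"] c_ends by auto

lemma f_affine:
  "i \<le> d \<Longrightarrow> x \<in> {c i..c (Suc i)} \<Longrightarrow> y \<in> {c i..c (Suc i)} \<Longrightarrow> f y - f x = s i * (y - x)"
  using affine_branchesD(2)[OF branches, of i x] affine_branchesD(2)[OF branches, of i y]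
  by (simp add: algebra_simps)

lemma branch_subset: "i \<le> d \<Longrightarrow> {c i..c (Suc i)} \<subseteq> {a..b}"
  using c_in[of i] c_in[of "Suc i"] by auto

lemma funpow_in: "x \<in> {a..b} \<Longrightarrow> (f ^^ j) x \<in> {a..b}"
  using f_in by (induction j) auto

lemma funpow_cont: "continuous_on {a..b} (f ^^ j)"
proof (induction j)
  case 0
  then show ?case by (simp add: id_def)
next
  case (Suc j)
  have "continuous_on ((f ^^ j) ` {a..b}) f"
    by (rule continuous_on_subset[OF f_cont]) (use funpow_in in blast)
  then show ?case using continuous_on_compose[OF Suc] by simp
qed

definition crit :: "real \<Rightarrow> bool" where "crit x \<longleftrightarrow> (\<exists>l\<in>{1..d}. x = c l)"

text \<open>The strict inequality puts a critical point on the branch to its left, whose right end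
  point it is. The flag in the letters of a code relies on this.\<close>

definition branch_idx :: "real \<Rightarrow> nat" where "branch_idx x = card {l\<in>{1..d}. c l < x}"

text \<open>The default 0 at critical points makes a product along an orbit vanish as soon as the
  orbit hits one, so that bounds on these products hold even where iterates have no
  derivative.\<close>

definition \<tau> :: "real \<Rightarrow> real" where "\<tau> x = (if crit x then 0 else 1 / s (branch_idx x))"

lemma branch_idx_eq:
  assumes "i \<le> d" "c i < x \<or> i = 0" "x \<le> c (Suc i)" "x \<in> {a..b}"
  shows "branch_idx x = i"
proof -
  have "{l\<in>{1..d}. c l < x} = {1..i}"
  proof (intro subset_antisym subsetI)
    fix l assume "l \<in> {l\<in>{1..d}. c l < x}"
    then have l: "1 \<le> l" "l \<le> d" "c l < x" by auto
    have "\<not> Suc i \<le> l" using c_le[of "Suc i" l] l assms by auto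
    then show "l \<in> {1..i}" using l by auto
  next
    fix l assume "l \<in> {1..i}"
    then show "l \<in> {l\<in>{1..d}. c l < x}" using c_le[of l i] assms by auto
  qed
  then show ?thesis by (simp add: branch_idx_def)
qed

lemma branch_cases:
  assumes "x \<in> {a..b}"
  obtains i where "i \<le> d" "c i < x \<or> i = 0" "x \<le> c (Suc i)"
proof -
  define i where "i = (LEAST i. x \<le> c (Suc i))"
  have ex: "x \<le> c (Suc d)" using assms c_ends by simp
  have 1: "x \<le> c (Suc i)" unfolding i_def by (rule LeastI) (rule ex)
  have 2: "i \<le> d" unfolding i_def by (rule Least_le) (rule ex)
  have 3: "c i < x" if "i \<noteq> 0"
  proof -
    obtain j where j: "i = Suc j" using \<open>i \<noteq> 0\<close> not0_implies_Suc by blast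
    have "\<not> x \<le> c (Suc j)"
    proof
      assume "x \<le> c (Suc j)"
      then have "i \<le> j" unfolding i_def by (rule Least_le)
      then show False using j by simp
    qed
    then show ?thesis using j by simp
  qed
  show ?thesis using that 1 2 3 by blast
qed

lemma branch_idx_le: "branch_idx x \<le> d"
proof -
  have "card {l\<in>{1..d}. c l < x} \<le> card {1..d}" by (rule card_mono) auto
  then show ?thesis by (simp add: branch_idx_def)
qed

lemma in_branch_idx:
  assumes "x \<in> {a..b}"
  shows "x \<in> {c (branch_idx x)..c (Suc (branch_idx x))}"
proof -
  obtain i where i: "i \<le> d" "c i < x \<or> i = 0" "x \<le> c (Suc i)"
    by (rule branch_cases[OF assms])
  have *: "branch_idx x = i" by (rule branch_idx_eq[OF i assms])
  have "c i \<le> x" using i(2) assms c_ends(1) by (elim disjE) simp_all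
  then show ?thesis unfolding * using i(3) by simp
qed

lemma crit_idx:
  assumes "crit x"
  shows "x = c (Suc (branch_idx x)) \<and> Suc (branch_idx x) \<in> {1..d}"
proof -
  from assms obtain l where l: "l \<in> {1..d}" "x = c l" unfolding crit_def by blast
  have "branch_idx (c l) = l - 1"
  proof (rule branch_idx_eq)
    show "c (l - 1) < c l \<or> l - 1 = 0" using c_less[of "l - 1" l] l(1) by simp
    show "c l \<in> {a..b}" using c_in[of l] l(1) by simp
    show "l - 1 \<le> d" using l(1) diff_le_self[of l 1] by (meson atLeastAtMost_iff order_trans)
    show "c l \<le> c (Suc (l - 1))" using l(1) by simp
  qed
  then show ?thesis unfolding l(2) using l(1) by simp
qed

lemma noncrit_strict:
  assumes "x \<in> {a..b}" "\<not> crit x"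
  shows "(c (branch_idx x) < x \<or> branch_idx x = 0) \<and> (x < c (Suc (branch_idx x)) \<or> branch_idx x = d)"
proof -
  let ?i = "branch_idx x"
  have "x \<in> {c ?i..c (Suc ?i)}" using in_branch_idx assms by blast
  moreover have "x \<noteq> c ?i" if "?i \<noteq> 0"
  proof -
    have "?i \<in> {1..d}" using that branch_idx_le[of x] by simp
    then show ?thesis using assms(2) unfolding crit_def by blast
  qed
  moreover have "x \<noteq> c (Suc ?i)" if "?i \<noteq> d"
  proof -
    have "Suc ?i \<in> {1..d}" using that branch_idx_le[of x] by simp
    then show ?thesis using assms(2) unfolding crit_def by blast
  qed
  ultimately show ?thesis by (metis atLeastAtMost_iff le_less)
qed

lemma branch_idx_interior:
  assumes *: "i \<le> d" "c i < x" "x < c (Suc i)"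
  shows "branch_idx x = i \<and> \<not> crit x"
proof -
  have x: "x \<in> {a..b}" using branch_subset[OF *(1)] * by auto
  have 1: "branch_idx x = i" using * x by (intro branch_idx_eq) simp_all
  moreover have "\<not> crit x"
  proof
    assume "crit x"
    then have "x = c (Suc i)" using crit_idx 1 by metis
    then show False using *(3) by simp
  qed
  ultimately show ?thesis by simp
qed

lemma deriv_f:
  assumes "x \<in> {a..b}" "\<not> crit x"
  shows "(f has_real_derivative s (branch_idx x)) (at x within {a..b})"
proof -
  let ?i = "branch_idx x"
  \<comment> \<open>An open set whose trace on {a..b} lies in one branch. The alternatives
    \<open>?i = 0\<close> and \<open>?i = d\<close> admit the end points \<open>a\<close> and
    \<open>b\<close>, where the derivative is one-sided.\<close>
  define U where "U = {y. (c ?i < y \<or> ?i = 0) \<and> (y < c (Suc ?i) \<or> ?i = d)}"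
  have "open {y. c ?i < y \<or> ?i = 0}" "open {y. y < c (Suc ?i) \<or> ?i = d}"
    by (cases "?i = 0"; simp add: open_Collect_less)
       (cases "?i = d"; simp add: open_Collect_less)
  then have U: "open U" unfolding U_def by (rule open_Collect_conj)
  have xU: "x \<in> U" using noncrit_strict[OF assms] by (simp add: U_def)
  have "((\<lambda>y. f x + s ?i * (y - x)) has_real_derivative s ?i) (at x within {a..b})"
    by (auto intro!: derivative_eq_intros)
  moreover obtain e where e: "e > 0" "\<And>y. dist y x < e \<Longrightarrow> y \<in> U"
    using U xU unfolding open_dist by blast
  ultimately show ?thesis
    apply -
  proof (erule has_field_derivative_transform_within[OF _ \<open>e > 0\<close> assms(1)])
    fix y assume y: "y \<in> {a..b}" "dist y x < e"
    have "y \<in> {c ?i..c (Suc ?i)}"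
      using e(2)[OF y(2)] y(1) c_ends by (auto simp: U_def)
    then show "f x + s ?i * (y - x) = f y"
      using f_affine[OF branch_idx_le, of x x y] in_branch_idx[OF assms(1)] by simp
  qed
qed

lemma deriv_funpow:
  assumes "x \<in> {a..b}" "\<And>j. j < n \<Longrightarrow> \<not> crit ((f ^^ j) x)"
  shows "((f ^^ n) has_real_derivative (\<Prod>j<n. s (branch_idx ((f ^^ j) x)))) (at x within {a..b})"
  using assms(2)
proof (induction n)
  case 0
  show ?case by (auto intro!: derivative_eq_intros simp: id_def)
next
  case (Suc n)
  have "(f has_real_derivative s (branch_idx ((f ^^ n) x))) (at ((f ^^ n) x) within (f ^^ n) ` {a..b})"
    by (rule DERIV_subset[OF deriv_f]) (use funpow_in assms(1) Suc in auto)
  moreover have "((f ^^ n) has_real_derivative (\<Prod>j<n. s (branch_idx ((f ^^ j) x)))) (at x within {a..b})"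
    using Suc by simp
  ultimately have "(f \<circ> f ^^ n has_real_derivative
      s (branch_idx ((f ^^ n) x)) * (\<Prod>j<n. s (branch_idx ((f ^^ j) x)))) (at x within {a..b})"
    by (rule DERIV_image_chain)
  then show ?case by (simp add: mult.commute o_def)
qed

end

locale expanding_affine = piecewise_affine +
  assumes expanding: "eventually_expanding {a..b} f"
begin

text \<open>With a single branch the alternation of signs is an empty condition; there the expansion
  of \<open>f ^^ n\<close>, whose derivative is \<open>s 0 ^ n\<close>, excludes the slope
  0.\<close>

lemma slope_nonzero: "i \<le> d \<Longrightarrow> s i \<noteq> 0"
proof (cases "d = 0")
  case True
  assume i: "i \<le> d"
  obtain n where n: "n \<ge> 1" "\<And>x D. x \<in> {a..b} \<Longrightarrow> ((f ^^ n) has_real_derivative D) (at x within {a..b}) \<Longrightarrow> \<bar>D\<bar> > 1"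
    using expanding unfolding eventually_expanding_def by blast
  have a: "a \<in> {a..b}" using ab by simp
  have "\<not> crit x" for x unfolding crit_def using True by simp
  moreover have "branch_idx x = 0" for x unfolding branch_idx_def using True by simp
  ultimately have "\<bar>s 0 ^ n\<bar> > 1" using n(2)[OF a deriv_funpow[OF a, of n]] by simp
  then show ?thesis using i True n(1) by (auto simp: power_0_left)
next
  case False
  assume i: "i \<le> d"
  show ?thesis
  proof (cases "i < d")
    case True then show ?thesis using affine_branchesD(3)[OF branches True] by auto
  next
    case f: False
    then have "Suc (d - 1) = i" "d - 1 < d" using False i by auto
    then show ?thesis using affine_branchesD(3)[OF branches, of "d - 1"] by auto
  qed
qed

text \<open>At each point the modulus is below 1: by expansion if the orbit segment avoids critical
  points, by the value 0 otherwise. All factors come from one finite set, so only finitely many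
  products occur and their maximum is still below 1.\<close>

lemma tau_window:
  obtains N \<rho> where "N \<ge> 1" "0 \<le> \<rho>" "\<rho> < 1" "\<And>x. x \<in> {a..b} \<Longrightarrow> \<bar>\<Prod>j<N. \<tau> ((f ^^ j) x)\<bar> \<le> \<rho>"
proof -
  obtain n where n: "n \<ge> 1" "\<And>x D. x \<in> {a..b} \<Longrightarrow> ((f ^^ n) has_real_derivative D) (at x within {a..b}) \<Longrightarrow> \<bar>D\<bar> > 1"
    using expanding unfolding eventually_expanding_def by blast
  define W where "W = (\<lambda>x. \<bar>\<Prod>j<n. \<tau> ((f ^^ j) x)\<bar>) ` {a..b}"
  define V where "V = insert 0 ((\<lambda>i. 1 / s i) ` {..d})"
  have tV: "\<tau> x \<in> V" for x using branch_idx_le by (auto simp: \<tau>_def V_def)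
  have "W \<subseteq> (\<lambda>w. \<bar>prod_list w\<bar>) ` {w. set w \<subseteq> V \<and> length w = n}"
  proof
    fix y assume "y \<in> W"
    then obtain x where "y = \<bar>\<Prod>j<n. \<tau> ((f ^^ j) x)\<bar>" by (auto simp: W_def)
    then have "y = \<bar>prod_list (map (\<lambda>j. \<tau> ((f ^^ j) x)) [0..<n])\<bar>"
      by (simp add: prod.distinct_set_conv_list[symmetric] atLeast0LessThan)
    then show "y \<in> (\<lambda>w. \<bar>prod_list w\<bar>) ` {w. set w \<subseteq> V \<and> length w = n}"
      using tV by (intro image_eqI) auto
  qed
  moreover have "finite {w. set w \<subseteq> V \<and> length w = n}" by (rule finite_lists_length_eq) (simp add: V_def)
  ultimately have fin: "finite W" by (rule finite_surj[rotated])
  have lt: "y < 1" if y: "y \<in> W" for y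
  proof -
    obtain x where x: "x \<in> {a..b}" "y = \<bar>\<Prod>j<n. \<tau> ((f ^^ j) x)\<bar>" using y unfolding W_def by blast
    show ?thesis
    proof (cases "\<exists>j<n. crit ((f ^^ j) x)")
      case True
      then have "(\<Prod>j<n. \<tau> ((f ^^ j) x)) = 0" by (auto simp: \<tau>_def)
      then show ?thesis unfolding x(2) by (metis abs_zero zero_less_one)
    next
      case False
      let ?P = "\<Prod>j<n. s (branch_idx ((f ^^ j) x))"
      have "(\<Prod>j<n. \<tau> ((f ^^ j) x)) = 1 / ?P"
        using False by (simp add: \<tau>_def prod_dividef)
      moreover have P: "\<bar>?P\<bar> > 1" using n(2)[OF x(1) deriv_funpow] x(1) False by blast
      moreover have "1 / \<bar>?P\<bar> < 1" using P divide_less_eq_1_pos[of "\<bar>?P\<bar>" 1] by linarith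
      ultimately show ?thesis unfolding x(2) by (simp only: abs_divide abs_one)
    qed
  qed
  have ne: "W \<noteq> {}" using ab by (simp add: W_def)
  have "Max W < 1" using Max_in[OF fin ne] lt by blast
  moreover have "y \<le> Max W" if "y \<in> W" for y using fin that by simp
  moreover have "0 \<le> y" if "y \<in> W" for y using that by (auto simp: W_def)
  then have "0 \<le> Max W" using Max_in[OF fin ne] by blast
  ultimately show ?thesis using that[of n "Max W"] n(1) by (auto simp: W_def)
qed

lemma tau_bound:
  obtains T where "\<And>x. \<bar>\<tau> x\<bar> \<le> T"
proof
  fix x
  have "\<bar>1 / s (branch_idx x)\<bar> \<le> (\<Sum>i\<le>d. \<bar>1 / s i\<bar>)"
    by (rule member_le_sum) (use branch_idx_le in auto)
  moreover have "(\<Sum>i\<le>d. \<bar>1 / s i\<bar>) \<ge> 0" by (rule sum_nonneg) auto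
  ultimately show "\<bar>\<tau> x\<bar> \<le> (\<Sum>i\<le>d. \<bar>1 / s i\<bar>)" by (simp add: \<tau>_def)
qed

lemma tau_decay:
  obtains C r where "0 \<le> C" "0 < r" "r < 1" "\<And>x n. x \<in> {a..b} \<Longrightarrow> \<bar>\<Prod>j<n. \<tau> ((f ^^ j) x)\<bar> \<le> C * r ^ n"
proof -
  obtain N \<rho> where N: "N \<ge> 1" "0 \<le> \<rho>" "\<rho> < 1" "\<And>x. x \<in> {a..b} \<Longrightarrow> \<bar>\<Prod>j<N. \<tau> ((f ^^ j) x)\<bar> \<le> \<rho>"
    by (rule tau_window) blast
  obtain T where T: "\<And>x. \<bar>\<tau> x\<bar> \<le> T" by (rule tau_bound) blast
  show ?thesis
    by (rule product_decay[of "{a..b}" f \<tau> T N \<rho>, OF f_in T N that])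
qed

end

lemma real_ivt_segment:
  fixes g :: "real \<Rightarrow> real"
  assumes "continuous_on S g" "is_interval S" "x \<in> S" "y \<in> S" "min (g x) (g y) \<le> w" "w \<le> max (g x) (g y)"
  obtains z where "z \<in> {min x y..max x y}" "g z = w"
proof -
  have sub: "{min x y..max x y} \<subseteq> S"
  proof
    fix w assume "w \<in> {min x y..max x y}"
    moreover have "min x y \<in> S" "max x y \<in> S" using assms(3,4) by (simp_all add: min_def max_def)
    ultimately show "w \<in> S" using mem_is_interval_1_I[OF assms(2)] by (meson atLeastAtMost_iff)
  qed
  have "connected (g ` {min x y..max x y})"
    by (intro connected_continuous_image continuous_on_subset[OF assms(1) sub]) simp
  moreover have "g x \<in> g ` {min x y..max x y}" "g y \<in> g ` {min x y..max x y}" by auto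
  ultimately have "{min (g x) (g y)..max (g x) (g y)} \<subseteq> g ` {min x y..max x y}"
    by (intro connected_contains_Icc) (auto simp: min_def max_def)
  then have "w \<in> g ` {min x y..max x y}" using assms(5,6) by auto
  then show ?thesis using that by blast
qed

context piecewise_affine
begin

text \<open>If the iterate left the branch, the intermediate value theorem would produce a point
  strictly between \<open>u\<close> and \<open>v\<close> that is sent to a critical end point of the
  branch. Hits at \<open>u\<close> and \<open>v\<close> themselves do no harm, since the branch is
  closed.\<close>

lemma no_crit_same_branch:
  assumes uv: "u < v" "u \<in> {a..b}" "v \<in> {a..b}"
    and nc: "\<And>x. u < x \<Longrightarrow> x < v \<Longrightarrow> \<not> crit ((f ^^ j) x)"
    and m: "u < m" "m < v"
    and x: "x \<in> {u..v}"
  shows "(f ^^ j) x \<in> {c (branch_idx ((f ^^ j) m))..c (Suc (branch_idx ((f ^^ j) m)))}"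
proof (rule ccontr)
  let ?g = "f ^^ j" and ?i = "branch_idx ((f ^^ j) m)"
  have m_in: "m \<in> {a..b}" and x_in: "x \<in> {a..b}" using m uv x by auto
  note st = noncrit_strict[OF funpow_in[OF m_in] nc[OF m]]
  have hit: False if w: "crit w" "w \<noteq> ?g x" "min (?g m) (?g x) \<le> w" "w \<le> max (?g m) (?g x)" for w
  proof -
    obtain z where z: "z \<in> {min m x..max m x}" "?g z = w"
      using real_ivt_segment[OF funpow_cont is_interval_cc m_in x_in w(3,4)] by blast
    then have "z \<noteq> x" using that(2) by auto
    then have "u < z" "z < v" using z(1) m x by (auto simp: min_def max_def split: if_splits)
    then show False using nc z(2) that(1) by blast
  qed
  assume "?g x \<notin> {c ?i..c (Suc ?i)}"
  then consider "?g x < c ?i" | "?g x > c (Suc ?i)" by fastforce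
  then show False
  proof cases
    case 1
    have "?i \<noteq> 0" using 1 funpow_in[OF x_in, of j] c_ends(1) by (metis atLeastAtMost_iff not_less)
    then have "c ?i < ?g m" "crit (c ?i)" using st branch_idx_le[of "?g m"] by (auto simp: crit_def)
    then show False using hit[of "c ?i"] 1 by simp
  next
    case 2
    have "?i \<noteq> d" using 2 funpow_in[OF x_in, of j] c_ends(2) by (metis atLeastAtMost_iff not_less)
    then have "?g m < c (Suc ?i)" "Suc ?i \<in> {1..d}" using st branch_idx_le[of "?g m"] by auto
    then have "?g m < c (Suc ?i)" "crit (c (Suc ?i))" unfolding crit_def by blast+
    then show False using hit[of "c (Suc ?i)"] 2 by simp
  qed
qed

lemma no_crit_affine:
  assumes uv: "u < v" "u \<in> {a..b}" "v \<in> {a..b}"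
    and nc: "\<And>j x. j < n \<Longrightarrow> u < x \<Longrightarrow> x < v \<Longrightarrow> \<not> crit ((f ^^ j) x)"
    and m: "u < m" "m < v"
  shows "(f ^^ n) v - (f ^^ n) u = (\<Prod>j<n. s (branch_idx ((f ^^ j) m))) * (v - u)"
  using nc
proof (induction n)
  case (Suc n)
  have "(f ^^ n) v \<in> {c (branch_idx ((f ^^ n) m))..c (Suc (branch_idx ((f ^^ n) m)))}"
    "(f ^^ n) u \<in> {c (branch_idx ((f ^^ n) m))..c (Suc (branch_idx ((f ^^ n) m)))}"
    using uv by (intro no_crit_same_branch[OF uv _ m] Suc.prems; simp)+
  then have "f ((f ^^ n) v) - f ((f ^^ n) u) = s (branch_idx ((f ^^ n) m)) * ((f ^^ n) v - (f ^^ n) u)"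
    by (intro f_affine branch_idx_le)
  then show ?case using Suc by simp
qed simp

text \<open>The factor 4 pays for one cut: an interval that falls into two such pieces still gains a
  factor 2 on the longer one.\<close>

definition clean :: "nat \<Rightarrow> real \<Rightarrow> real \<Rightarrow> bool" where
  "clean N u v \<longleftrightarrow> \<bar>(f ^^ N) v - (f ^^ N) u\<bar> \<ge> 4 * \<bar>v - u\<bar> \<and>
     (\<forall>j<N. \<exists>i\<le>d. (f ^^ j) u \<in> {c i..c (Suc i)} \<and> (f ^^ j) v \<in> {c i..c (Suc i)})"

end

context expanding_affine
begin

lemma finite_preimage:
  assumes "finite S"
  shows "finite {x \<in> {a..b}. (f ^^ j) x \<in> S}"
proof (induction j)
  case 0
  show ?case by (rule finite_subset[OF _ assms]) auto
next
  case (Suc j)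
  define S' where "S' = {x \<in> {a..b}. (f ^^ j) x \<in> S}"
  have "{x \<in> {a..b}. (f ^^ Suc j) x \<in> S} \<subseteq> (\<Union>i\<le>d. f -` S' \<inter> {c i..c (Suc i)})"
  proof
    fix x assume "x \<in> {x \<in> {a..b}. (f ^^ Suc j) x \<in> S}"
    then have x: "x \<in> {a..b}" "(f ^^ j) (f x) \<in> S" by (simp_all add: funpow_swap1)
    then have "f x \<in> S'" using f_in by (simp add: S'_def)
    then show "x \<in> (\<Union>i\<le>d. f -` S' \<inter> {c i..c (Suc i)})"
      using in_branch_idx[OF x(1)] branch_idx_le[of x] by blast
  qed
  moreover have "finite (f -` S' \<inter> {c i..c (Suc i)})" if "i \<le> d" for i
  proof (rule finite_vimage_IntI)
    show "finite S'" using Suc by (simp add: S'_def)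
    show "inj_on f {c i..c (Suc i)}"
    proof (rule inj_onI)
      fix x y assume "x \<in> {c i..c (Suc i)}" "y \<in> {c i..c (Suc i)}" "f x = f y"
      then have "s i * (y - x) = 0" using f_affine[OF \<open>i \<le> d\<close>, of x y] by simp
      then show "x = y" using slope_nonzero[OF \<open>i \<le> d\<close>] by simp
    qed
  qed
  ultimately show ?case by (meson finite_UN_I finite_atMost atMost_iff finite_subset)
qed

lemma finite_crit: "finite {x \<in> {a..b}. crit ((f ^^ j) x)}"
proof -
  have "crit = (\<lambda>x. x \<in> c ` {1..d})" by (auto simp: crit_def fun_eq_iff)
  then show ?thesis using finite_preimage[of "c ` {1..d}" j] by simp
qed

text \<open>On an interval free of hits the slope of \<open>f ^^ N\<close> is the reciprocal of a
  product of \<open>\<tau>\<close>, hence of modulus at least 4 for large \<open>N\<close>. Only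
  finitely many points hit a critical point before time \<open>N\<close>, so an interval shorter
  than their smallest gap is cut at most once. The divisibility makes \<open>f ^^ N\<close> an
  iterate of a given return map \<open>f ^^ n\<close>.\<close>

lemma expansion:
  assumes "n \<ge> 1"
  obtains N \<delta> where "N \<ge> 1" "n dvd N" "\<delta> > 0"
    "\<And>x y. x < y \<Longrightarrow> x \<in> {a..b} \<Longrightarrow> y \<in> {a..b} \<Longrightarrow> y - x < \<delta> \<Longrightarrow>
      \<exists>z. x \<le> z \<and> z \<le> y \<and> (x < z \<longrightarrow> clean N x z) \<and> (z < y \<longrightarrow> clean N z y)"
proof -
  obtain C r where C: "0 \<le> C" "0 < r" "r < 1"
    "\<And>x n. x \<in> {a..b} \<Longrightarrow> \<bar>\<Prod>j<n. \<tau> ((f ^^ j) x)\<bar> \<le> C * r ^ n"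
    by (rule tau_decay) blast
  obtain k where k: "r ^ k < 1 / (4 * (C + 1))"
    using real_arch_pow_inv[of "1 / (4 * (C + 1))" r] C by auto
  define N where "N = n * Suc k"
  have "1 * k \<le> n * Suc k" using assms by (intro mult_le_mono) auto
  then have N: "N \<ge> 1" "n dvd N" "k \<le> N" using assms by (auto simp: N_def)
  have "r ^ N \<le> r ^ k" using C N by (intro power_decreasing) auto
  then have "r ^ N \<le> 1 / (4 * (C + 1))" using k by linarith
  then have "C * r ^ N \<le> (C + 1) * (1 / (4 * (C + 1)))" using C by (intro mult_mono) auto
  also have "\<dots> = 1 / 4" using C by (simp add: field_simps)
  finally have CN: "C * r ^ N \<le> 1 / 4" .
  define P where "P = (\<Union>j<N. {x \<in> {a..b}. crit ((f ^^ j) x)})"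
  have finP: "finite P" unfolding P_def using finite_crit by blast
  \<comment> \<open>The inserted 1 is the value of the minimum when there are no two distinct
    cutting points.\<close>
  define \<delta> where "\<delta> = Min (insert 1 ((\<lambda>(p, q). \<bar>p - q\<bar>) ` {(p, q) \<in> P \<times> P. p \<noteq> q}))"
  have fin2: "finite {(p, q) \<in> P \<times> P. p \<noteq> q}" by (rule finite_subset[of _ "P \<times> P"]) (use finP in auto)
  have \<delta>: "\<delta> > 0" unfolding \<delta>_def using fin2 by (subst Min_gr_iff) auto
  have gap: "\<delta> \<le> \<bar>p - q\<bar>" if "p \<in> P" "q \<in> P" "p \<noteq> q" for p q
    unfolding \<delta>_def using fin2 that by (intro Min_le) (auto intro!: image_eqI[of _ _ "(p, q)"])
  have cl: "clean N u v" if uv: "u < v" "u \<in> {a..b}" "v \<in> {a..b}" and np: "\<And>x. u < x \<Longrightarrow> x < v \<Longrightarrow> x \<notin> P" for u v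
  proof -
    define m where "m = (u + v) / 2"
    have m: "u < m" "m < v" "m \<in> {a..b}" using uv by (auto simp: m_def)
    have nc: "\<not> crit ((f ^^ j) x)" if "j < N" "u < x" "x < v" for j x
      using np[OF that(2,3)] that uv by (auto simp: P_def)
    let ?S = "\<Prod>j<N. s (branch_idx ((f ^^ j) m))"
    have "(\<Prod>j<N. \<tau> ((f ^^ j) m)) = 1 / ?S"
      using nc m by (simp add: \<tau>_def prod_dividef)
    then have "\<bar>1 / ?S\<bar> \<le> 1 / 4" using C(4)[OF m(3), of N] CN by (metis order_trans)
    moreover have "?S \<noteq> 0" using slope_nonzero branch_idx_le by (simp only: prod_zero_iff finite_lessThan) blast
    ultimately have "\<bar>?S\<bar> \<ge> 4" by (simp only: abs_divide abs_one) (simp add: field_simps del: prod_zero_iff)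
    moreover have "(f ^^ N) v - (f ^^ N) u = ?S * (v - u)"
      by (rule no_crit_affine[OF uv nc m(1,2)])
    ultimately have "\<bar>(f ^^ N) v - (f ^^ N) u\<bar> \<ge> 4 * \<bar>v - u\<bar>"
      by (simp only: abs_mult) (rule mult_right_mono; simp)
    moreover have "\<exists>i\<le>d. (f ^^ j) u \<in> {c i..c (Suc i)} \<and> (f ^^ j) v \<in> {c i..c (Suc i)}" if "j < N" for j
    proof -
      have "(f ^^ j) x \<in> {c (branch_idx ((f ^^ j) m))..c (Suc (branch_idx ((f ^^ j) m)))}" if "x \<in> {u..v}" for x
        by (rule no_crit_same_branch[OF uv nc[OF \<open>j < N\<close>] m(1,2) that])
      then show ?thesis using branch_idx_le uv(1) by (meson atLeastAtMost_iff less_imp_le order_refl)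
    qed
    ultimately show ?thesis by (simp add: clean_def)
  qed
  have "\<exists>z. x \<le> z \<and> z \<le> y \<and> (x < z \<longrightarrow> clean N x z) \<and> (z < y \<longrightarrow> clean N z y)"
    if xy: "x < y" "x \<in> {a..b}" "y \<in> {a..b}" "y - x < \<delta>" for x y
  proof (cases "\<exists>z\<in>P. x < z \<and> z < y")
    case True
    then obtain z where z: "z \<in> P" "x < z" "z < y" by blast
    have only: "p = z" if "p \<in> P" "x < p" "p < y" for p
    proof (rule ccontr)
      assume "p \<noteq> z"
      then have "\<delta> \<le> \<bar>p - z\<bar>" using gap that z by blast
      then show False using that z xy(4) by linarith
    qed
    have zin: "z \<in> {a..b}" using z xy by auto
    have "clean N x z" using only z by (intro cl xy zin) force+
    moreover have "clean N z y" using only z by (intro cl xy zin) force+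
    ultimately show ?thesis using z by (intro exI[of _ z]) auto
  next
    case False
    then have "clean N x y" by (intro cl xy) blast
    then show ?thesis using xy by (intro exI[of _ y]) auto
  qed
  then show ?thesis using that[OF N(1,2) \<delta>] by blast
qed

text \<open>
  A quotient bound that holds at large scale spreads to all scales, since difference quotients
  do not decrease along the dynamics and a short interval is cut into at most two pieces, each
  expanded by a factor at least \<open>4\<close>: the error term is halved by every application of \<open>f ^^ N\<close>.
\<close>

lemma quotient_bound_spreads:
  fixes \<alpha> :: "real \<Rightarrow> real" and J :: "real \<Rightarrow> real \<Rightarrow> bool"
  assumes exp: "\<And>x y. x < y \<Longrightarrow> x \<in> {a..b} \<Longrightarrow> y \<in> {a..b} \<Longrightarrow> y - x < \<delta> \<Longrightarrow>
      \<exists>z. x \<le> z \<and> z \<le> y \<and> (x < z \<longrightarrow> clean N x z) \<and> (z < y \<longrightarrow> clean N z y)"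
    and J_sym: "\<And>x y. J x y \<Longrightarrow> J y x"
    and J_in: "\<And>x y. J x y \<Longrightarrow> x \<in> {a..b}"
    and J_sub: "\<And>x y z. J x y \<Longrightarrow> x \<le> z \<Longrightarrow> z \<le> y \<Longrightarrow> J x z \<and> J z y"
    and J_img: "\<And>x y i. J x y \<Longrightarrow> i \<le> d \<Longrightarrow> x \<in> {c i..c (Suc i)} \<Longrightarrow> y \<in> {c i..c (Suc i)} \<Longrightarrow> x \<noteq> y \<Longrightarrow>
       J (f x) (f y) \<and> (\<alpha> y - \<alpha> x) / (y - x) \<le> (\<alpha> (f y) - \<alpha> (f x)) / (f y - f x)"
    and bd: "\<And>x y. J x y \<Longrightarrow> \<bar>\<alpha> y - \<alpha> x\<bar> \<le> A"
    and big: "\<And>x y. J x y \<Longrightarrow> x < y \<Longrightarrow> y - x \<ge> \<delta> \<Longrightarrow> \<alpha> y - \<alpha> x \<le> M * (y - x)"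
    and xy: "J x y" "x < y"
  shows "\<alpha> y - \<alpha> x \<le> M * (y - x)"
proof -
  have img: "J ((f ^^ n) u) ((f ^^ n) v) \<and> (f ^^ n) u \<noteq> (f ^^ n) v \<and>
      (\<alpha> v - \<alpha> u) / (v - u) \<le> (\<alpha> ((f ^^ n) v) - \<alpha> ((f ^^ n) u)) / ((f ^^ n) v - (f ^^ n) u)"
    if "J u v" "u \<noteq> v" "\<forall>j<n. \<exists>i\<le>d. (f ^^ j) u \<in> {c i..c (Suc i)} \<and> (f ^^ j) v \<in> {c i..c (Suc i)}" for n u v
    using that
  proof (induction n)
    case (Suc n)
    then have IH: "J ((f ^^ n) u) ((f ^^ n) v)" "(f ^^ n) u \<noteq> (f ^^ n) v"
      "(\<alpha> v - \<alpha> u) / (v - u) \<le> (\<alpha> ((f ^^ n) v) - \<alpha> ((f ^^ n) u)) / ((f ^^ n) v - (f ^^ n) u)" by auto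
    obtain i where i: "i \<le> d" "(f ^^ n) u \<in> {c i..c (Suc i)}" "(f ^^ n) v \<in> {c i..c (Suc i)}"
      using Suc.prems(3) by blast
    have "f ((f ^^ n) v) - f ((f ^^ n) u) = s i * ((f ^^ n) v - (f ^^ n) u)"
      by (rule f_affine[OF i])
    then have "f ((f ^^ n) u) \<noteq> f ((f ^^ n) v)"
      using slope_nonzero[OF i(1)] IH(2) by auto
    then show ?case using J_img[OF IH(1) i IH(2)] IH(3) by simp
  qed simp
  \<comment> \<open>Large enough for stage 0: \<open>A\<close> bounds the increment, and
    \<open>\<bar>M\<bar> * (b - a)\<close> compensates for a possibly negative
    \<open>M * (v - u)\<close>.\<close>
  define B where "B = A + \<bar>M\<bar> * (b - a)"
  have "\<forall>u v. J u v \<longrightarrow> u < v \<longrightarrow> \<alpha> v - \<alpha> u \<le> B / 2 ^ k + M * (v - u)" for k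
  proof (induction k)
    case 0
    show ?case
    proof (intro allI impI)
      fix u v assume uv: "J u v" "u < v"
      have "v - u \<le> b - a" using J_in[OF uv(1)] J_in[OF J_sym[OF uv(1)]] by auto
      then have "\<bar>M * (v - u)\<bar> \<le> \<bar>M\<bar> * (b - a)" using uv by (auto simp: abs_mult intro!: mult_left_mono)
      then show "\<alpha> v - \<alpha> u \<le> B / 2 ^ 0 + M * (v - u)" using bd[OF uv(1)] by (simp add: B_def)
    qed
  next
    case (Suc k)
    \<comment> \<open>The stage \<open>k\<close> bound is applied to the image, which is at least
      four times as long, and divided by its length. Quotients do not decrease on the way, so the
      relative error shrinks by the factor 4.\<close>
    have piece: "\<alpha> v - \<alpha> u \<le> B / 2 ^ k / 4 + M * (v - u)"
      if "J u v" "u < v" "clean N u v" for u v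
    proof -
      let ?u = "(f ^^ N) u" and ?v = "(f ^^ N) v"
      have st: "J ?u ?v" "?u \<noteq> ?v" "(\<alpha> v - \<alpha> u) / (v - u) \<le> (\<alpha> ?v - \<alpha> ?u) / (?v - ?u)"
        using img[OF that(1), of N] that by (auto simp: clean_def)
      have div: "X / p \<le> Q / p + M" if "X \<le> Q + M * p" "p > 0" for X Q p :: real
        using divide_right_mono[OF that(1), of p] that(2) by (simp add: add_divide_distrib)
      have q: "(\<alpha> ?v - \<alpha> ?u) / (?v - ?u) \<le> B / 2 ^ k / \<bar>?v - ?u\<bar> + M"
      proof (cases "?u < ?v")
        case True
        then have "\<alpha> ?v - \<alpha> ?u \<le> B / 2 ^ k + M * (?v - ?u)" using Suc st(1) by blast
        then have "(\<alpha> ?v - \<alpha> ?u) / (?v - ?u) \<le> B / 2 ^ k / (?v - ?u) + M"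
          using True by (intro div) simp_all
        then show ?thesis using True by simp
      next
        case False
        then have lt: "?v < ?u" using st(2) by simp
        then have "\<alpha> ?u - \<alpha> ?v \<le> B / 2 ^ k + M * (?u - ?v)" using Suc J_sym[OF st(1)] by blast
        then have "(\<alpha> ?u - \<alpha> ?v) / (?u - ?v) \<le> B / 2 ^ k / (?u - ?v) + M"
          using lt by (intro div) simp_all
        moreover have "(\<alpha> ?u - \<alpha> ?v) / (?u - ?v) = (\<alpha> ?v - \<alpha> ?u) / (?v - ?u)"
          by (metis minus_diff_eq minus_divide_divide)
        ultimately show ?thesis using lt by simp
      qed
      have "0 \<le> B" using bd[OF that(1)] ab by (auto simp: B_def)
      then have "B / 2 ^ k / \<bar>?v - ?u\<bar> \<le> B / 2 ^ k / (4 * (v - u))"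
        using that by (intro divide_left_mono) (auto simp: clean_def)
      then have "(\<alpha> v - \<alpha> u) / (v - u) \<le> B / 2 ^ k / (4 * (v - u)) + M" using q st(3) by linarith
      then have "\<alpha> v - \<alpha> u \<le> (B / 2 ^ k / (4 * (v - u)) + M) * (v - u)" using that(2) by (simp add: pos_divide_le_eq)
      also have "\<dots> = B / 2 ^ k / 4 + M * (v - u)" using that(2) by (simp add: field_simps)
      finally show ?thesis .
    qed
    show ?case
    proof (intro allI impI)
      fix u v assume uv: "J u v" "u < v"
      have B: "0 \<le> B" using bd[OF uv(1)] ab by (auto simp: B_def)
      show "\<alpha> v - \<alpha> u \<le> B / 2 ^ Suc k + M * (v - u)"
      proof (cases "v - u < \<delta>")
        case True
        obtain z where z: "u \<le> z" "z \<le> v" "u < z \<longrightarrow> clean N u z" "z < v \<longrightarrow> clean N z v"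
          using exp[OF uv(2) J_in[OF uv(1)] J_in[OF J_sym[OF uv(1)]] True] by blast
        have J: "J u z" "J z v" using J_sub[OF uv(1) z(1,2)] by auto
        have q: "0 \<le> B / 2 ^ k / 4" using B by simp
        have "\<alpha> z - \<alpha> u \<le> B / 2 ^ k / 4 + M * (z - u)"
          using piece[OF J(1)] z q by (cases "u < z") auto
        moreover have "\<alpha> v - \<alpha> z \<le> B / 2 ^ k / 4 + M * (v - z)"
          using piece[OF J(2)] z q by (cases "z < v") auto
        moreover have "B / 2 ^ Suc k = B / 2 ^ k / 4 + B / 2 ^ k / 4" by simp
        ultimately show ?thesis by (simp add: algebra_simps)
      next
        case False
        then show ?thesis using big[OF uv] B by (smt (verit) divide_nonneg_pos zero_less_power)
      qed
    qed
  qed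
  then have "\<alpha> y - \<alpha> x \<le> B / 2 ^ k + M * (y - x)" for k using xy by blast
  moreover have "(\<lambda>k. B / 2 ^ k + M * (y - x)) \<longlonglongrightarrow> 0 + M * (y - x)"
    by (intro tendsto_intros LIMSEQ_divide_realpow_zero) simp
  ultimately show ?thesis using LIMSEQ_le_const[of _ "0 + M * (y - x)"] by auto
qed

end

section \<open>Minimal cycles and rigidity of the essential slopes\<close>

context expanding_affine
begin

lemma image_nontrivial:
  assumes "u < v" "u \<in> {a..b}" "v \<in> {a..b}"
  obtains x y where "x \<in> (f ^^ j) ` {u..v}" "y \<in> (f ^^ j) ` {u..v}" "x < y"
proof -
  have "\<exists>w\<in>{u..v}. (f ^^ j) w \<noteq> (f ^^ j) u"
  proof (rule ccontr)
    assume "\<not> ?thesis"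
    moreover have "{u..v} \<subseteq> {a..b}" using assms by auto
    ultimately have "{u..v} \<subseteq> {x \<in> {a..b}. (f ^^ j) x \<in> {(f ^^ j) u}}" by blast
    then have "finite {u..v}" using finite_preimage[of "{(f ^^ j) u}" j] finite_subset by blast
    then show False using assms(1) by (simp add: infinite_Icc)
  qed
  then obtain w where w: "w \<in> {u..v}" "(f ^^ j) w \<noteq> (f ^^ j) u" by blast
  have u: "u \<in> {u..v}" using assms(1) by simp
  show ?thesis
  proof (cases "(f ^^ j) w < (f ^^ j) u")
    case True
    then show ?thesis using that[of "(f ^^ j) w" "(f ^^ j) u"] w(1) u by blast
  next
    case False
    then have "(f ^^ j) u < (f ^^ j) w" using w(2) by simp
    then show ?thesis using that[of "(f ^^ j) u" "(f ^^ j) w"] w(1) u by blast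
  qed
qed

lemma image_interval: "{u..v} \<subseteq> {a..b} \<Longrightarrow> is_interval ((f ^^ j) ` {u..v})"
  by (metis connected_Icc connected_continuous_image continuous_on_subset funpow_cont is_interval_connected_1)

text \<open>In steps of \<open>N\<close> the images double in length until they reach
  \<open>\<delta>\<close>, and this happens at arbitrarily late times. A bounded interval has no
  room for infinitely many disjoint segments of length \<open>\<delta>\<close>, so two images
  meet.\<close>

lemma recurrent_interval:
  assumes uv: "u < v" "u \<in> {a..b}" "v \<in> {a..b}" and n: "n \<ge> 1"
  obtains p q where "p < q" "((f ^^ n) ^^ p) ` {u..v} \<inter> ((f ^^ n) ^^ q) ` {u..v} \<noteq> {}"
proof -
  obtain N \<delta> where N: "N \<ge> 1" "n dvd N" "\<delta> > 0"
    "\<And>x y. x < y \<Longrightarrow> x \<in> {a..b} \<Longrightarrow> y \<in> {a..b} \<Longrightarrow> y - x < \<delta> \<Longrightarrow>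
      \<exists>z. x \<le> z \<and> z \<le> y \<and> (x < z \<longrightarrow> clean N x z) \<and> (z < y \<longrightarrow> clean N z y)"
    by (rule expansion[OF n]) blast
  define L where "L k = (f ^^ (N * k)) ` {u..v}" for k
  have sub: "{u..v} \<subseteq> {a..b}" using uv by auto
  have L_int: "is_interval (L k)" for k unfolding L_def by (rule image_interval[OF sub])
  have L_in: "L k \<subseteq> {a..b}" for k unfolding L_def using funpow_in sub by blast
  have L_Suc: "L (Suc k) = (f ^^ N) ` L k" for k
    by (simp add: L_def funpow_add image_image)
  define P where "P k l \<longleftrightarrow> (\<exists>x\<in>L k. \<exists>y\<in>L k. y - x = l)" for k and l :: real
  have shrink: "P k l'" if l: "P k l" "0 \<le> l'" "l' \<le> l" for k l l'
  proof -
    obtain x y where xy: "x \<in> L k" "y \<in> L k" "y - x = l" using l(1) unfolding P_def by blast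
    have "x + l' \<in> L k" by (rule mem_is_interval_1_I[OF L_int xy(1,2)]) (use xy l in auto)
    then show ?thesis unfolding P_def using xy(1) by (intro bexI[of _ x] bexI[of _ "x + l'"]) auto
  qed
  have dbl: "P (Suc k) (2 * l)" if l: "P k l" "0 < l" "l < \<delta>" for k l
  proof -
    obtain x y where xy: "x \<in> L k" "y \<in> L k" "y - x = l" using l(1) unfolding P_def by blast
    have inab: "x \<in> {a..b}" "y \<in> {a..b}" using xy L_in by blast+
    obtain z where z: "x \<le> z" "z \<le> y" "x < z \<longrightarrow> clean N x z" "z < y \<longrightarrow> clean N z y"
      using N(4)[of x y] xy(3) l inab by auto
    have zL: "z \<in> L k" by (rule mem_is_interval_1_I[OF L_int xy(1,2) z(1,2)])
    \<comment> \<open>Applied to the longer of the two pieces, which has at least half the length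
      and is expanded by 4.\<close>
    have grow: "P (Suc k) (2 * l)" if "clean N s t" "s \<in> L k" "t \<in> L k" "l / 2 \<le> t - s" for s t
    proof -
      have "4 * \<bar>t - s\<bar> \<le> \<bar>(f ^^ N) t - (f ^^ N) s\<bar>" using that(1) unfolding clean_def by blast
      then have e: "2 * l \<le> \<bar>(f ^^ N) t - (f ^^ N) s\<bar>" using that(4) abs_ge_self[of "t - s"] by argo
      have m: "(f ^^ N) s \<in> L (Suc k)" "(f ^^ N) t \<in> L (Suc k)" using that(2,3) L_Suc by blast+
      have "P (Suc k) \<bar>(f ^^ N) t - (f ^^ N) s\<bar>"
      proof (cases "(f ^^ N) s \<le> (f ^^ N) t")
        case True
        then show ?thesis unfolding P_def by (intro bexI[of _ "(f ^^ N) s"] bexI[of _ "(f ^^ N) t"] m) simp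
      next
        case False
        then show ?thesis unfolding P_def by (intro bexI[of _ "(f ^^ N) t"] bexI[of _ "(f ^^ N) s"] m) simp
      qed
      then show ?thesis using shrink e \<open>0 < l\<close> by (meson less_imp_le mult_pos_pos zero_less_numeral)
    qed
    show ?thesis
    proof (cases "l / 2 \<le> z - x")
      case True
      then show ?thesis using grow[of x z] z(3) xy zL \<open>0 < l\<close> by auto
    next
      case False
      then show ?thesis using grow[of z y] z(4) xy zL \<open>0 < l\<close> by auto
    qed
  qed
  have ex: "\<exists>k\<ge>k0. P k \<delta>" for k0
  proof (rule ccontr)
    assume no: "\<not> ?thesis"
    obtain x y where "x \<in> L k0" "y \<in> L k0" "x < y"
      using image_nontrivial[OF uv, of "N * k0"] unfolding L_def by metis
    then obtain l where l: "P k0 l" "l > 0" unfolding P_def by (metis diff_gt_0_iff_gt)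
    have "P (k0 + j) (2 ^ j * l)" for j
    proof (induction j)
      case (Suc j)
      have "2 ^ j * l < \<delta>"
      proof (rule ccontr)
        assume "\<not> ?thesis"
        then have "P (k0 + j) \<delta>" using shrink[OF Suc] N(3) by simp
        then show False using no by auto
      qed
      then show ?case using dbl[OF Suc] l(2) by (simp add: mult.assoc)
    qed (use l in simp)
    moreover obtain j where "(b - a) / l < 2 ^ j" using real_arch_pow[of 2 "(b - a) / l"] by auto
    ultimately obtain j x y where xy: "x \<in> L (k0 + j)" "y \<in> L (k0 + j)" "y - x = 2 ^ j * l" "b - a < 2 ^ j * l"
      unfolding P_def using l(2) by (metis mult.commute pos_divide_less_eq)
    then have "x \<in> {a..b}" "y \<in> {a..b}" using L_in by blast+
    then show False using xy(3,4) by simp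
  qed
  define X where "X = {k. P k \<delta>}"
  have inf: "infinite X"
    unfolding X_def infinite_nat_iff_unbounded_le using ex by auto
  have "\<forall>k\<in>X. \<exists>x. x \<in> L k \<and> x + \<delta> \<in> L k"
  proof
    fix k assume "k \<in> X"
    then obtain x y where "x \<in> L k" "y \<in> L k" "y - x = \<delta>" unfolding X_def P_def by blast
    then show "\<exists>x. x \<in> L k \<and> x + \<delta> \<in> L k" by (intro exI[of _ x]) (simp add: algebra_simps)
  qed
  then obtain x where x: "\<And>k. k \<in> X \<Longrightarrow> x k \<in> L k" "\<And>k. k \<in> X \<Longrightarrow> x k + \<delta> \<in> L k" by metis
  \<comment> \<open>Pigeonhole on cells of length \<open>\<delta>\<close>: left end points in the
    same cell are less than \<open>\<delta>\<close> apart, so the segments of length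
    \<open>\<delta>\<close> to their right overlap.\<close>
  have "finite ((\<lambda>k. \<lfloor>x k / \<delta>\<rfloor>) ` X)"
  proof (rule finite_subset)
    show "(\<lambda>k. \<lfloor>x k / \<delta>\<rfloor>) ` X \<subseteq> {\<lfloor>a / \<delta>\<rfloor>..\<lfloor>b / \<delta>\<rfloor>}"
    proof
      fix i assume "i \<in> (\<lambda>k. \<lfloor>x k / \<delta>\<rfloor>) ` X"
      then obtain k where k: "k \<in> X" "i = \<lfloor>x k / \<delta>\<rfloor>" by blast
      then have "a \<le> x k" "x k \<le> b" using x(1)[OF k(1)] L_in[of k] by auto
      then show "i \<in> {\<lfloor>a / \<delta>\<rfloor>..\<lfloor>b / \<delta>\<rfloor>}"
        using N(3) k(2) by (simp add: floor_mono divide_right_mono)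
    qed
  qed simp
  then obtain k0 where k0: "k0 \<in> X" "infinite {k \<in> X. \<lfloor>x k / \<delta>\<rfloor> = \<lfloor>x k0 / \<delta>\<rfloor>}"
    using pigeonhole_infinite[OF inf] by blast
  then obtain k1 where k1: "k1 \<in> X" "\<lfloor>x k1 / \<delta>\<rfloor> = \<lfloor>x k0 / \<delta>\<rfloor>" "k1 > k0"
    by (metis (mono_tags, lifting) infinite_nat_iff_unbounded mem_Collect_eq)
  have "\<bar>x k1 / \<delta> - x k0 / \<delta>\<bar> < 1" using k1(2) by linarith
  then have "\<bar>(x k1 - x k0) / \<delta>\<bar> < 1" by (simp add: diff_divide_distrib)
  then have dist: "\<bar>x k1 - x k0\<bar> < \<delta>" using N(3) by (simp add: abs_divide)
  have "max (x k0) (x k1) \<in> L k0"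
    by (rule mem_is_interval_1_I[OF L_int x[OF k0(1)]]) (use dist in auto)
  moreover have "max (x k0) (x k1) \<in> L k1"
    by (rule mem_is_interval_1_I[OF L_int x[OF k1(1)]]) (use dist in auto)
  ultimately have meet: "L k0 \<inter> L k1 \<noteq> {}" by blast
  obtain m where m: "N = n * m" using N(2) by blast
  have "m > 0" using N(1) m by (cases m) auto
  have "L k = ((f ^^ n) ^^ (m * k)) ` {u..v}" for k
    by (simp add: L_def m funpow_mult mult.assoc)
  then show ?thesis using that[of "m * k0" "m * k1"] meet k1(3) \<open>m > 0\<close> by simp
qed

text \<open>The connected component \<open>K\<close> of the orbit of {u..v} around a recurrent image
  returns to itself. With its first return time it would be a renormalization of the return map
  unless its closure is that of \<open>I\<close>; hence its closure is that of
  \<open>I\<close>.\<close>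

lemma dense_orbit_of_interval:
  assumes I: "is_interval I" "I \<subseteq> {a..b}" and n: "n \<ge> 1" and inv: "(f ^^ n) ` I \<subseteq> I"
    and nr: "\<not> renormalizable I (f ^^ n)"
    and uv: "u < v" "{u..v} \<subseteq> I"
  shows "I \<subseteq> closure (\<Union>k. ((f ^^ n) ^^ k) ` {u..v})"
proof -
  define F where "F = f ^^ n"
  define V where "V = (\<Union>k. (F ^^ k) ` {u..v})"
  have "u \<in> I" "v \<in> I" using uv by auto
  then have uv_ab: "u \<in> {a..b}" "v \<in> {a..b}" using I(2) by auto
  have F_inv: "(F ^^ k) x \<in> I" if "x \<in> I" for k x using that inv by (induction k) (auto simp: F_def)
  have V_I: "V \<subseteq> I" unfolding V_def using F_inv uv(2) by blast
  have F_V: "(F ^^ k) x \<in> V" if xV: "x \<in> V" for k x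
  proof -
    obtain l y where "y \<in> {u..v}" "x = (F ^^ l) y" using xV unfolding V_def by blast
    then have "y \<in> {u..v}" "(F ^^ k) x = (F ^^ (k + l)) y" by (simp_all add: funpow_add)
    then show ?thesis unfolding V_def by blast
  qed
  have F_cont: "continuous_on {a..b} (F ^^ k)" for k
    unfolding F_def funpow_mult by (rule funpow_cont)
  have conn: "connected ((F ^^ k) ` S)" if "connected S" "S \<subseteq> V" for k S
    by (rule connected_continuous_image[OF continuous_on_subset[OF F_cont] that(1)]) (use that(2) V_I I(2) in blast)
  obtain p q where pq: "p < q" "(F ^^ p) ` {u..v} \<inter> (F ^^ q) ` {u..v} \<noteq> {}"
    unfolding F_def by (rule recurrent_interval[OF uv(1) uv_ab n]) blast
  have uv_V: "(F ^^ k) ` {u..v} \<subseteq> V" for k unfolding V_def by blast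
  have conn_uv: "connected ((F ^^ k) ` {u..v})" for k
    by (rule conn) (use uv_V[of 0] in auto)
  have ne: "(F ^^ k) ` {u..v} \<noteq> {}" for k using uv(1) by simp
  obtain w where w: "w \<in> (F ^^ p) ` {u..v}" using ne by blast
  define K where "K = connected_component_set V w"
  have wV: "w \<in> V" using w uv_V by blast
  have K: "K \<in> components V" unfolding K_def using wV by (rule componentsI)
  have wK: "w \<in> K" unfolding K_def using wV by simp
  have K_conn: "connected K" and K_V: "K \<subseteq> V"
    using K in_components_connected in_components_subset by blast+
  have p_K: "(F ^^ p) ` {u..v} \<subseteq> K"
    using components_maximal[OF K conn_uv uv_V] w wK by blast
  have q_K: "(F ^^ q) ` {u..v} \<inter> K \<noteq> {}" using pq(2) p_K by blast
  \<comment> \<open>A connected subset of \<open>V\<close> that meets the component \<open>K\<close>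
    lies in it, so a single common point already gives invariance.\<close>
  have FK: "(F ^^ m) ` K \<subseteq> K" if "(F ^^ m) ` K \<inter> K \<noteq> {}" for m
    by (rule components_maximal[OF K conn[OF K_conn K_V]]) (use F_V K_V that in blast)+
  have "(F ^^ (q - p)) ` ((F ^^ p) ` {u..v}) = (F ^^ q) ` {u..v}"
    using pq(1) by (simp add: image_comp flip: funpow_add)
  then have "(F ^^ (q - p)) ` K \<inter> K \<noteq> {}" using p_K q_K by blast
  then have ex: "q - p \<ge> 1 \<and> (F ^^ (q - p)) ` K \<subseteq> K" using FK pq(1) by simp
  define m where "m = (LEAST m. m \<ge> 1 \<and> (F ^^ m) ` K \<subseteq> K)"
  have m: "m \<ge> 1" "(F ^^ m) ` K \<subseteq> K"
    using LeastI[of "\<lambda>m. m \<ge> 1 \<and> (F ^^ m) ` K \<subseteq> K", OF ex] by (auto simp: m_def)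
  have least: "m \<le> l" if "l \<ge> 1" "(F ^^ l) ` K \<subseteq> K" for l
    unfolding m_def by (rule Least_le) (use that in blast)
  \<comment> \<open>If the images at times \<open>i < j\<close> met, applying
    \<open>F ^^ (m - j)\<close> would bring a point of \<open>K\<close> back at time
    \<open>m - j + i\<close>, which is less than the first return time \<open>m\<close>.\<close>
  have disj: "(F ^^ i) ` K \<inter> (F ^^ j) ` K = {}" if ij: "i < j" "j < m" for i j
  proof (rule ccontr)
    assume "\<not> ?thesis"
    then obtain x y where xy: "x \<in> K" "y \<in> K" "(F ^^ i) x = (F ^^ j) y" by blast
    have "(F ^^ (m - j + i)) x = (F ^^ (m - j)) ((F ^^ i) x)" by (simp add: funpow_add)
    also have "\<dots> = (F ^^ (m - j + j)) y" unfolding xy(3) by (simp only: funpow_add comp_apply)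
    also have "\<dots> = (F ^^ m) y" using ij by simp
    finally have "(F ^^ (m - j + i)) x \<in> K" using m(2) xy(2) by auto
    then have "(F ^^ (m - j + i)) ` K \<subseteq> K" using FK xy(1) by blast
    then have "m \<le> m - j + i" using least ij by simp
    then show False using ij by simp
  qed
  have "interior K \<noteq> {}"
  proof -
    obtain x y where "x \<in> (f ^^ (n * p)) ` {u..v}" "y \<in> (f ^^ (n * p)) ` {u..v}" "x < y"
      using image_nontrivial[OF uv(1) uv_ab] by blast
    then have xy: "x \<in> K" "y \<in> K" "x < y" using p_K by (auto simp: F_def funpow_mult)
    have "{x..y} \<subseteq> K" by (rule connected_contains_Icc[OF K_conn xy(1,2)])
    then have "{x<..<y} \<subseteq> interior K" by (intro interior_maximal) auto
    then show ?thesis using xy(3) dense by fastforce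
  qed
  moreover have "disjoint_family_on (\<lambda>i. interior ((F ^^ i) ` K)) {..<m}"
    unfolding disjoint_family_on_def
  proof (intro ballI impI)
    fix i j assume "i \<in> {..<m}" "j \<in> {..<m}" "i \<noteq> j"
    then have "(F ^^ i) ` K \<inter> (F ^^ j) ` K = {}"
      using disj[of i j] disj[of j i] by (cases i j rule: linorder_cases) auto
    then show "interior ((F ^^ i) ` K) \<inter> interior ((F ^^ j) ` K) = {}"
      using interior_subset[of "(F ^^ i) ` K"] interior_subset[of "(F ^^ j) ` K"] by blast
  qed
  moreover have "is_interval K" using K_conn is_interval_connected_1 by blast
  ultimately have "renormalization I F K m" if "closure K \<noteq> closure I"
    using m K_V V_I that unfolding renormalization_def by simp
  then have "closure K = closure I" using nr unfolding renormalizable_def F_def by blast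
  then show ?thesis using closure_subset[of I] closure_mono[OF K_V] unfolding V_def F_def by blast
qed

end

lemma between_closure_interval:
  fixes I :: "real set"
  assumes "is_interval I" "x \<in> closure I" "y \<in> closure I" "x < z" "z < y"
  shows "z \<in> I"
proof -
  have "x \<in> {..<z}" "y \<in> {z<..}" using assms by auto
  then have "{..<z} \<inter> I \<noteq> {}" "{z<..} \<inter> I \<noteq> {}"
    using assms(2,3) open_Int_closure_eq_empty[of "{..<z}" I] open_Int_closure_eq_empty[of "{z<..}" I] by auto
  then obtain x' y' where "x' \<in> I" "x' < z" "y' \<in> I" "z < y'" by auto
  then show ?thesis using mem_is_interval_1_I[OF assms(1), of x' y' z] by simp
qed

context expanding_affine
begin

lemma funpow_nbhd:
  assumes "x \<in> {a..b}" "open U" "(f ^^ j) x \<in> U"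
  obtains T where "open T" "x \<in> T" "\<forall>z\<in>{a..b} \<inter> T. (f ^^ j) z \<in> U"
proof -
  have "\<exists>T. open T \<and> x \<in> T \<and> (\<forall>z\<in>{a..b}. z \<in> T \<longrightarrow> (f ^^ j) z \<in> U)"
    using funpow_cont[of j] assms unfolding continuous_on_topological by blast
  then show ?thesis using that by blast
qed

text \<open>Brings both kinds of minimal cycle into one form: a non-renormalizable \<open>f\<close>
  is its own return map, on the whole interval and with \<open>n = 1\<close>.\<close>

lemma minimal_cycle_return_interval:
  assumes "minimal_cycle {a..b} f C"
  obtains I n where "is_interval I" "interior I \<noteq> {}" "I \<subseteq> {a..b}" "n \<ge> 1" "(f ^^ n) ` I \<subseteq> I"
    "\<not> renormalizable I (f ^^ n)" "C = (\<Union>i<n. (f ^^ i) ` I)"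
  using assms unfolding minimal_cycle_def
proof (elim disjE exE conjE)
  fix I n
  assume "renormalization {a..b} f I n" "\<not> renormalizable I (f ^^ n)" "C = (\<Union>i<n. (f ^^ i) ` I)"
  then show thesis using that[of I n] unfolding renormalization_def by blast
next
  assume "\<not> renormalizable {a..b} f" "C = {a..b}"
  moreover have "f ` {a..b} \<subseteq> {a..b}" using f_in by blast
  ultimately show thesis using that[of "{a..b}" 1] ab by (simp add: lessThan_Suc is_interval_cc)
qed

text \<open>
  In the application \<open>\<alpha>\<close> is plus or minus a conjugacy, and \<open>m i\<close> is the slope of the branch
  corresponding to the \<open>i\<close>-th one. The difference quotients of \<open>\<alpha>\<close> attain their supremum on a
  minimal cycle, so \<open>\<alpha>\<close> is affine with that slope on some interval, hence on all its images.
\<close>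

lemma essential_slopes_eq:
  assumes \<alpha>_mono: "strict_mono_on {a..b} \<alpha>" and \<alpha>_cont: "continuous_on {a..b} \<alpha>"
    and conj: "\<And>i x y. i \<le> d \<Longrightarrow> x \<in> {c i..c (Suc i)} \<Longrightarrow> y \<in> {c i..c (Suc i)} \<Longrightarrow>
      \<alpha> (f y) - \<alpha> (f x) = m i * (\<alpha> y - \<alpha> x)"
    and C: "minimal_cycle {a..b} f C"
    and ge: "\<And>i. i \<le> d \<Longrightarrow> C \<inter> {c i<..<c (Suc i)} \<noteq> {} \<Longrightarrow> \<bar>m i\<bar> \<ge> \<bar>s i\<bar>"
    and i: "i \<le> d" "C \<inter> {c i<..<c (Suc i)} \<noteq> {}"
  shows "m i = s i"
proof -
  obtain I n where I: "is_interval I" "interior I \<noteq> {}" "I \<subseteq> {a..b}" and n: "n \<ge> 1"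
    and inv: "(f ^^ n) ` I \<subseteq> I" and nr: "\<not> renormalizable I (f ^^ n)" and C_eq: "C = (\<Union>i<n. (f ^^ i) ` I)"
    by (rule minimal_cycle_return_interval[OF C]) blast
  \<comment> \<open>Closures make the set \<open>D\<close> of pairs compact. They add only end
    points: strictly between two points of \<open>K j\<close> everything belongs to the image
    itself.\<close>
  define K where "K j = closure ((f ^^ j) ` I)" for j
  define J where "J x y \<longleftrightarrow> (\<exists>j<n. x \<in> K j \<and> y \<in> K j)" for x y
  have fI_int: "is_interval ((f ^^ j) ` I)" for j
    using I(1,3) funpow_cont connected_continuous_image continuous_on_subset is_interval_connected_1 by metis
  have fI_in: "(f ^^ j) ` I \<subseteq> {a..b}" for j using I(3) funpow_in by blast
  have K_in: "K j \<subseteq> {a..b}" for j unfolding K_def by (rule closure_minimal[OF fI_in]) simp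
  have K_int: "is_interval (K j)" for j
    unfolding K_def using fI_int convex_closure is_interval_convex_1 by blast
  have fK: "f ` K j \<subseteq> K (Suc j)" for j
  proof -
    have "f ` closure ((f ^^ j) ` I) \<subseteq> closure (f ` (f ^^ j) ` I)"
    proof (rule image_closure_subset)
      show "continuous_on (closure ((f ^^ j) ` I)) f"
        using continuous_on_subset[OF f_cont K_in[of j]] by (simp add: K_def)
    qed (simp_all add: closure_subset)
    then show ?thesis by (simp add: K_def image_image)
  qed
  have Kn: "K n \<subseteq> K 0" unfolding K_def using inv by (auto intro!: closure_mono)
  have J_sym: "J y x" if "J x y" for x y using that unfolding J_def by blast
  have J_in: "x \<in> {a..b}" "y \<in> {a..b}" if "J x y" for x y using that K_in unfolding J_def by blast+
  have J_sub: "J x z \<and> J z y" if "J x y" "x \<le> z" "z \<le> y" for x y z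
    using that mem_is_interval_1_I[OF K_int] unfolding J_def by blast
  have J_f: "J (f x) (f y)" if "J x y" for x y
  proof -
    obtain j where j: "j < n" "x \<in> K j" "y \<in> K j" using \<open>J x y\<close> unfolding J_def by blast
    then have s: "f x \<in> K (Suc j)" "f y \<in> K (Suc j)" using fK by blast+
    show ?thesis
    proof (cases "Suc j = n")
      case True
      then show ?thesis unfolding J_def using s Kn n by (intro exI[of _ 0]) auto
    next
      case False
      then show ?thesis unfolding J_def using s j(1) by (intro exI[of _ "Suc j"]) auto
    qed
  qed
  have ess: "C \<inter> {c i<..<c (Suc i)} \<noteq> {}"
    if Jxy: "J x y" "x < y" "x \<in> {c i..c (Suc i)}" "y \<in> {c i..c (Suc i)}" for x y i
  proof -
    obtain j where j: "j < n" "x \<in> K j" "y \<in> K j" using Jxy(1) unfolding J_def by blast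
    have "(x + y) / 2 \<in> (f ^^ j) ` I"
      by (rule between_closure_interval[OF fI_int, of x j y]) (use j Jxy(2) in \<open>auto simp: K_def\<close>)
    then have "(x + y) / 2 \<in> C" using j(1) C_eq by blast
    moreover have "(x + y) / 2 \<in> {c i<..<c (Suc i)}" using Jxy by auto
    ultimately show ?thesis by blast
  qed
  define R where "R x y = (\<alpha> y - \<alpha> x) / (y - x)" for x y
  have R_sym: "R x y = R y x" for x y unfolding R_def by (metis minus_diff_eq minus_divide_divide)
  have R_pos: "R x y > 0" if "x \<in> {a..b}" "y \<in> {a..b}" "x \<noteq> y" for x y
  proof (cases "x < y")
    case True
    then show ?thesis using strict_mono_onD[OF \<alpha>_mono, of x y] that by (simp add: R_def)
  next
    case False
    then have "y < x" using that by simp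
    then show ?thesis using strict_mono_onD[OF \<alpha>_mono, of y x] that
      by (simp add: R_def divide_neg_neg)
  qed
  \<comment> \<open>One application of \<open>f\<close> multiplies the quotient by
    \<open>m i / s i\<close>. This factor is positive because \<open>\<alpha>\<close> is increasing,
    so the comparison of moduli makes it at least 1.\<close>
  have step: "f x \<noteq> f y \<and> R (f x) (f y) = m i / s i * R x y \<and> m i / s i \<ge> 1"
    if J: "J x y" and i: "i \<le> d" and xi: "x \<in> {c i..c (Suc i)}" and yi: "y \<in> {c i..c (Suc i)}" and ne: "x \<noteq> y" for x y i
  proof -
    have s: "s i \<noteq> 0" by (rule slope_nonzero[OF i])
    have fd: "f y - f x = s i * (y - x)" by (rule f_affine[OF i xi yi])
    then have fne: "f x \<noteq> f y" using s ne by auto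
    have eq: "R (f x) (f y) = m i / s i * R x y"
      unfolding R_def conj[OF i xi yi] fd by simp
    have "R x y > 0" "R (f x) (f y) > 0"
      using J_in[OF J] J_in[OF J_f[OF J]] ne fne by (auto intro!: R_pos)
    then have pos: "m i / s i > 0" unfolding eq by (simp only: zero_less_mult_iff) linarith
    have "C \<inter> {c i<..<c (Suc i)} \<noteq> {}"
    proof (cases "x < y")
      case True
      then show ?thesis using ess[OF J _ xi yi] by simp
    next
      case False
      then show ?thesis using ess[OF J_sym[OF J] _ yi xi] ne by simp
    qed
    then have "\<bar>m i\<bar> \<ge> \<bar>s i\<bar>" by (rule ge[OF i])
    then have "\<bar>m i / s i\<bar> \<ge> 1" using s by (simp add: abs_divide)
    then show ?thesis using pos eq fne by simp
  qed
  obtain N \<delta>0 where N: "N \<ge> 1" "1 dvd N" "\<delta>0 > 0"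
    "\<And>x y. x < y \<Longrightarrow> x \<in> {a..b} \<Longrightarrow> y \<in> {a..b} \<Longrightarrow> y - x < \<delta>0 \<Longrightarrow>
      \<exists>z. x \<le> z \<and> z \<le> y \<and> (x < z \<longrightarrow> clean N x z) \<and> (z < y \<longrightarrow> clean N z y)"
    by (rule expansion[of 1]) auto
  obtain x1 y1 where xy1: "x1 \<in> I" "y1 \<in> I" "x1 < y1"
  proof -
    obtain z e where "e > 0" "ball z e \<subseteq> I" using I(2) by (metis ex_in_conv mem_interior)
    then have "z \<in> I" "z + e / 2 \<in> I" "z < z + e / 2" by (auto simp: subset_eq dist_real_def)
    then show ?thesis using that by blast
  qed
  \<comment> \<open>Not above \<open>\<delta>0\<close>, for the expansion, and not above the length
    of a segment in \<open>I\<close>, so that \<open>D\<close> is nonempty.\<close>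
  define \<delta> where "\<delta> = min \<delta>0 (y1 - x1)"
  have \<delta>: "\<delta> > 0" using N(3) xy1(3) by (simp add: \<delta>_def)
  \<comment> \<open>Away from the diagonal the quotient is continuous on a compact set and attains
    its maximum \<open>M\<close>; \<open>M_max\<close> then extends the bound to arbitrarily close
    pairs.\<close>
  define D where "D = (\<Union>j<n. K j \<times> K j) \<inter> {p. fst p + \<delta> \<le> snd p}"
  have "compact (K j)" for j
    using compact_eq_bounded_closed bounded_subset[OF bounded_closed_interval K_in]
    by (simp add: K_def compact_eq_bounded_closed)
  then have "compact D" unfolding D_def
    by (intro compact_Int_closed compact_UN compact_Times closed_Collect_le continuous_intros) auto
  moreover have "D \<noteq> {}"
  proof -
    have "(x1, y1) \<in> K 0 \<times> K 0" using xy1 closure_subset[of I] by (auto simp: K_def)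
    then have "(x1, y1) \<in> D" using n by (auto simp: D_def \<delta>_def intro!: bexI[of _ 0])
    then show ?thesis by blast
  qed
  moreover have "continuous_on D (\<lambda>p. R (fst p) (snd p))"
    unfolding R_def
  proof (intro continuous_intros continuous_on_compose2[OF \<alpha>_cont])
    show "fst ` D \<subseteq> {a..b}" "snd ` D \<subseteq> {a..b}" using K_in by (fastforce simp: D_def)+
    show "\<forall>p\<in>D. snd p - fst p \<noteq> 0" using \<delta> by (auto simp: D_def)
  qed
  ultimately have "\<exists>q\<in>D. \<forall>p\<in>D. R (fst p) (snd p) \<le> R (fst q) (snd q)"
    by (rule continuous_attains_sup)
  then obtain q where q: "q \<in> D" "\<And>p. p \<in> D \<Longrightarrow> R (fst p) (snd p) \<le> R (fst q) (snd q)" by blast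
  define x0 y0 M where "x0 = fst q" and "y0 = snd q" and "M = R x0 y0"
  have xy0: "J x0 y0" "x0 < y0" using q(1) \<delta> by (auto simp: D_def J_def x0_def y0_def)
  have M_max: "\<alpha> y - \<alpha> x \<le> M * (y - x)" if "J x y" "x < y" for x y
  proof (rule quotient_bound_spreads[where J=J and \<alpha>=\<alpha> and \<delta>=\<delta> and N=N and A="\<alpha> b - \<alpha> a"])
    show "\<exists>z. x \<le> z \<and> z \<le> y \<and> (x < z \<longrightarrow> clean N x z) \<and> (z < y \<longrightarrow> clean N z y)"
      if "x < y" "x \<in> {a..b}" "y \<in> {a..b}" "y - x < \<delta>" for x y
      using N(4) that by (simp add: \<delta>_def)
    show "J (f x) (f y) \<and> (\<alpha> y - \<alpha> x) / (y - x) \<le> (\<alpha> (f y) - \<alpha> (f x)) / (f y - f x)"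
      if "J x y" "i \<le> d" "x \<in> {c i..c (Suc i)}" "y \<in> {c i..c (Suc i)}" "x \<noteq> y" for x y i
    proof -
      have "0 < R x y" using J_in[OF that(1)] that(5) by (intro R_pos)
      then have "1 * R x y \<le> m i / s i * R x y" using step[OF that] by (intro mult_right_mono) auto
      then show ?thesis using step[OF that] J_f[OF that(1)] by (simp add: R_def)
    qed
    show "\<bar>\<alpha> y - \<alpha> x\<bar> \<le> \<alpha> b - \<alpha> a" if "J x y" for x y
    proof -
      have mono: "\<alpha> u \<le> \<alpha> v" if "u \<in> {a..b}" "v \<in> {a..b}" "u \<le> v" for u v
        using strict_mono_onD[OF \<alpha>_mono, of u v] that by (cases "u = v") auto
      show ?thesis using mono[of a x] mono[of x b] mono[of a y] mono[of y b] J_in[OF that] ab by auto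
    qed
    show "\<alpha> y - \<alpha> x \<le> M * (y - x)" if "J x y" "x < y" "\<delta> \<le> y - x" for x y
    proof -
      have "(x, y) \<in> D" using that by (auto simp: D_def J_def)
      then have "R x y \<le> M" using q(2)[of "(x, y)"] by (simp add: M_def x0_def y0_def)
      then show ?thesis using that(2) by (simp add: R_def pos_divide_le_eq)
    qed
    show "J x y" "x < y" by (fact that)+
  qed (use J_sym J_in J_sub in blast)+
  define G where "G x y \<longleftrightarrow> J x y \<and> x \<noteq> y \<and> R x y = M" for x y
  \<comment> \<open>Subintervals of an extremal interval are extremal: none of the three parts rises
    by more than \<open>M\<close> times its length, and together they rise by exactly that
    much.\<close>
  have G0: "G x y" if "x0 \<le> x" "x < y" "y \<le> y0" for x y
  proof -
    have J: "J x0 x" "J x y" "J y y0"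
      using J_sub[OF xy0(1), of x] J_sub[of x y0 y] that xy0(1) J_sub[of x0 y0 x] J_sub[of x0 y0 y] by auto
    have "\<alpha> y0 - \<alpha> x0 = M * (y0 - x0)" using xy0(2) by (simp add: M_def R_def)
    moreover have "\<alpha> x - \<alpha> x0 \<le> M * (x - x0)" using M_max[OF J(1)] that by (cases "x0 = x") auto
    moreover have "\<alpha> y - \<alpha> x \<le> M * (y - x)" using M_max[OF J(2)] that by auto
    moreover have "\<alpha> y0 - \<alpha> y \<le> M * (y0 - y)" using M_max[OF J(3)] that by (cases "y = y0") auto
    ultimately have "\<alpha> y - \<alpha> x = M * (y - x)" by (simp add: algebra_simps)
    then show ?thesis using J(2) that(2) by (simp add: G_def R_def)
  qed
  have M_ge: "R x y \<le> M" if "J x y" "x \<noteq> y" for x y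
  proof (cases "x < y")
    case True
    then show ?thesis using M_max[OF that(1)] by (simp add: R_def pos_divide_le_eq)
  next
    case False
    then have "R y x \<le> M" using M_max[OF J_sym[OF that(1)]] that(2) by (simp add: R_def pos_divide_le_eq)
    then show ?thesis using R_sym by simp
  qed
  \<comment> \<open>A quotient that is already maximal cannot be multiplied by a factor above 1.
    Hence \<open>m i / s i = 1\<close> on every branch that an extremal pair visits, and the image
    pair is extremal again.\<close>
  have G_step: "G (f x) (f y) \<and> m i = s i"
    if G: "G x y" and i: "i \<le> d" "x \<in> {c i..c (Suc i)}" "y \<in> {c i..c (Suc i)}" for x y i
  proof -
    have J: "J x y" "x \<noteq> y" "R x y = M" using G by (auto simp: G_def)
    note st = step[OF J(1) i J(2)]
    have M: "M > 0" using R_pos J J_in[OF J(1)] by metis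
    have le: "m i / s i * M \<le> M" using M_ge[OF J_f[OF J(1)]] st J(3) by simp
    then have "m i / s i * M \<le> 1 * M" by simp
    then have "m i / s i \<le> 1" using M mult_right_le_imp_le by blast
    then have one: "m i / s i = 1" using st by linarith
    then show ?thesis using st J_f[OF J(1)] J(3) by (simp add: G_def)
  qed
  have orbit: "\<exists>w k. x0 < w \<and> w < y0 \<and> (f ^^ k) w \<in> {c i<..<c (Suc i)}"
  proof -
    obtain j0 where j0: "j0 < n" "x0 \<in> K j0" "y0 \<in> K j0" using xy0(1) unfolding J_def by blast
    \<comment> \<open>The middle third avoids the ends, which may lie only in the closure of the
      image of \<open>I\<close>; its image after the remaining \<open>n - j0\<close> steps therefore
      lies in \<open>I\<close>.\<close>
    define u v where "u = (2 * x0 + y0) / 3" and "v = (x0 + 2 * y0) / 3"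
    have uv: "x0 < u" "u < v" "v < y0" using xy0(2) by (auto simp: u_def v_def)
    have uv_ab: "u \<in> {a..b}" "v \<in> {a..b}" using uv J_in[OF xy0(1)] by auto
    have "w \<in> (f ^^ j0) ` I" if "w \<in> {u..v}" for w
      by (rule between_closure_interval[OF fI_int, of x0 j0 y0]) (use j0 uv that in \<open>auto simp: K_def\<close>)
    then have "(f ^^ (n - j0)) ` {u..v} \<subseteq> (f ^^ (n - j0)) ` (f ^^ j0) ` I" by blast
    also have "\<dots> = (f ^^ n) ` I" using j0(1) by (simp add: image_comp flip: funpow_add)
    finally have uvI: "(f ^^ (n - j0)) ` {u..v} \<subseteq> I" using inv by blast
    obtain p q where pq: "p \<in> (f ^^ (n - j0)) ` {u..v}" "q \<in> (f ^^ (n - j0)) ` {u..v}" "p < q"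
      by (rule image_nontrivial[OF uv(2) uv_ab]) blast
    have pq_sub: "{p..q} \<subseteq> (f ^^ (n - j0)) ` {u..v}"
      using image_interval[of u v "n - j0"] pq uv_ab mem_is_interval_1_I by fastforce
    have dense: "I \<subseteq> closure (\<Union>k. ((f ^^ n) ^^ k) ` {p..q})"
      by (rule dense_orbit_of_interval[OF I(1,3) n inv nr pq(3)]) (use pq_sub uvI in blast)
    obtain y j1 where y: "y \<in> I" "j1 < n" "(f ^^ j1) y \<in> {c i<..<c (Suc i)}" using i(2) C_eq by blast
    have "y \<in> {a..b}" using y(1) I(3) by blast
    then obtain T where T: "open T" "y \<in> T" "\<forall>z\<in>{a..b} \<inter> T. (f ^^ j1) z \<in> {c i<..<c (Suc i)}"
      by (rule funpow_nbhd[OF _ open_greaterThanLessThan y(3)])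
    define U where "U = (\<Union>k. ((f ^^ n) ^^ k) ` {p..q})"
    have "y \<in> T \<inter> closure U"
      using IntI[OF T(2) subsetD[OF dense y(1)]] by (simp only: U_def)
    then have "T \<inter> U \<noteq> {}"
      using open_Int_closure_eq_empty[OF T(1), of U] by (metis empty_iff)
    then obtain k z where z: "z \<in> {p..q}" "((f ^^ n) ^^ k) z \<in> T" unfolding U_def by blast
    obtain w where w: "w \<in> {u..v}" "z = (f ^^ (n - j0)) w" using z(1) pq_sub by blast
    have "w \<in> {a..b}" using w(1) uv_ab by auto
    then have "((f ^^ n) ^^ k) z \<in> {a..b}" unfolding w(2) funpow_mult by (intro funpow_in)
    then have "(f ^^ j1) (((f ^^ n) ^^ k) z) \<in> {c i<..<c (Suc i)}" using T(3) z(2) by blast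
    then have "(f ^^ (j1 + n * k + (n - j0))) w \<in> {c i<..<c (Suc i)}"
      unfolding w(2) by (simp add: funpow_mult funpow_add)
    then show ?thesis using w(1) uv by (intro exI[of _ w] exI[of _ "j1 + n * k + (n - j0)"]) auto
  qed
  then obtain w0 k where w0: "x0 < w0" "w0 < y0" "(f ^^ k) w0 \<in> {c i<..<c (Suc i)}" by blast
  have xy0_ab: "x0 \<in> {a..b}" "y0 \<in> {a..b}" using J_in[OF xy0(1)] by blast+
  \<comment> \<open>Avoiding these finitely many points gives a small interval around a point that
    reaches branch \<open>i\<close> at time \<open>k\<close>, and the interval stays on a single
    branch at each earlier time. Extremality can then be carried along to branch
    \<open>i\<close>.\<close>
  define P where "P = (\<Union>j\<le>k. {x \<in> {a..b}. crit ((f ^^ j) x)})"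
  have finP: "finite P" unfolding P_def using finite_crit by blast
  have "w0 \<in> {a..b}" using w0 xy0_ab by auto
  then obtain T where T: "open T" "w0 \<in> T" "\<forall>z\<in>{a..b} \<inter> T. (f ^^ k) z \<in> {c i<..<c (Suc i)}"
    by (rule funpow_nbhd[OF _ open_greaterThanLessThan w0(3)])
  have op: "open (T \<inter> {x0<..<y0})" by (rule open_Int[OF T(1) open_greaterThanLessThan])
  have "w0 \<in> T \<inter> {x0<..<y0}" using T(2) w0 by simp
  then have "infinite (T \<inter> {x0<..<y0})"
    using finite_imp_not_open[of "T \<inter> {x0<..<y0}"] op by blast
  then have "T \<inter> {x0<..<y0} - P \<noteq> {}" using finP by (metis finite.emptyI finite_Diff2)
  moreover have "open (T \<inter> {x0<..<y0} - P)" using op finite_imp_closed[OF finP] by (rule open_Diff)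
  ultimately obtain w e where e: "e > 0" "ball w e \<subseteq> T \<inter> {x0<..<y0} - P" unfolding open_contains_ball by blast
  define u v where "u = w - e / 2" and "v = w + e / 2"
  have uw: "u < w" "w < v" "u < v" using e(1) by (auto simp: u_def v_def)
  have sub: "{u..v} \<subseteq> T \<inter> {x0<..<y0} - P"
    using e by (force simp: u_def v_def dist_real_def)
  have "u \<in> {u..v}" "v \<in> {u..v}" "w \<in> {u..v}" using uw by auto
  then have uvw: "u \<in> T \<inter> {x0<..<y0}" "v \<in> T \<inter> {x0<..<y0}" "w \<in> T \<inter> {x0<..<y0}" using sub by blast+
  have uv_ab: "u \<in> {a..b}" "v \<in> {a..b}" "w \<in> {a..b}" using uvw xy0_ab by auto
  have same: "(f ^^ j) x \<in> {c (branch_idx ((f ^^ j) w))..c (Suc (branch_idx ((f ^^ j) w)))}"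
    if j: "j \<le> k" and x: "x \<in> {u..v}" for j x
  proof (rule no_crit_same_branch[OF uw(3) uv_ab(1,2) _ uw(1,2) x])
    fix z assume z: "u < z" "z < v"
    then have "z \<in> {u..v}" by simp
    then have "z \<notin> P" using sub by blast
    moreover have "z \<in> {a..b}" using z uv_ab by auto
    ultimately show "\<not> crit ((f ^^ j) z)" using j unfolding P_def by blast
  qed
  have G: "G ((f ^^ j) u) ((f ^^ j) v)" if "j \<le> k" for j
    using that
  proof (induction j)
    case 0
    then show ?case using G0[of u v] uvw uw(3) by simp
  next
    case (Suc j)
    then show ?case
      using G_step[OF Suc.IH branch_idx_le same same] uw(3) by simp
  qed
  have "(f ^^ k) w \<in> {c i<..<c (Suc i)}" using T(3) uvw uv_ab by blast
  then have "branch_idx ((f ^^ k) w) = i" using branch_idx_interior[OF i(1)] by simp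
  then show ?thesis using G_step[OF G[of k] i(1)] same[of k u] same[of k v] uw(3) by simp
qed

end

context expanding_affine
begin

text \<open>
  A bounded vector field \<open>\<alpha>\<close> whose difference quotients increase by a definite amount under \<open>f\<close>
  would be one-sided Lipschitz by \<open>quotient_bound_spreads\<close>, yet its best one-sided Lipschitz constant
  could be improved by \<open>\<epsilon>\<close>.
\<close>

lemma no_growing_quotients:
  fixes \<alpha> :: "real \<Rightarrow> real"
  assumes bd: "\<And>x. x \<in> {a..b} \<Longrightarrow> \<bar>\<alpha> x\<bar> \<le> A" and \<epsilon>: "\<epsilon> > 0"
    and grow: "\<And>i x y. i \<le> d \<Longrightarrow> x \<in> {c i..c (Suc i)} \<Longrightarrow> y \<in> {c i..c (Suc i)} \<Longrightarrow> x \<noteq> y \<Longrightarrow>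
      (\<alpha> y - \<alpha> x) / (y - x) + \<epsilon> \<le> (\<alpha> (f y) - \<alpha> (f x)) / (f y - f x)"
  shows False
proof -
  obtain N \<delta> where N: "N \<ge> 1" "1 dvd N" "\<delta> > 0"
    "\<And>x y. x < y \<Longrightarrow> x \<in> {a..b} \<Longrightarrow> y \<in> {a..b} \<Longrightarrow> y - x < \<delta> \<Longrightarrow>
      \<exists>z. x \<le> z \<and> z \<le> y \<and> (x < z \<longrightarrow> clean N x z) \<and> (z < y \<longrightarrow> clean N z y)"
    by (rule expansion[of 1]) auto
  have A: "A \<ge> 0" using bd[of a] ab by auto
  have diff: "\<bar>\<alpha> y - \<alpha> x\<bar> \<le> 2 * A" if "x \<in> {a..b}" "y \<in> {a..b}" for x y
    using bd[OF that(1)] bd[OF that(2)] by linarith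
  have lip: "\<alpha> y - \<alpha> x \<le> (2 * A / \<delta>) * (y - x)" if "x \<in> {a..b} \<and> y \<in> {a..b}" "x < y" for x y
  proof (rule quotient_bound_spreads[where J="\<lambda>x y. x \<in> {a..b} \<and> y \<in> {a..b}" and N=N and \<delta>=\<delta> and A="2 * A"])
    show "(f x \<in> {a..b} \<and> f y \<in> {a..b}) \<and> (\<alpha> y - \<alpha> x) / (y - x) \<le> (\<alpha> (f y) - \<alpha> (f x)) / (f y - f x)"
      if "x \<in> {a..b} \<and> y \<in> {a..b}" "i \<le> d" "x \<in> {c i..c (Suc i)}" "y \<in> {c i..c (Suc i)}" "x \<noteq> y" for x y i
      using f_in that(1) grow[OF that(2-5)] \<epsilon> by (intro conjI) (blast, blast, linarith)
    show "\<alpha> y - \<alpha> x \<le> (2 * A / \<delta>) * (y - x)" if "x \<in> {a..b} \<and> y \<in> {a..b}" "x < y" "\<delta> \<le> y - x" for x y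
    proof -
      have "2 * A = (2 * A / \<delta>) * \<delta>" using N(3) by simp
      also have "\<dots> \<le> (2 * A / \<delta>) * (y - x)" using that(3) N(3) A by (intro mult_left_mono) auto
      finally show ?thesis using diff[of x y] that(1) by linarith
    qed
    show "\<bar>\<alpha> y - \<alpha> x\<bar> \<le> 2 * A" if "x \<in> {a..b} \<and> y \<in> {a..b}" for x y using diff that by blast
    show "x \<in> {a..b} \<and> y \<in> {a..b}" "x < y" by (fact that)+
  qed (use N(4) in \<open>blast, blast, blast, auto\<close>)
  define Q where "Q = {(\<alpha> y - \<alpha> x) / (y - x) | x y. x \<in> {a..b} \<and> y \<in> {a..b} \<and> x < y}"
  have bdd: "bdd_above Q"
    unfolding bdd_above_def Q_def using lip by (intro exI[of _ "2 * A / \<delta>"]) (auto simp: pos_divide_le_eq)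
  define M where "M = Sup Q"
  have le_M: "(\<alpha> y - \<alpha> x) / (y - x) \<le> M" if "x \<in> {a..b}" "y \<in> {a..b}" "x < y" for x y
    unfolding M_def by (rule cSup_upper[OF _ bdd]) (use that in \<open>unfold Q_def, blast\<close>)
  have le_M': "(\<alpha> y - \<alpha> x) / (y - x) \<le> M" if xy: "x \<in> {a..b}" "y \<in> {a..b}" "x \<noteq> y" for x y
  proof (cases "x < y")
    case True
    then show ?thesis using le_M xy by blast
  next
    case False
    then have "(\<alpha> x - \<alpha> y) / (x - y) \<le> M" using le_M xy by simp
    then show ?thesis by (metis minus_diff_eq minus_divide_divide)
  qed
  \<comment> \<open>Image quotients are at most \<open>M\<close> and exceed the original ones by at
    least \<open>\<epsilon>\<close>, so \<open>M - \<epsilon>\<close> is a bound within each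
    branch.\<close>
  have branch: "\<alpha> y - \<alpha> x \<le> (M - \<epsilon>) * (y - x)"
    if i: "i \<le> d" "x \<in> {c i..c (Suc i)}" "y \<in> {c i..c (Suc i)}" and xy: "x \<le> y" for i x y
  proof (cases "x = y")
    case False
    have in_ab: "x \<in> {a..b}" "y \<in> {a..b}" using branch_subset[OF i(1)] i by blast+
    have "f y - f x = s i * (y - x)" by (rule f_affine[OF i])
    then have "f x \<noteq> f y" using slope_nonzero[OF i(1)] False by auto
    then have "(\<alpha> (f y) - \<alpha> (f x)) / (f y - f x) \<le> M" using f_in in_ab by (intro le_M')
    then have "(\<alpha> y - \<alpha> x) / (y - x) \<le> M - \<epsilon>" using grow[OF i False] by linarith
    then show ?thesis using False xy by (simp add: pos_divide_le_eq)
  qed simp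
  have all: "\<alpha> y - \<alpha> x \<le> (M - \<epsilon>) * (y - x)" if xy: "x \<in> {a..b}" "y \<in> {a..b}" "x < y" for x y
  proof -
    \<comment> \<open>Breakpoints clamped to {x..y}: consecutive ones delimit a possibly degenerate
      piece of one branch, and the bounds for the pieces add up.\<close>
    define u where "u i = max x (min y (c i))" for i
    have step: "\<alpha> (u (Suc i)) - \<alpha> (u i) \<le> (M - \<epsilon>) * (u (Suc i) - u i)" if i: "i \<le> d" for i
    proof -
      have lt: "c i < c (Suc i)" using c_less[of i "Suc i"] i by simp
      show ?thesis
      proof (cases "c (Suc i) \<le> x \<or> y \<le> c i")
        case True
        then have "u (Suc i) = u i" using lt xy(3) by (auto simp: u_def)
        then show ?thesis by simp
      next
        case False
        then have "u i \<in> {c i..c (Suc i)}" "u (Suc i) \<in> {c i..c (Suc i)}" "u i \<le> u (Suc i)"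
          using lt xy(3) by (auto simp: u_def)
        then show ?thesis by (rule branch[OF i])
      qed
    qed
    have "(\<Sum>i<Suc d. \<alpha> (u (Suc i)) - \<alpha> (u i)) \<le> (\<Sum>i<Suc d. (M - \<epsilon>) * (u (Suc i) - u i))"
      by (rule sum_mono) (use step in auto)
    also have "\<dots> = (M - \<epsilon>) * (\<Sum>i<Suc d. u (Suc i) - u i)" by (rule sum_distrib_left[symmetric])
    finally have "\<alpha> (u (Suc d)) - \<alpha> (u 0) \<le> (M - \<epsilon>) * (u (Suc d) - u 0)"
      by (simp only: sum_lessThan_telescope[of "\<lambda>i. \<alpha> (u i)"] sum_lessThan_telescope[of u])
    moreover have "u (Suc d) = y" "u 0 = x" using xy c_ends by (auto simp: u_def)
    ultimately show ?thesis by simp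
  qed
  have "M \<le> M - \<epsilon>"
    unfolding M_def
  proof (rule cSup_least)
    have "(\<alpha> b - \<alpha> a) / (b - a) \<in> Q"
      unfolding Q_def using ab by (intro CollectI exI[of _ a] exI[of _ b]) simp
    then show "Q \<noteq> {}" by blast
    show "q \<le> Sup Q - \<epsilon>" if q: "q \<in> Q" for q
    proof -
      obtain x y where "q = (\<alpha> y - \<alpha> x) / (y - x)" "x \<in> {a..b}" "y \<in> {a..b}" "x < y"
        using q unfolding Q_def by blast
      then show ?thesis using all[of x y] by (simp add: pos_divide_le_eq M_def)
    qed
  qed
  then show False using \<epsilon> by simp
qed

section \<open>Critical points and breakpoints under conjugacy\<close>

lemma crit_not_locally_injective:
  assumes "crit x" "e > 0"
  shows "\<not> inj_on f ({a..b} \<inter> ball x e)"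
proof -
  obtain k where k: "k \<in> {1..d}" "x = c k" using assms(1) unfolding crit_def by blast
  obtain i where i: "k = Suc i" "i < d" using k(1) by (cases k) auto
  have neg: "s i * s (Suc i) < 0" by (rule affine_branchesD(3)[OF branches i(2)])
  have lt: "c i < x" "x < c (Suc (Suc i))" using c_less[of i "Suc i"] c_less[of "Suc i" "Suc (Suc i)"] i k by auto
  define S where "S = \<bar>s i\<bar> + \<bar>s (Suc i)\<bar> + 1"
  \<comment> \<open>Steps to the left and right that are proportional to the slope of the opposite
    side lead to equal values of \<open>f\<close>. The scale \<open>\<eta>\<close> fits both steps
    into the ball and into the adjacent branches.\<close>
  define \<eta> where "\<eta> = min (e / 2) (min (x - c i) (c (Suc (Suc i)) - x)) / S"
  have S: "S > 0" unfolding S_def by linarith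
  have \<eta>: "\<eta> > 0" using lt assms(2) S by (simp add: \<eta>_def)
  have \<eta>S: "\<eta> * S = min (e / 2) (min (x - c i) (c (Suc (Suc i)) - x))" using S by (simp add: \<eta>_def)
  define u v where "u = \<eta> * \<bar>s (Suc i)\<bar>" and "v = \<eta> * \<bar>s i\<bar>"
  have pos: "u > 0" "v > 0" using \<eta> neg by (auto simp: u_def v_def mult_less_0_iff)
  have "u \<le> \<eta> * S" "v \<le> \<eta> * S" unfolding u_def v_def S_def using \<eta> by (auto intro!: mult_left_mono)
  then have small: "u < e" "v < e" "u \<le> x - c i" "v \<le> c (Suc (Suc i)) - x"
    unfolding \<eta>S using assms(2) by auto
  have 1: "f x - f (x - u) = s i * (x - (x - u))"
    by (rule f_affine) (use i small pos k lt in auto)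
  have 2: "f (x + v) - f x = s (Suc i) * (x + v - x)"
    by (rule f_affine) (use i small pos k lt in auto)
  have "- s i * \<bar>s (Suc i)\<bar> = s (Suc i) * \<bar>s i\<bar>" using neg by (auto simp: abs_if mult_less_0_iff)
  then have "- s i * u = s (Suc i) * v" unfolding u_def v_def by (metis mult.left_commute)
  then have eq: "f (x - u) = f (x + v)" using 1 2 by simp
  have "x - u \<in> {a..b} \<inter> ball x e" "x + v \<in> {a..b} \<inter> ball x e"
    using small pos branch_subset[of i] branch_subset[of "Suc i"] i k lt by (auto simp: dist_real_def)
  moreover have "x - u \<noteq> x + v" using pos by simp
  ultimately show ?thesis using eq unfolding inj_on_def by blast
qed

lemma noncrit_locally_injective:
  assumes "x \<in> {a..b}" "\<not> crit x"
  obtains e where "e > 0" "inj_on f ({a..b} \<inter> ball x e)"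
proof -
  let ?i = "branch_idx x"
  note st = noncrit_strict[OF assms]
  define e where "e = min (if ?i = 0 then 1 else x - c ?i) (if ?i = d then 1 else c (Suc ?i) - x)"
  have "e > 0" using st by (auto simp: e_def)
  moreover have "y \<in> {c ?i..c (Suc ?i)}" if "y \<in> {a..b} \<inter> ball x e" for y
    using that c_ends by (auto simp: e_def dist_real_def split: if_splits)
  then have "inj_on f ({a..b} \<inter> ball x e)"
  proof (intro inj_onI)
    fix y z assume "y \<in> {a..b} \<inter> ball x e" "z \<in> {a..b} \<inter> ball x e" "f y = f z"
      and sub: "\<And>y. y \<in> {a..b} \<inter> ball x e \<Longrightarrow> y \<in> {c ?i..c (Suc ?i)}"
    then have "s ?i * (z - y) = 0" using f_affine[OF branch_idx_le sub sub, of y z] by simp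
    then show "y = z" using slope_nonzero[OF branch_idx_le] by simp
  qed
  ultimately show ?thesis using that by blast
qed

end

lemma strict_sequence_unique:
  fixes u w :: "nat \<Rightarrow> real"
  assumes "\<And>i j. i < j \<Longrightarrow> j \<le> n \<Longrightarrow> u i < u j" "\<And>i j. i < j \<Longrightarrow> j \<le> n \<Longrightarrow> w i < w j"
    and "u ` {..n} = w ` {..n}" "i \<le> n"
  shows "u i = w i"
proof -
  have sd: "sorted (map u [0..<Suc n]) \<and> distinct (map u [0..<Suc n])"
    if "\<And>i j. i < j \<Longrightarrow> j \<le> n \<Longrightarrow> u i < u j" for u :: "nat \<Rightarrow> real"
  proof
    have "u i \<le> u j" if "i \<le> j" "j < Suc n" for i j
      using \<open>\<And>i j. i < j \<Longrightarrow> j \<le> n \<Longrightarrow> u i < u j\<close>[of i j] that by (cases "i = j") auto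
    then show "sorted (map u [0..<Suc n])"
      unfolding sorted_iff_nth_mono by (simp del: upt_Suc)
    have "inj_on u {0..<Suc n}"
    proof (rule inj_onI)
      fix i j assume "i \<in> {0..<Suc n}" "j \<in> {0..<Suc n}" "u i = u j"
      then show "i = j"
        using \<open>\<And>i j. i < j \<Longrightarrow> j \<le> n \<Longrightarrow> u i < u j\<close>[of i j] \<open>\<And>i j. i < j \<Longrightarrow> j \<le> n \<Longrightarrow> u i < u j\<close>[of j i]
        by (cases i j rule: linorder_cases) auto
    qed
    then show "distinct (map u [0..<Suc n])" by (simp add: distinct_map del: upt_Suc)
  qed
  have "{0..<Suc n} = {..n}" by auto
  then have "set (map u [0..<Suc n]) = set (map w [0..<Suc n])" using assms(3) by (simp del: upt_Suc)
  then have "map u [0..<Suc n] = map w [0..<Suc n]"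
    using sorted_distinct_set_unique sd[of u, OF assms(1)] sd[of w, OF assms(2)] by blast
  then show ?thesis using assms(4) by (simp del: upt_Suc)
qed

lemma conjugacy_inverse:
  assumes "homeomorphism X Y h k" "\<And>x. x \<in> X \<Longrightarrow> h (f x) = g (h x)" "\<And>x. x \<in> X \<Longrightarrow> f x \<in> X" "y \<in> Y"
  shows "k (g y) = f (k y)"
proof -
  have "k y \<in> X" "h (k y) = y" using assms(1,4) unfolding homeomorphism_def by auto
  then have "k (g y) = k (h (f (k y)))" using assms(2) by metis
  then show ?thesis using assms(1) assms(3)[OF \<open>k y \<in> X\<close>] unfolding homeomorphism_def by simp
qed

text \<open>Critical points are exactly the points without a neighbourhood in {a..b} on which the
  map is injective, and a homeomorphism carries such neighbourhoods over.\<close>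

lemma conjugacy_crit:
  assumes F: "expanding_affine a b d f c s" and G: "expanding_affine a b d g c' s'"
    and h: "homeomorphism {a..b} {a..b} h k" "\<And>x. x \<in> {a..b} \<Longrightarrow> h (f x) = g (h x)"
    and x: "x \<in> {a..b}" "piecewise_affine.crit d c x"
  shows "piecewise_affine.crit d c' (h x)"
proof (rule ccontr)
  interpret F: expanding_affine a b d f c s by (rule F)
  interpret G: expanding_affine a b d g c' s' by (rule G)
  have hx: "h x \<in> {a..b}" and cont: "continuous_on {a..b} h" and inj: "inj_on h {a..b}" and im: "h ` {a..b} = {a..b}"
    using h(1) x(1) by (auto simp: homeomorphism_def intro: inj_on_inverseI)
  assume "\<not> G.crit (h x)"
  then obtain e where e: "e > 0" "inj_on g ({a..b} \<inter> ball (h x) e)"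
    by (rule G.noncrit_locally_injective[OF hx])
  obtain e' where e': "e' > 0" "\<And>y. y \<in> {a..b} \<Longrightarrow> dist y x < e' \<Longrightarrow> dist (h y) (h x) < e"
    using cont x(1) e(1) unfolding continuous_on_iff by metis
  have "inj_on f ({a..b} \<inter> ball x e')"
  proof (rule inj_onI)
    fix y z assume yz: "y \<in> {a..b} \<inter> ball x e'" "z \<in> {a..b} \<inter> ball x e'" "f y = f z"
    then have "g (h y) = g (h z)" using h(2) by (metis IntE)
    moreover have "h y \<in> {a..b} \<inter> ball (h x) e" "h z \<in> {a..b} \<inter> ball (h x) e"
      using yz e'(2)[of y] e'(2)[of z] im by (auto simp: dist_commute)
    ultimately have "h y = h z" using e(2) unfolding inj_on_def by blast
    then show "y = z" using inj yz unfolding inj_on_def by blast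
  qed
  then show False using F.crit_not_locally_injective[OF x(2) e'(1)] by blast
qed

text \<open>Critical points correspond in both directions and end points go to end points, so the
  two sets of breakpoints correspond. As \<open>h\<close> is monotone, the increasing enumeration is
  either kept or reversed.\<close>

lemma conjugacy_breakpoints:
  assumes F: "expanding_affine a b d f c s" and G: "expanding_affine a b d g c' s'"
    and conj: "conjugacy {a..b} f {a..b} g h"
  obtains (mono) "strict_mono_on {a..b} h" "\<And>i. i \<le> Suc d \<Longrightarrow> h (c i) = c' i"
    | (anti) "strict_antimono_on {a..b} h" "\<And>i. i \<le> Suc d \<Longrightarrow> h (c i) = c' (Suc d - i)"
proof -
  interpret F: expanding_affine a b d f c s by (rule F)
  interpret G: expanding_affine a b d g c' s' by (rule G)
  obtain k where h: "homeomorphism {a..b} {a..b} h k" and hf: "\<And>x. x \<in> {a..b} \<Longrightarrow> h (f x) = g (h x)"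
    using conj unfolding conjugacy_def by blast
  have k: "homeomorphism {a..b} {a..b} k h" by (rule homeomorphism_symD[OF h])
  have kg: "k (g y) = f (k y)" if "y \<in> {a..b}" for y
  proof (rule conjugacy_inverse[of "{a..b}" "{a..b}" h k f g y])
    show "homeomorphism {a..b} {a..b} h k" "y \<in> {a..b}" by (fact h, fact that)
    show "h (f x) = g (h x)" if "x \<in> {a..b}" for x by (rule hf[OF that])
    show "f x \<in> {a..b}" if "x \<in> {a..b}" for x by (rule F.f_in[OF that])
  qed
  have im: "h ` {a..b} = {a..b}" by (rule homeomorphism_image1[OF h])
  have cont: "continuous_on {a..b} h" by (rule homeomorphism_cont1[OF h])
  have kin: "k y \<in> {a..b} \<and> h (k y) = y" if "y \<in> {a..b}" for y
    using imageI[OF that, of k] homeomorphism_apply2[OF h that] unfolding homeomorphism_image2[OF h] by (rule conjI)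
  have "\<And>x. x \<in> {a..b} \<Longrightarrow> k (h x) = x" by (rule homeomorphism_apply1[OF h])
  then have inj: "inj_on h {a..b}" by (rule inj_on_inverseI)
  have set_c: "c ` {..Suc d} = {a, b} \<union> {x \<in> {a..b}. F.crit x}"
    and set_c': "c' ` {..Suc d} = {a, b} \<union> {x \<in> {a..b}. G.crit x}"
  proof -
    have *: "u ` {..Suc d} = {u 0, u (Suc d)} \<union> {x. \<exists>l\<in>{1..d}. x = u l}" for u :: "nat \<Rightarrow> real"
    proof -
      have "{..Suc d} = {0, Suc d} \<union> {1..d}" by auto
      then have "u ` {..Suc d} = u ` ({0, Suc d} \<union> {1..d})" by simp
      then show ?thesis unfolding image_Un by auto
    qed
    show "c ` {..Suc d} = {a, b} \<union> {x \<in> {a..b}. F.crit x}"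
      unfolding * F.c_ends F.crit_def using F.c_in by force
    show "c' ` {..Suc d} = {a, b} \<union> {x \<in> {a..b}. G.crit x}"
      unfolding * G.c_ends G.crit_def using G.c_in by force
  qed
  have "h ` {x \<in> {a..b}. F.crit x} = {x \<in> {a..b}. G.crit x}"
  proof
    show "h ` {x \<in> {a..b}. F.crit x} \<subseteq> {x \<in> {a..b}. G.crit x}"
      using conjugacy_crit[OF F G h hf] im by blast
    show "{x \<in> {a..b}. G.crit x} \<subseteq> h ` {x \<in> {a..b}. F.crit x}"
    proof
      fix y assume "y \<in> {x \<in> {a..b}. G.crit x}"
      then have y: "y \<in> {a..b}" "G.crit y" by auto
      then have "F.crit (k y)" using conjugacy_crit[OF G F k kg] by blast
      then show "y \<in> h ` {x \<in> {a..b}. F.crit x}" using kin[OF y(1)] by (metis (mono_tags, lifting) image_eqI mem_Collect_eq)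
    qed
  qed
  then have img: "h ` (c ` {..Suc d}) = c' ` {..Suc d}" if "{h a, h b} = {a, b}"
    unfolding set_c set_c' image_Un using that by simp
  have ends: "a \<in> {a..b}" "b \<in> {a..b}" using F.ab by auto
  obtain xa xb where xab: "xa \<in> {a..b}" "h xa = a" "xb \<in> {a..b}" "h xb = b" using im ends by (metis imageE)
  have hab: "h a \<in> {a..b}" "h b \<in> {a..b}" using im ends by blast+
  have "strict_mono_on {a..b} h \<or> strict_antimono_on {a..b} h"
    using injective_eq_monotone_map[OF is_interval_cc cont] inj by blast
  then show thesis
  proof
    assume m: "strict_mono_on {a..b} h"
    have "h a \<le> h xa" "h xb \<le> h b"
      using strict_mono_onD[OF m, of a xa] strict_mono_onD[OF m, of xb b] xab(1,3) ends by (auto simp: le_less)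
    then have "h a = a" "h b = b" using xab hab by auto
    then have "(\<lambda>i. h (c i)) ` {..Suc d} = c' ` {..Suc d}" using img by (simp add: image_image)
    moreover have "h (c i) < h (c j)" if "i < j" "j \<le> Suc d" for i j
      using strict_mono_onD[OF m] F.c_in F.c_less that by simp
    ultimately have "h (c i) = c' i" if "i \<le> Suc d" for i
      using strict_sequence_unique[of "Suc d" "\<lambda>i. h (c i)" c' i] G.c_less that by blast
    then show thesis using mono m by blast
  next
    assume m: "strict_antimono_on {a..b} h"
    have md: "h y < h x" if "x \<in> {a..b}" "y \<in> {a..b}" "x < y" for x y
      using monotone_onD[OF m that] .
    have "h xb \<le> h a" "h b \<le> h xa"
      using md[of a xb] md[of xa b] xab(1,3) ends by (auto simp: le_less)
    then have ab': "h a = b" "h b = a" using xab hab by auto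
    have "(\<lambda>i. h (c (Suc d - i))) ` {..Suc d} = h ` c ` ((\<lambda>i. Suc d - i) ` {..Suc d})" by (simp add: image_image)
    also have "(\<lambda>i. Suc d - i) ` {..Suc d} = {..Suc d}"
    proof
      show "{..Suc d} \<subseteq> (\<lambda>i. Suc d - i) ` {..Suc d}"
      proof
        fix i assume "i \<in> {..Suc d}"
        then show "i \<in> (\<lambda>i. Suc d - i) ` {..Suc d}" by (intro image_eqI[of _ _ "Suc d - i"]) auto
      qed
    qed auto
    finally have "(\<lambda>i. h (c (Suc d - i))) ` {..Suc d} = c' ` {..Suc d}" using img ab' by auto
    moreover have "h (c (Suc d - i)) < h (c (Suc d - j))" if "i < j" "j \<le> Suc d" for i j
      using md F.c_in F.c_less that by simp
    ultimately have eq: "h (c (Suc d - i)) = c' i" if "i \<le> Suc d" for i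
      using strict_sequence_unique[of "Suc d" "\<lambda>i. h (c (Suc d - i))" c' i] G.c_less that by blast
    have "h (c i) = c' (Suc d - i)" if "i \<le> Suc d" for i
      using eq[of "Suc d - i"] that by simp
    then show thesis using anti m by blast
  qed
qed

lemma exp_familyD:
  assumes "a < b" "f \<in> exp_family a b d"
  obtains c s where "expanding_affine a b d f c s" "\<And>i. i \<le> Suc d \<Longrightarrow> breakpoint a b d f i = c i"
    "\<And>i. i \<le> d \<Longrightarrow> slope a b d f i = s i"
proof -
  have m: "modal_affine_map a b d f" and e: "eventually_expanding {a..b} f"
    using assms(2) unfolding exp_family_def by auto
  obtain c s where cs: "affine_branches a b d f c s" using m unfolding modal_affine_map_def by blast
  have "f \<in> {a..b} \<rightarrow>\<^sub>E {a..b}" "continuous_on {a..b} f" using m unfolding modal_affine_map_def by blast+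
  then have "expanding_affine a b d f c s"
    using assms(1) cs e by unfold_locales (auto dest: PiE_mem simp del: atLeastAtMost_iff)
  then show ?thesis using that breakpoint_eq[OF cs] slope_eq[OF cs] by blast
qed

text \<open>Applies \<open>essential_slopes_eq\<close> with \<open>\<alpha>\<close> equal to
  \<open>h\<close> or to its negative, whichever increases. Changing the sign of \<open>h\<close>
  leaves the linear relation between increments intact, so the slopes of \<open>g\<close> enter with
  their own signs in both cases.\<close>

lemma essential_slopes_rigid:
  assumes ab: "a < b" and f: "f \<in> exp_family a b d" and g: "g \<in> exp_family a b d"
    and conj: "conjugacy {a..b} f {a..b} g h"
    and ge: "\<forall>i\<in>essential_branches a b d f.
               \<bar>slope a b d g (corresponding_branch a b d h i)\<bar> \<ge> \<bar>slope a b d f i\<bar>"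
    and i: "i \<in> essential_branches a b d f"
  shows "slope a b d f i = slope a b d g (corresponding_branch a b d h i)"
proof -
  obtain c s where F: "expanding_affine a b d f c s" and bf: "\<And>i. i \<le> Suc d \<Longrightarrow> breakpoint a b d f i = c i"
    and sf: "\<And>i. i \<le> d \<Longrightarrow> slope a b d f i = s i" by (rule exp_familyD[OF ab f]) blast
  obtain c' s' where G: "expanding_affine a b d g c' s'"
    and sg: "\<And>i. i \<le> d \<Longrightarrow> slope a b d g i = s' i" by (rule exp_familyD[OF ab g]) blast
  interpret F: expanding_affine a b d f c s by (rule F)
  interpret G: expanding_affine a b d g c' s' by (rule G)
  have hf: "h (f x) = g (h x)" if "x \<in> {a..b}" for x using conj that unfolding conjugacy_def by blast
  have cont: "continuous_on {a..b} h" using conj unfolding conjugacy_def homeomorphism_def by blast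
  have ess: "i \<in> essential_branches a b d f \<longleftrightarrow>
      i \<le> d \<and> (\<exists>C. minimal_cycle {a..b} f C \<and> C \<inter> {c i<..<c (Suc i)} \<noteq> {})" for i
    unfolding essential_branches_def using bf[of i] bf[of "Suc i"] by (cases "i \<le> d") simp_all
  obtain C where C: "minimal_cycle {a..b} f C" "i \<le> d" "C \<inter> {c i<..<c (Suc i)} \<noteq> {}" using i ess by blast
  define m where "m j = s' (corresponding_branch a b d h j)" for j
  have ge': "\<bar>m j\<bar> \<ge> \<bar>s j\<bar>" if "j \<le> d" "C \<inter> {c j<..<c (Suc j)} \<noteq> {}" for j
  proof -
    have "corresponding_branch a b d h j \<le> d" using that(1) by (simp add: corresponding_branch_def)
    then show ?thesis using ge that C(1) ess[of j] sf[OF that(1)] sg unfolding m_def by metis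
  qed
  have in_ab: "x \<in> {a..b}" if "x \<in> {c j..c (Suc j)}" "j \<le> d" for x j using F.branch_subset that by blast
  have "m i = s i"
    using F G conj
  proof (cases rule: conjugacy_breakpoints)
    case mono
    have le: "h x \<le> h y" if "x \<in> {a..b}" "y \<in> {a..b}" "x \<le> y" for x y
      using strict_mono_onD[OF mono(1) that(1,2)] that(3) by (cases "x = y") simp_all
    have m_eq: "m j = s' j" for j
      using strict_mono_onD[OF mono(1), of a b] ab by (simp add: m_def corresponding_branch_def)
    have "h (f y) - h (f x) = m j * (h y - h x)"
      if j: "j \<le> d" and x: "x \<in> {c j..c (Suc j)}" and y: "y \<in> {c j..c (Suc j)}" for j x y
    proof -
      have "h z \<in> {c' j..c' (Suc j)}" if "z \<in> {c j..c (Suc j)}" for z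
      proof -
        have "h (c j) \<le> h z" "h z \<le> h (c (Suc j))"
          using that j by (auto intro!: le in_ab[OF that j] F.c_in simp del: atLeastAtMost_iff simp: atLeastAtMost_iff[of z])
        then show ?thesis using mono(2) j by simp
      qed
      then have "g (h y) - g (h x) = s' j * (h y - h x)" using x y by (intro G.f_affine[OF j])
      then show ?thesis using hf[OF in_ab[OF x j]] hf[OF in_ab[OF y j]] m_eq[of j] by simp
    qed
    note cj = this
    show ?thesis
      by (rule F.essential_slopes_eq[where \<alpha>=h and m=m and C=C and i=i])
        (fact mono(1) cont cj C ge')+
  next
    case anti
    have md: "h y < h x" if "x \<in> {a..b}" "y \<in> {a..b}" "x < y" for x y using monotone_onD[OF anti(1) that] .
    have le: "h y \<le> h x" if "x \<in> {a..b}" "y \<in> {a..b}" "x \<le> y" for x y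
      using md[OF that(1,2)] that(3) by (cases "x = y") simp_all
    have m_eq: "m j = s' (d - j)" for j
      using md[of a b] ab by (simp add: m_def corresponding_branch_def)
    have mono': "strict_mono_on {a..b} (\<lambda>x. - h x)" using md by (intro strict_mono_onI) simp
    have "- h (f y) - - h (f x) = m j * (- h y - - h x)"
      if j: "j \<le> d" and x: "x \<in> {c j..c (Suc j)}" and y: "y \<in> {c j..c (Suc j)}" for j x y
    proof -
      have "h z \<in> {c' (d - j)..c' (Suc (d - j))}" if "z \<in> {c j..c (Suc j)}" for z
      proof -
        have "h z \<le> h (c j)" "h (c (Suc j)) \<le> h z"
          using that j by (auto intro!: le in_ab[OF that j] F.c_in simp del: atLeastAtMost_iff simp: atLeastAtMost_iff[of z])
        then show ?thesis using anti(2)[of j] anti(2)[of "Suc j"] j by (simp add: Suc_diff_le)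
      qed
      then have "g (h y) - g (h x) = s' (d - j) * (h y - h x)" using x y by (intro G.f_affine) auto
      then show ?thesis
        using hf[OF in_ab[OF x j]] hf[OF in_ab[OF y j]] m_eq[of j] by (simp add: algebra_simps)
    qed
    note cj = this
    have cont': "continuous_on {a..b} (\<lambda>x. - h x)" by (rule continuous_on_minus[OF cont])
    show ?thesis
      by (rule F.essential_slopes_eq[where \<alpha>="\<lambda>x. - h x" and m=m and C=C and i=i])
        (fact mono' cont' cj C ge')+
  qed
  then show ?thesis unfolding m_def using sf sg C(2) by (simp add: corresponding_branch_def)
qed

section \<open>Smooth functions and product series\<close>

lemma Ck_on_cong:
  assumes "open U" "\<And>x. x \<in> U \<Longrightarrow> \<phi> x = \<psi> x" "Ck_on k U \<phi>"
  shows "Ck_on k U \<psi>"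
  using assms(2,3)
proof (induction k arbitrary: \<phi> \<psi>)
  case 0
  show ?case unfolding Ck_on.simps
    by (rule continuous_on_eq[of U \<phi>]) (use 0 in simp_all)
next
  case (Suc k)
  have has: "(\<psi> has_derivative frechet_derivative \<phi> (at x)) (at x)" if x: "x \<in> U" for x
  proof (rule has_derivative_transform_within_open[OF _ assms(1) x])
    show "(\<phi> has_derivative frechet_derivative \<phi> (at x)) (at x)"
      using Suc.prems(2) x by (simp add: frechet_derivative_works)
  qed (simp add: Suc.prems(1))
  have "Ck_on k U (\<lambda>x. frechet_derivative \<psi> (at x) v)" for v
  proof (rule Suc.IH)
    show "Ck_on k U (\<lambda>x. frechet_derivative \<phi> (at x) v)" using Suc.prems(2) by simp
    show "frechet_derivative \<phi> (at x) v = frechet_derivative \<psi> (at x) v" if "x \<in> U" for x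
      using frechet_derivative_at[OF has[OF that]] by simp
  qed
  moreover have "\<forall>x\<in>U. \<psi> differentiable (at x)" using has differentiable_def by blast
  ultimately show ?case by simp
qed

lemma Ck_on_SucI:
  assumes "open U" "\<And>x. x \<in> U \<Longrightarrow> (\<phi> has_derivative (\<lambda>v. D v x)) (at x)" "\<And>v. Ck_on k U (D v)"
  shows "Ck_on (Suc k) U \<phi>"
proof -
  have "Ck_on k U (\<lambda>x. frechet_derivative \<phi> (at x) v)" for v
  proof (rule Ck_on_cong[OF assms(1) _ assms(3)])
    show "D v x = frechet_derivative \<phi> (at x) v" if "x \<in> U" for x
      using frechet_derivative_at[OF assms(2)[OF that]] by metis
  qed
  moreover have "\<forall>x\<in>U. \<phi> differentiable (at x)" using assms(2) differentiable_def by blast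
  ultimately show ?thesis by simp
qed

lemma Ck_on_has_derivative:
  "Ck_on (Suc k) U \<phi> \<Longrightarrow> x \<in> U \<Longrightarrow> (\<phi> has_derivative (\<lambda>v. frechet_derivative \<phi> (at x) v)) (at x)"
  by (simp add: frechet_derivative_works)

lemma Ck_on_deriv: "Ck_on (Suc k) U \<phi> \<Longrightarrow> Ck_on k U (\<lambda>x. frechet_derivative \<phi> (at x) v)"
  by simp

lemma Ck_on_SucD: "Ck_on (Suc k) U \<phi> \<Longrightarrow> Ck_on k U \<phi>"
proof (induction k arbitrary: \<phi>)
  case 0
  then show ?case
    by (auto intro!: continuous_at_imp_continuous_on differentiable_imp_continuous_within)
next
  case (Suc k)
  then show ?case by (metis Ck_on.simps(2))
qed

lemma Ck_on_const: "Ck_on k U (\<lambda>x. c)"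
proof (induction k arbitrary: c)
  case (Suc k)
  then show ?case by (simp add: frechet_derivative_const)
qed simp

lemma Ck_on_bounded_linear:
  assumes "bounded_linear L" "open U"
  shows "Ck_on k U L"
proof (cases k)
  case 0
  then show ?thesis using linear_continuous_on[OF assms(1)] by simp
next
  case (Suc k')
  show ?thesis unfolding Suc
    by (rule Ck_on_SucI[OF assms(2), where D="\<lambda>v x. L v"])
      (simp_all add: assms(1) bounded_linear_imp_has_derivative Ck_on_const)
qed

lemma Ck_on_add:
  assumes "open U"
  shows "Ck_on k U \<phi> \<Longrightarrow> Ck_on k U \<psi> \<Longrightarrow> Ck_on k U (\<lambda>x. \<phi> x + \<psi> x)"
proof (induction k arbitrary: \<phi> \<psi>)
  case 0
  then show ?case by (simp add: continuous_on_add)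
next
  case (Suc k)
  show ?case
    by (rule Ck_on_SucI[OF assms, OF has_derivative_add[OF Ck_on_has_derivative[OF Suc.prems(1)] Ck_on_has_derivative[OF Suc.prems(2)]]])
      (auto intro!: Suc.IH Ck_on_deriv Suc.prems)
qed

lemma Ck_on_mult:
  assumes "open U"
  shows "Ck_on k U \<phi> \<Longrightarrow> Ck_on k U \<psi> \<Longrightarrow> Ck_on k U (\<lambda>x. \<phi> x * \<psi> x)"
proof (induction k arbitrary: \<phi> \<psi>)
  case 0
  then show ?case by (simp add: continuous_on_mult)
next
  case (Suc k)
  show ?case
    by (rule Ck_on_SucI[OF assms, OF has_derivative_mult[OF Ck_on_has_derivative[OF Suc.prems(1)] Ck_on_has_derivative[OF Suc.prems(2)]]])
      (assumption | intro Ck_on_add[OF assms] Suc.IH Ck_on_SucD[OF Suc.prems(1)] Ck_on_SucD[OF Suc.prems(2)]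
        Ck_on_deriv[OF Suc.prems(1)] Ck_on_deriv[OF Suc.prems(2)])+
qed

lemma Ck_on_diff:
  assumes "open U" "Ck_on k U \<phi>" "Ck_on k U \<psi>"
  shows "Ck_on k U (\<lambda>x. \<phi> x - \<psi> x)"
  using Ck_on_add[OF assms(1,2) Ck_on_mult[OF assms(1) Ck_on_const[of k U "- 1"] assms(3)]] by simp

lemma Ck_on_inverse:
  assumes "open U" "\<And>x. x \<in> U \<Longrightarrow> \<phi> x \<noteq> 0"
  shows "Ck_on k U \<phi> \<Longrightarrow> Ck_on k U (\<lambda>x. inverse (\<phi> x))"
proof (induction k)
  case 0
  then show ?case using assms by (auto intro!: continuous_on_inverse)
next
  case (Suc k)
  have inv: "Ck_on k U (\<lambda>x. inverse (\<phi> x))" by (rule Suc.IH[OF Ck_on_SucD[OF Suc.prems]])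
  show ?case
  proof (rule Ck_on_SucI[OF assms(1)])
    show "((\<lambda>x. inverse (\<phi> x)) has_derivative
        (\<lambda>v. - 1 * (inverse (\<phi> x) * frechet_derivative \<phi> (at x) v * inverse (\<phi> x)))) (at x)" if "x \<in> U" for x
      using Deriv.has_derivative_inverse[OF assms(2)[OF that] Ck_on_has_derivative[OF Suc.prems that]] by simp
    show "Ck_on k U (\<lambda>x. - 1 * (inverse (\<phi> x) * frechet_derivative \<phi> (at x) v * inverse (\<phi> x)))" for v
      by (intro Ck_on_mult[OF assms(1)] Ck_on_const inv Ck_on_deriv Suc.prems)
  qed
qed

lemma Ck_on_sum:
  assumes "open U" "\<And>i. i \<in> A \<Longrightarrow> Ck_on k U (\<phi> i)"
  shows "Ck_on k U (\<lambda>x. \<Sum>i\<in>A. \<phi> i x)"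
  using assms(2)
proof (induction A rule: infinite_finite_induct)
  case (insert i A)
  then show ?case using Ck_on_add[OF assms(1), of k "\<phi> i" "\<lambda>x. \<Sum>i\<in>A. \<phi> i x"] by simp
qed (simp_all add: Ck_on_const)

lemma Ck_on_subset: "Ck_on k U \<phi> \<Longrightarrow> V \<subseteq> U \<Longrightarrow> Ck_on k V \<phi>"
proof (induction k arbitrary: \<phi>)
  case 0
  then show ?case by (auto intro: continuous_on_subset)
qed auto

text \<open>Spares formulas for higher derivatives: it suffices to exhibit a class of functions that
  differentiation does not leave.\<close>

lemma Ck_on_coinduct:
  assumes "open U" "\<phi> \<in> \<A>"
    and "\<And>\<phi>. \<phi> \<in> \<A> \<Longrightarrow> \<exists>D. (\<forall>x\<in>U. (\<phi> has_derivative (\<lambda>v. D v x)) (at x)) \<and> (\<forall>v. D v \<in> \<A>)"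
  shows "Ck_on k U \<phi>"
  using assms(2)
proof (induction k arbitrary: \<phi>)
  case 0
  then show ?case using assms(3)[OF 0]
    by (auto intro!: continuous_at_imp_continuous_on dest!: has_derivative_continuous)
next
  case (Suc k)
  obtain D where D: "\<forall>x\<in>U. (\<phi> has_derivative (\<lambda>v. D v x)) (at x)" "\<forall>v. D v \<in> \<A>"
    using assms(3)[OF Suc.prems] by blast
  show ?case by (rule Ck_on_SucI[OF assms(1), of _ D]) (use D Suc.IH in blast)+
qed

text \<open>\<open>prod_series t E\<close> is the bounded solution \<open>X\<close> of \<open>X m = E m + t m * X (m + 1)\<close>.\<close>

definition prod_series :: "(nat \<Rightarrow> real) \<Rightarrow> (nat \<Rightarrow> real) \<Rightarrow> nat \<Rightarrow> real" where
  "prod_series t E m = (\<Sum>n. E (m + n) * (\<Prod>i<n. t (m + i)))"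

text \<open>Uniformity in the starting index \<open>m\<close> makes the series bounded in
  \<open>m\<close>, and bounded solutions of its recursion are unique.\<close>

definition decaying :: "(nat \<Rightarrow> real) \<Rightarrow> real \<Rightarrow> real \<Rightarrow> bool" where
  "decaying t C r \<longleftrightarrow> 0 \<le> C \<and> 0 \<le> r \<and> r < 1 \<and> (\<forall>m n. \<bar>\<Prod>i<n. t (m + i)\<bar> \<le> C * r ^ n)"

lemma decaying_const_nonneg: "decaying t C r \<Longrightarrow> 0 \<le> C / (1 - r)"
  by (simp add: decaying_def)

lemma prod_series_summable:
  assumes "decaying t C r" "\<And>m. \<bar>E m\<bar> \<le> B"
  shows "summable (\<lambda>n. E (m + n) * (\<Prod>i<n. t (m + i)))"
    and "\<bar>prod_series t E m\<bar> \<le> C / (1 - r) * B"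
proof -
  have B: "0 \<le> B" using assms(2)[of 0] by linarith
  have r: "0 \<le> r" "r < 1" "0 \<le> C" using assms(1) by (auto simp: decaying_def)
  have bd: "\<bar>E (m + n) * (\<Prod>i<n. t (m + i))\<bar> \<le> C * B * r ^ n" for n
  proof -
    have "\<bar>E (m + n) * (\<Prod>i<n. t (m + i))\<bar> = \<bar>E (m + n)\<bar> * \<bar>\<Prod>i<n. t (m + i)\<bar>" by (rule abs_mult)
    also have "\<dots> \<le> B * (C * r ^ n)"
      using assms B by (intro mult_mono) (simp_all only: decaying_def abs_ge_zero)
    finally show ?thesis by (simp add: mult_ac)
  qed
  have geo: "(\<lambda>n. C * B * r ^ n) sums (C * B * (1 / (1 - r)))"
    using r by (intro sums_mult geometric_sums) simp
  have abs: "summable (\<lambda>n. \<bar>E (m + n) * (\<Prod>i<n. t (m + i))\<bar>)"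
    by (rule summable_comparison_test'[OF sums_summable[OF geo], of 0]) (use bd in simp)
  then show "summable (\<lambda>n. E (m + n) * (\<Prod>i<n. t (m + i)))" by (rule summable_rabs_cancel)
  have "\<bar>prod_series t E m\<bar> \<le> (\<Sum>n. \<bar>E (m + n) * (\<Prod>i<n. t (m + i))\<bar>)"
    unfolding prod_series_def by (rule summable_rabs[OF abs])
  also have "\<dots> \<le> (\<Sum>n. C * B * r ^ n)"
    by (rule suminf_le[OF bd abs sums_summable[OF geo]])
  also have "\<dots> = C / (1 - r) * B" using sums_unique[OF geo] by simp
  finally show "\<bar>prod_series t E m\<bar> \<le> C / (1 - r) * B" .
qed

lemma prod_series_rec:
  assumes "decaying t C r" "\<And>m. \<bar>E m\<bar> \<le> B"
  shows "prod_series t E m = E m + t m * prod_series t E (Suc m)"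
proof -
  have "prod_series t E m = E m + (\<Sum>n. E (m + Suc n) * (\<Prod>i<Suc n. t (m + i)))"
    unfolding prod_series_def
    using suminf_split_head[OF prod_series_summable(1)[of t C r E B m, OF assms]] by simp
  also have "(\<lambda>n. E (m + Suc n) * (\<Prod>i<Suc n. t (m + i))) = (\<lambda>n. t m * (E (Suc m + n) * (\<Prod>i<n. t (Suc m + i))))"
    by (simp add: prod.lessThan_Suc_shift mult_ac del: prod.lessThan_Suc)
  also have "(\<Sum>n. t m * (E (Suc m + n) * (\<Prod>i<n. t (Suc m + i)))) = t m * prod_series t E (Suc m)"
    unfolding prod_series_def by (rule suminf_mult[OF prod_series_summable(1)[OF assms]])
  finally show ?thesis .
qed

text \<open>The difference \<open>Z\<close> of two bounded solutions satisfies
  \<open>Z m = t m * Z (Suc m)\<close>; iterating this multiplies a bounded sequence by arbitrarily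
  small products.\<close>

lemma prod_series_unique:
  assumes t: "decaying t C r" and E: "\<And>m. \<bar>E m\<bar> \<le> B"
    and X: "\<And>m. X m = E m + t m * X (Suc m)" "\<And>m. \<bar>X m\<bar> \<le> B'"
  shows "X m = prod_series t E m"
proof -
  define Z where "Z m = X m - prod_series t E m" for m
  have Z: "Z m = t m * Z (Suc m)" for m
    using X(1)[of m] prod_series_rec[of t C r E B m, OF t E] by (simp add: Z_def algebra_simps)
  have Zn: "Z m = (\<Prod>i<n. t (m + i)) * Z (m + n)" for n
  proof (induction n)
    case (Suc n)
    then show ?case using Z[of "m + n"] by (simp add: mult.assoc)
  qed simp
  define B'' where "B'' = B' + C / (1 - r) * B"
  have ZB: "\<bar>Z m\<bar> \<le> B''" for m
    using X(2)[of m] prod_series_summable(2)[of t C r E B m, OF t E] unfolding Z_def B''_def by linarith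
  have "\<bar>Z m\<bar> \<le> C * r ^ n * B''" for n
  proof -
    have "\<bar>Z m\<bar> = \<bar>\<Prod>i<n. t (m + i)\<bar> * \<bar>Z (m + n)\<bar>" using Zn[of n] by (metis abs_mult)
    also have "\<dots> \<le> C * r ^ n * B''"
      using t ZB by (intro mult_mono) (auto simp: decaying_def)
    finally show ?thesis .
  qed
  moreover have "(\<lambda>n. C * r ^ n * B'') \<longlonglongrightarrow> C * 0 * B''"
    using t by (intro tendsto_intros LIMSEQ_power_zero) (simp add: decaying_def)
  ultimately have "\<bar>Z m\<bar> \<le> C * 0 * B''" by (intro LIMSEQ_le_const[of "\<lambda>n. C * r ^ n * B''"]) auto
  then show ?thesis by (simp add: Z_def)
qed

text \<open>Differentiability at \<open>p\<close> in the supremum norm over \<open>m\<close>: one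
  neighbourhood serves all indices. The derivative in direction \<open>v\<close> keeps the point as
  an argument, so that \<open>D v\<close> is again a sequence of functions which can be
  differentiated.\<close>

definition uniformly_differentiable ::
    "(nat \<Rightarrow> 'a::euclidean_space \<Rightarrow> real) \<Rightarrow> ('a \<Rightarrow> nat \<Rightarrow> 'a \<Rightarrow> real) \<Rightarrow> 'a \<Rightarrow> bool" where
  "uniformly_differentiable Y D p \<longleftrightarrow>
     (\<forall>m. linear (\<lambda>v. D v m p)) \<and> (\<exists>B\<ge>0. \<forall>m v. \<bar>D v m p\<bar> \<le> B * norm v) \<and>
     (\<forall>\<epsilon>>0. \<forall>\<^sub>F q in nhds p. \<forall>m. \<bar>Y m q - Y m p - D (q - p) m p\<bar> \<le> \<epsilon> * norm (q - p))"

lemma uniformly_differentiable_lipschitz: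
  assumes "uniformly_differentiable Y D p"
  obtains B where "B \<ge> 0" "\<forall>m v. \<bar>D v m p\<bar> \<le> B * norm v"
    "\<forall>\<^sub>F q in nhds p. \<forall>m. \<bar>Y m q - Y m p\<bar> \<le> B * norm (q - p)"
proof -
  obtain B where B: "B \<ge> 0" "\<forall>m v. \<bar>D v m p\<bar> \<le> B * norm v"
    using assms unfolding uniformly_differentiable_def by blast
  have "\<forall>\<^sub>F q in nhds p. \<forall>m. \<bar>Y m q - Y m p - D (q - p) m p\<bar> \<le> 1 * norm (q - p)"
    using assms zero_less_one unfolding uniformly_differentiable_def by blast
  then have "\<forall>\<^sub>F q in nhds p. \<forall>m. \<bar>Y m q - Y m p\<bar> \<le> (B + 1) * norm (q - p)"
  proof (rule eventually_mono, intro allI)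
    fix q m assume "\<forall>m. \<bar>Y m q - Y m p - D (q - p) m p\<bar> \<le> 1 * norm (q - p)"
    then have "\<bar>Y m q - Y m p - D (q - p) m p\<bar> \<le> norm (q - p)" by simp
    moreover have "\<bar>D (q - p) m p\<bar> \<le> B * norm (q - p)" using B by blast
    ultimately show "\<bar>Y m q - Y m p\<bar> \<le> (B + 1) * norm (q - p)" by (simp add: algebra_simps)
  qed
  moreover have "\<bar>D v m p\<bar> \<le> (B + 1) * norm v" for m v
  proof -
    have "\<bar>D v m p\<bar> \<le> B * norm v" using B by blast
    then show ?thesis by (simp add: distrib_right add_increasing2)
  qed
  ultimately show ?thesis using that[of "B + 1"] B(1) by simp
qed

lemma uniformly_differentiable_has_derivative:
  assumes "uniformly_differentiable Y D p"
  shows "(Y m has_derivative (\<lambda>v. D v m p)) (at p)"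
  unfolding has_derivative_within_alt2
proof
  obtain B where "\<forall>m v. \<bar>D v m p\<bar> \<le> B * norm v" and lin: "linear (\<lambda>v. D v m p)"
    using assms unfolding uniformly_differentiable_def by blast
  then show "bounded_linear (\<lambda>v. D v m p)"
    by (intro bounded_linear.intro bounded_linear_axioms.intro) (auto simp: mult.commute)
  show "\<forall>e>0. \<forall>\<^sub>F q in at p. norm (Y m q - Y m p - D (q - p) m p) \<le> e * norm (q - p)"
  proof (intro allI impI)
    fix e :: real assume "e > 0"
    then have "\<forall>\<^sub>F q in nhds p. \<forall>m. \<bar>Y m q - Y m p - D (q - p) m p\<bar> \<le> e * norm (q - p)"
      using assms unfolding uniformly_differentiable_def by blast
    then show "\<forall>\<^sub>F q in at p. norm (Y m q - Y m p - D (q - p) m p) \<le> e * norm (q - p)"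
      unfolding eventually_at_filter by (rule eventually_mono) simp
  qed
qed

text \<open>Uniformity in \<open>m\<close> costs nothing when only finitely many different functions
  occur.\<close>

lemma uniformly_differentiable_finite_range:
  assumes fin: "finite (range Y)" and sm: "\<And>m. (Y m) differentiable (at p)"
  shows "uniformly_differentiable Y (\<lambda>v m q. frechet_derivative (Y m) (at q) v) p"
proof -
  have der: "(\<phi> has_derivative frechet_derivative \<phi> (at p)) (at p)" if "\<phi> \<in> range Y" for \<phi>
    using sm that by (auto simp: frechet_derivative_works)
  have bl: "bounded_linear (frechet_derivative \<phi> (at p))" if "\<phi> \<in> range Y" for \<phi>
    using has_derivative_bounded_linear[OF der[OF that]] .
  have "\<forall>\<phi>\<in>range Y. \<exists>B\<ge>0. \<forall>v. \<bar>frechet_derivative \<phi> (at p) v\<bar> \<le> norm v * B"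
  proof
    fix \<phi> assume "\<phi> \<in> range Y"
    then show "\<exists>B\<ge>0. \<forall>v. \<bar>frechet_derivative \<phi> (at p) v\<bar> \<le> norm v * B"
      using bounded_linear.nonneg_bounded[OF bl, of \<phi>] by auto
  qed
  then obtain B where B: "\<And>\<phi>. \<phi> \<in> range Y \<Longrightarrow> B \<phi> \<ge> 0"
    "\<And>\<phi> v. \<phi> \<in> range Y \<Longrightarrow> \<bar>frechet_derivative \<phi> (at p) v\<bar> \<le> norm v * B \<phi>" by metis
  have le: "B \<phi> \<le> sum B (range Y)" if "\<phi> \<in> range Y" for \<phi>
    by (rule member_le_sum[OF that _ fin]) (use B(1) in auto)
  have "\<bar>frechet_derivative (Y m) (at p) v\<bar> \<le> sum B (range Y) * norm v" for m v
  proof -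
    have "norm v * B (Y m) \<le> norm v * sum B (range Y)" by (rule mult_left_mono[OF le]) auto
    then show ?thesis using B(2)[of "Y m" v] by (simp add: mult.commute)
  qed
  moreover have "0 \<le> sum B (range Y)" using B(1) by (rule sum_nonneg)
  moreover have "\<forall>\<^sub>F q in nhds p. \<forall>m. \<bar>Y m q - Y m p - frechet_derivative (Y m) (at p) (q - p)\<bar> \<le> \<epsilon> * norm (q - p)"
    if e: "\<epsilon> > 0" for \<epsilon>
  proof -
    have "\<forall>\<^sub>F q in nhds p. \<forall>\<phi>\<in>range Y. \<bar>\<phi> q - \<phi> p - frechet_derivative \<phi> (at p) (q - p)\<bar> \<le> \<epsilon> * norm (q - p)"
    proof (rule eventually_ball_finite[OF fin], rule ballI)
      fix \<phi> assume phi: "\<phi> \<in> range Y"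
      have "\<forall>\<^sub>F q in at p. norm (\<phi> q - \<phi> p - frechet_derivative \<phi> (at p) (q - p)) \<le> \<epsilon> * norm (q - p)"
        using der[OF phi] e unfolding has_derivative_within_alt2 by blast
      then show "\<forall>\<^sub>F q in nhds p. \<bar>\<phi> q - \<phi> p - frechet_derivative \<phi> (at p) (q - p)\<bar> \<le> \<epsilon> * norm (q - p)"
        unfolding eventually_at_filter
        by (rule eventually_mono) (use linear_0[OF bounded_linear.linear[OF bl[OF phi]]] in auto)
    qed
    then show ?thesis by (rule eventually_mono) simp
  qed
  moreover have "linear (frechet_derivative (Y m) (at p))" for m
    using bounded_linear.linear[OF bl] by simp
  ultimately show ?thesis unfolding uniformly_differentiable_def by blast
qed

lemma uniformly_differentiable_add:
  assumes "uniformly_differentiable Y D p" "uniformly_differentiable Z E p"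
  shows "uniformly_differentiable (\<lambda>m q. Y m q + Z m q) (\<lambda>v m q. D v m q + E v m q) p"
proof -
  obtain B where B: "B \<ge> 0" "\<forall>m v. \<bar>D v m p\<bar> \<le> B * norm v"
    using assms(1) unfolding uniformly_differentiable_def by blast
  obtain B' where B': "B' \<ge> 0" "\<forall>m v. \<bar>E v m p\<bar> \<le> B' * norm v"
    using assms(2) unfolding uniformly_differentiable_def by blast
  have "\<bar>D v m p + E v m p\<bar> \<le> (B + B') * norm v" for v m
  proof -
    have "\<bar>D v m p\<bar> \<le> B * norm v" "\<bar>E v m p\<bar> \<le> B' * norm v" using B B' by blast+
    then show ?thesis unfolding distrib_right by linarith
  qed
  moreover have "\<forall>\<^sub>F q in nhds p. \<forall>m. \<bar>(Y m q + Z m q) - (Y m p + Z m p) - (D (q - p) m p + E (q - p) m p)\<bar> \<le> \<epsilon> * norm (q - p)"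
    if "\<epsilon> > 0" for \<epsilon>
  proof -
    have "\<epsilon> / 2 > 0" using that by simp
    then have 1: "\<forall>\<^sub>F q in nhds p. \<forall>m. \<bar>Y m q - Y m p - D (q - p) m p\<bar> \<le> \<epsilon> / 2 * norm (q - p)"
      and 2: "\<forall>\<^sub>F q in nhds p. \<forall>m. \<bar>Z m q - Z m p - E (q - p) m p\<bar> \<le> \<epsilon> / 2 * norm (q - p)"
      using assms unfolding uniformly_differentiable_def by blast+
    show ?thesis
    proof (rule eventually_elim2[OF 1 2], intro allI)
      fix q m
      assume "\<forall>m. \<bar>Y m q - Y m p - D (q - p) m p\<bar> \<le> \<epsilon> / 2 * norm (q - p)"
        "\<forall>m. \<bar>Z m q - Z m p - E (q - p) m p\<bar> \<le> \<epsilon> / 2 * norm (q - p)"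
      then have "\<bar>Y m q - Y m p - D (q - p) m p\<bar> \<le> \<epsilon> / 2 * norm (q - p)"
        "\<bar>Z m q - Z m p - E (q - p) m p\<bar> \<le> \<epsilon> / 2 * norm (q - p)" by blast+
      then show "\<bar>(Y m q + Z m q) - (Y m p + Z m p) - (D (q - p) m p + E (q - p) m p)\<bar> \<le> \<epsilon> * norm (q - p)"
        by linarith
    qed
  qed
  moreover have "linear (\<lambda>v. D v m p + E v m p)" for m
    using assms unfolding uniformly_differentiable_def by (intro linear_compose_add) blast+
  moreover have "0 \<le> B + B'" using B(1) B'(1) by simp
  ultimately show ?thesis unfolding uniformly_differentiable_def by blast
qed

lemma uniformly_differentiable_mult:
  assumes Y: "uniformly_differentiable Y D p" "\<And>m. \<bar>Y m p\<bar> \<le> b"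
    and Z: "uniformly_differentiable Z E p" "\<And>m. \<bar>Z m p\<bar> \<le> b'"
  shows "uniformly_differentiable (\<lambda>m q. Y m q * Z m q) (\<lambda>v m q. Y m q * E v m q + D v m q * Z m q) p"
proof -
  obtain B where B: "B \<ge> 0" "\<forall>m v. \<bar>D v m p\<bar> \<le> B * norm v"
    "\<forall>\<^sub>F q in nhds p. \<forall>m. \<bar>Y m q - Y m p\<bar> \<le> B * norm (q - p)"
    by (rule uniformly_differentiable_lipschitz[OF Y(1)]) blast
  obtain B' where B': "B' \<ge> 0" "\<forall>m v. \<bar>E v m p\<bar> \<le> B' * norm v"
    "\<forall>\<^sub>F q in nhds p. \<forall>m. \<bar>Z m q - Z m p\<bar> \<le> B' * norm (q - p)"
    by (rule uniformly_differentiable_lipschitz[OF Z(1)]) blast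
  have b: "0 \<le> b" "0 \<le> b'" using Y(2)[of 0] Z(2)[of 0] by linarith+
  have "\<bar>Y m p * E v m p + D v m p * Z m p\<bar> \<le> (b * B' + B * b') * norm v" for v m
  proof -
    have "\<bar>Y m p * E v m p\<bar> \<le> b * (B' * norm v)"
      unfolding abs_mult using Y(2) B' b by (intro mult_mono) auto
    moreover have "\<bar>D v m p * Z m p\<bar> \<le> (B * norm v) * b'"
      unfolding abs_mult using Z(2) B b by (intro mult_mono) auto
    ultimately show ?thesis by (simp add: algebra_simps)
  qed
  moreover have "\<forall>\<^sub>F q in nhds p. \<forall>m. \<bar>Y m q * Z m q - Y m p * Z m p - (Y m p * E (q - p) m p + D (q - p) m p * Z m p)\<bar> \<le> \<epsilon> * norm (q - p)"
    if e: "\<epsilon> > 0" for \<epsilon>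
  proof -
    \<comment> \<open>Half of \<open>\<epsilon>\<close> covers the two first-order remainders,
      weighted by \<open>b\<close> and \<open>b'\<close>; the other half covers the product of the
      increments, which is quadratic in the distance.\<close>
    define \<eta> where "\<eta> = \<epsilon> / (2 * (b + b' + 1))"
    define \<rho> where "\<rho> = \<epsilon> / (2 * (B * B' + 1))"
    have half: "x * (\<epsilon> / (2 * x)) = \<epsilon> / 2" if "x > 0" for x using that by (simp add: field_simps)
    have BB: "0 < B * B' + 1" using B(1) B'(1) by (simp add: add_nonneg_pos)
    have eta: "\<eta> > 0" "\<rho> > 0" using e b BB by (auto simp: \<eta>_def \<rho>_def)
    have 1: "\<forall>\<^sub>F q in nhds p. \<forall>m. \<bar>Y m q - Y m p - D (q - p) m p\<bar> \<le> \<eta> * norm (q - p)"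
      and 2: "\<forall>\<^sub>F q in nhds p. \<forall>m. \<bar>Z m q - Z m p - E (q - p) m p\<bar> \<le> \<eta> * norm (q - p)"
      using Y(1) Z(1) eta(1) unfolding uniformly_differentiable_def by blast+
    have 3: "\<forall>\<^sub>F q in nhds p. norm (q - p) < \<rho>"
      using eta(2) unfolding eventually_nhds_metric dist_norm by blast
    have "\<forall>\<^sub>F q in nhds p. (\<forall>m. \<bar>Y m q - Y m p - D (q - p) m p\<bar> \<le> \<eta> * norm (q - p)) \<and>
       (\<forall>m. \<bar>Z m q - Z m p - E (q - p) m p\<bar> \<le> \<eta> * norm (q - p)) \<and> norm (q - p) < \<rho> \<and>
       (\<forall>m. \<bar>Y m q - Y m p\<bar> \<le> B * norm (q - p)) \<and> (\<forall>m. \<bar>Z m q - Z m p\<bar> \<le> B' * norm (q - p))"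
      using 1 2 3 B(3) B'(3) by (intro eventually_conj)
    then show ?thesis
    proof (rule eventually_mono, intro allI)
      fix q m
      let ?N = "norm (q - p)"
      let ?y = "Y m q - Y m p - D (q - p) m p" and ?z = "Z m q - Z m p - E (q - p) m p"
      let ?dy = "Y m q - Y m p" and ?dz = "Z m q - Z m p"
      assume H: "(\<forall>m. \<bar>Y m q - Y m p - D (q - p) m p\<bar> \<le> \<eta> * ?N) \<and>
       (\<forall>m. \<bar>Z m q - Z m p - E (q - p) m p\<bar> \<le> \<eta> * ?N) \<and> ?N < \<rho> \<and>
       (\<forall>m. \<bar>Y m q - Y m p\<bar> \<le> B * ?N) \<and> (\<forall>m. \<bar>Z m q - Z m p\<bar> \<le> B' * ?N)"
      have 1: "\<bar>Y m p * ?z\<bar> \<le> b * (\<eta> * ?N)"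
        unfolding abs_mult using H Y(2) b by (intro mult_mono) auto
      have 2: "\<bar>Z m p * ?y\<bar> \<le> b' * (\<eta> * ?N)"
        unfolding abs_mult using H Z(2) b by (intro mult_mono) auto
      have "\<bar>?dy * ?dz\<bar> \<le> (B * ?N) * (B' * ?N)"
        unfolding abs_mult using H B(1) by (intro mult_mono) auto
      also have "\<dots> \<le> (B * B' + 1) * \<rho> * ?N"
      proof -
        have "(B * B') * ?N \<le> (B * B' + 1) * \<rho>" using H B(1) B'(1) by (intro mult_mono) auto
        then have "(B * B') * ?N * ?N \<le> (B * B' + 1) * \<rho> * ?N" by (rule mult_right_mono) simp
        then show ?thesis by (simp add: mult_ac)
      qed
      also have "\<dots> = \<epsilon> / 2 * ?N" unfolding \<rho>_def half[OF BB] ..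
      finally have 3: "\<bar>?dy * ?dz\<bar> \<le> \<epsilon> / 2 * ?N" .
      have "(b + b') * \<eta> \<le> (b + b' + 1) * \<eta>" using eta by (intro mult_right_mono) auto
      also have "\<dots> = \<epsilon> / 2" unfolding \<eta>_def using b by (intro half) simp
      finally have "(b + b') * \<eta> * ?N \<le> \<epsilon> / 2 * ?N" by (rule mult_right_mono) simp
      then have 4: "b * (\<eta> * ?N) + b' * (\<eta> * ?N) \<le> \<epsilon> / 2 * ?N" by (simp add: algebra_simps)
      have "Y m q * Z m q - Y m p * Z m p - (Y m p * E (q - p) m p + D (q - p) m p * Z m p)
          = Y m p * ?z + Z m p * ?y + ?dy * ?dz" by (simp add: algebra_simps)
      then show "\<bar>Y m q * Z m q - Y m p * Z m p - (Y m p * E (q - p) m p + D (q - p) m p * Z m p)\<bar> \<le> \<epsilon> * ?N"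
        using 1 2 3 4 by linarith
    qed
  qed
  moreover have "linear (\<lambda>v. Y m p * E v m p + D v m p * Z m p)" for m
  proof (rule linear_compose_add)
    show "linear (\<lambda>v. Y m p * E v m p)"
      using Z(1) linear_compose_scale_right[of "\<lambda>v. E v m p" "Y m p"] unfolding uniformly_differentiable_def by simp
    show "linear (\<lambda>v. D v m p * Z m p)"
      using Y(1) linear_compose_scale_right[of "\<lambda>v. D v m p" "Z m p"]
      unfolding uniformly_differentiable_def by (simp add: mult.commute)
  qed
  moreover have "0 \<le> b * B' + B * b'" using B(1) B'(1) b by simp
  ultimately show ?thesis unfolding uniformly_differentiable_def by blast
qed

lemma prod_series_add:
  assumes "decaying t C r" "\<And>m. \<bar>E m\<bar> \<le> B" "\<And>m. \<bar>F m\<bar> \<le> B'"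
  shows "prod_series t (\<lambda>m. E m + F m) m = prod_series t E m + prod_series t F m"
  unfolding prod_series_def distrib_right
  by (rule suminf_add[symmetric, OF prod_series_summable(1)[OF assms(1,2)] prod_series_summable(1)[OF assms(1,3)]])

lemma prod_series_scale:
  assumes "decaying t C r" "\<And>m. \<bar>E m\<bar> \<le> B"
  shows "prod_series t (\<lambda>m. k * E m) m = k * prod_series t E m"
  unfolding prod_series_def mult.assoc
  by (rule suminf_mult[OF prod_series_summable(1)[OF assms]])

text \<open>
  \<open>X = prod_series t Y\<close> solves \<open>X m = Y m + t m * X (m + 1)\<close>; differentiating the equation shows
  that its derivative solves an equation of the same form. Working uniformly in \<open>m\<close> is the same
  as working in the Banach space of bounded sequences.
\<close>

lemma uniformly_differentiable_prod_series:
  assumes Y: "uniformly_differentiable Y D p" "\<And>m. \<bar>Y m p\<bar> \<le> b"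
    and Yq: "\<forall>\<^sub>F q in nhds p. \<exists>b. \<forall>m. \<bar>Y m q\<bar> \<le> b"
    and t: "uniformly_differentiable t E p"
    and dec: "\<forall>\<^sub>F q in nhds p. decaying (\<lambda>m. t m q) C r"
  defines "X \<equiv> \<lambda>m q. prod_series (\<lambda>m. t m q) (\<lambda>m. Y m q) m"
  shows "uniformly_differentiable X
     (\<lambda>v m q. prod_series (\<lambda>m. t m q) (\<lambda>m. D v m q + E v m q * X (Suc m) q) m) p"
proof -
  define K where "K = C / (1 - r)"
  have dec_p: "decaying (\<lambda>m. t m p) C r" using dec by (rule eventually_nhds_x_imp_x)
  have K: "K \<ge> 0" unfolding K_def using decaying_const_nonneg[OF dec_p] .
  obtain B where B: "B \<ge> 0" "\<forall>m v. \<bar>D v m p\<bar> \<le> B * norm v"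
    "\<forall>\<^sub>F q in nhds p. \<forall>m. \<bar>Y m q - Y m p\<bar> \<le> B * norm (q - p)"
    by (rule uniformly_differentiable_lipschitz[OF Y(1)]) blast
  obtain B' where B': "B' \<ge> 0" "\<forall>m v. \<bar>E v m p\<bar> \<le> B' * norm v"
    "\<forall>\<^sub>F q in nhds p. \<forall>m. \<bar>t m q - t m p\<bar> \<le> B' * norm (q - p)"
    by (rule uniformly_differentiable_lipschitz[OF t]) blast
  have b: "0 \<le> b" using Y(2)[of 0] by linarith
  have Xb: "\<bar>X m p\<bar> \<le> K * b" for m
    unfolding X_def K_def by (rule prod_series_summable(2)[OF dec_p Y(2)])
  define F where "F v m = D v m p + E v m p * X (Suc m) p" for v m
  define G where "G = B + B' * (K * b)"
  have G: "G \<ge> 0" using B(1) B'(1) K b by (simp add: G_def)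
  have Fb: "\<bar>F v m\<bar> \<le> G * norm v" for v m
  proof -
    have "\<bar>E v m p * X (Suc m) p\<bar> \<le> (B' * norm v) * (K * b)"
      unfolding abs_mult using B' Xb by (intro mult_mono) auto
    moreover have "\<bar>D v m p\<bar> \<le> B * norm v" using B by blast
    ultimately show ?thesis unfolding F_def G_def by (simp add: algebra_simps)
  qed
  define L where "L v m = prod_series (\<lambda>m. t m p) (F v) m" for v m
  have Lb: "\<bar>L v m\<bar> \<le> K * (G * norm v)" for v m
    unfolding L_def K_def by (rule prod_series_summable(2)[OF dec_p Fb])
  have linD: "linear (\<lambda>v. D v m p)" "linear (\<lambda>v. E v m p)" for m
    using Y(1) t unfolding uniformly_differentiable_def by blast+
  have "linear (\<lambda>v. L v m)" for m
  proof (rule linearI)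
    fix u v
    have "F (u + v) = (\<lambda>m. F u m + F v m)"
      unfolding F_def using linear_add[OF linD(1)] linear_add[OF linD(2)] by (auto simp: algebra_simps)
    then show "L (u + v) m = L u m + L v m"
      unfolding L_def using prod_series_add[OF dec_p Fb Fb] by simp
  next
    fix k v
    have "F (k *\<^sub>R v) = (\<lambda>m. k * F v m)"
      unfolding F_def using linear_scale[OF linD(1)] linear_scale[OF linD(2)] by (auto simp: algebra_simps)
    then show "L (k *\<^sub>R v) m = k *\<^sub>R L v m"
      unfolding L_def using prod_series_scale[OF dec_p Fb] by simp
  qed
  moreover have "\<bar>L v m\<bar> \<le> (K * G) * norm v" for v m using Lb[of v m] by (simp add: mult.assoc)
  moreover have "\<forall>\<^sub>F q in nhds p. \<forall>m. \<bar>X m q - X m p - L (q - p) m\<bar> \<le> \<epsilon> * norm (q - p)" if e: "\<epsilon> > 0" for \<epsilon>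
  proof -
    \<comment> \<open>The remainder \<open>W\<close> of the solution obeys the same recursion with
      source \<open>err\<close>, of size \<open>\<eta> * (2 + K * b)\<close> times the distance, and
      solving the recursion costs the factor \<open>K\<close>. Writing \<open>K + 1\<close> for it
      keeps the denominator positive.\<close>
    define \<eta> where "\<eta> = \<epsilon> / ((K + 1) * (2 + K * b))"
    have den: "(K + 1) * (2 + K * b) > 0" using K b by (intro mult_pos_pos) (auto intro: add_pos_nonneg)
    define \<rho> where "\<rho> = \<eta> / (B' * (K * G) + 1)"
    have den2: "B' * (K * G) + 1 > 0" using B'(1) K G by (intro add_nonneg_pos) auto
    have eta: "\<eta> > 0" "\<rho> > 0" unfolding \<eta>_def \<rho>_def using e den den2 by (auto simp: \<eta>_def)
    have 1: "\<forall>\<^sub>F q in nhds p. \<forall>m. \<bar>Y m q - Y m p - D (q - p) m p\<bar> \<le> \<eta> * norm (q - p)"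
      and 2: "\<forall>\<^sub>F q in nhds p. \<forall>m. \<bar>t m q - t m p - E (q - p) m p\<bar> \<le> \<eta> * norm (q - p)"
      using Y(1) t eta(1) unfolding uniformly_differentiable_def by blast+
    have 3: "\<forall>\<^sub>F q in nhds p. norm (q - p) < \<rho>"
      using eta(2) unfolding eventually_nhds_metric dist_norm by blast
    have "\<forall>\<^sub>F q in nhds p. (\<forall>m. \<bar>Y m q - Y m p - D (q - p) m p\<bar> \<le> \<eta> * norm (q - p)) \<and>
       (\<forall>m. \<bar>t m q - t m p - E (q - p) m p\<bar> \<le> \<eta> * norm (q - p)) \<and> norm (q - p) < \<rho> \<and>
       (\<forall>m. \<bar>t m q - t m p\<bar> \<le> B' * norm (q - p)) \<and> (\<exists>b. \<forall>m. \<bar>Y m q\<bar> \<le> b) \<and> decaying (\<lambda>m. t m q) C r"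
      using 1 2 3 B'(3) Yq dec by (intro eventually_conj)
    then show ?thesis
    proof (rule eventually_mono, intro allI)
      fix q m
      let ?N = "norm (q - p)"
      assume H: "(\<forall>m. \<bar>Y m q - Y m p - D (q - p) m p\<bar> \<le> \<eta> * ?N) \<and>
       (\<forall>m. \<bar>t m q - t m p - E (q - p) m p\<bar> \<le> \<eta> * ?N) \<and> ?N < \<rho> \<and>
       (\<forall>m. \<bar>t m q - t m p\<bar> \<le> B' * ?N) \<and> (\<exists>b. \<forall>m. \<bar>Y m q\<bar> \<le> b) \<and> decaying (\<lambda>m. t m q) C r"
      then obtain bq where bq: "\<And>m. \<bar>Y m q\<bar> \<le> bq" and dec_q: "decaying (\<lambda>m. t m q) C r" by blast
      define W where "W m = X m q - X m p - L (q - p) m" for m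
      define err where "err m = (Y m q - Y m p - D (q - p) m p) + (t m q - t m p - E (q - p) m p) * X (Suc m) p
          + (t m q - t m p) * L (q - p) (Suc m)" for m
      have Xq: "\<bar>X m q\<bar> \<le> K * bq" for m
        unfolding X_def K_def by (rule prod_series_summable(2)[OF dec_q bq])
      have W_rec: "W m = err m + t m q * W (Suc m)" for m
      proof -
        have "X m q = Y m q + t m q * X (Suc m) q"
          unfolding X_def by (rule prod_series_rec[OF dec_q bq])
        moreover have "X m p = Y m p + t m p * X (Suc m) p"
          unfolding X_def by (rule prod_series_rec[OF dec_p Y(2)])
        moreover have "L (q - p) m = F (q - p) m + t m p * L (q - p) (Suc m)"
          unfolding L_def by (rule prod_series_rec[OF dec_p Fb])
        ultimately show ?thesis unfolding W_def err_def F_def by (simp add: algebra_simps)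
      qed
      have err_b: "\<bar>err m\<bar> \<le> \<eta> * (2 + K * b) * ?N" for m
      proof -
        have 1: "\<bar>Y m q - Y m p - D (q - p) m p\<bar> \<le> \<eta> * ?N" using H by blast
        have 2: "\<bar>(t m q - t m p - E (q - p) m p) * X (Suc m) p\<bar> \<le> (\<eta> * ?N) * (K * b)"
          unfolding abs_mult using H Xb eta by (intro mult_mono) auto
        have "\<bar>(t m q - t m p) * L (q - p) (Suc m)\<bar> \<le> (B' * ?N) * (K * (G * ?N))"
          unfolding abs_mult using H Lb B'(1) by (intro mult_mono) auto
        also have "\<dots> \<le> \<eta> * ?N"
        proof -
          have "(B' * (K * G)) * ?N \<le> (B' * (K * G) + 1) * \<rho>"
            using H B'(1) K G by (intro mult_mono) auto
          also have "\<dots> = \<eta>" using den2 by (simp add: \<rho>_def)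
          finally have "(B' * (K * G)) * ?N * ?N \<le> \<eta> * ?N" by (rule mult_right_mono) simp
          then show ?thesis by (simp add: mult_ac)
        qed
        finally have 3: "\<bar>(t m q - t m p) * L (q - p) (Suc m)\<bar> \<le> \<eta> * ?N" .
        have "\<bar>err m\<bar> \<le> \<eta> * ?N + (\<eta> * ?N) * (K * b) + \<eta> * ?N"
          using 1 2 3 unfolding err_def by linarith
        then show ?thesis by (simp add: algebra_simps)
      qed
      have "\<bar>W m\<bar> \<le> K * bq + K * b + K * (G * ?N)" for m
        using Xq[of m] Xb[of m] Lb[of "q - p" m] unfolding W_def by linarith
      then have "W m = prod_series (\<lambda>m. t m q) err m"
        by (intro prod_series_unique[OF dec_q err_b W_rec])
      then have "\<bar>W m\<bar> \<le> K * (\<eta> * (2 + K * b) * ?N)"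
        unfolding K_def using prod_series_summable(2)[OF dec_q err_b[unfolded K_def]] by simp
      also have "\<dots> = K * (\<eta> * (2 + K * b)) * ?N" by (simp add: mult_ac)
      also have "\<dots> \<le> \<epsilon> * ?N"
      proof (rule mult_right_mono)
        have "0 \<le> \<eta> * (2 + K * b)" using eta K b by simp
        then have "K * (\<eta> * (2 + K * b)) \<le> (K + 1) * (\<eta> * (2 + K * b))" by (intro mult_right_mono) auto
        also have "\<dots> = \<eta> * ((K + 1) * (2 + K * b))" by (simp add: mult_ac)
        also have "\<dots> = \<epsilon>" using den by (metis \<eta>_def less_irrefl nonzero_eq_divide_eq)
        finally show "K * (\<eta> * (2 + K * b)) \<le> \<epsilon>" .
      qed simp
      finally show "\<bar>X m q - X m p - L (q - p) m\<bar> \<le> \<epsilon> * ?N" unfolding W_def .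
    qed
  qed
  moreover have "0 \<le> K * G" using K G by simp
  ultimately show ?thesis
    unfolding uniformly_differentiable_def L_def F_def by blast
qed

section \<open>A class of function sequences closed under differentiation\<close>

locale smooth_product_series =
  fixes \<Omega> :: "'a::euclidean_space set" and t :: "nat \<Rightarrow> 'a \<Rightarrow> real"
  assumes open_\<Omega>: "open \<Omega>"
    and t_finite: "finite (range t)"
    and t_smooth: "\<And>m k. Ck_on k \<Omega> (t m)"
    and t_decay: "\<And>p. p \<in> \<Omega> \<Longrightarrow> \<exists>C r. \<forall>\<^sub>F q in nhds p. decaying (\<lambda>m. t m q) C r"
begin

text \<open>Differentiating the recursion of a series gives another series, whose terms contain
  products of a derivative of \<open>t\<close> with the shifted original series. The rules are the
  operations that this formula requires, starting from sequences with finitely many members.\<close>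

inductive smooth_family :: "(nat \<Rightarrow> 'a \<Rightarrow> real) \<Rightarrow> bool" where
  base: "finite (range Y) \<Longrightarrow> (\<And>m k. Ck_on k \<Omega> (Y m)) \<Longrightarrow> smooth_family Y"
| add: "smooth_family Y \<Longrightarrow> smooth_family Z \<Longrightarrow> smooth_family (\<lambda>m q. Y m q + Z m q)"
| mult: "smooth_family Y \<Longrightarrow> smooth_family Z \<Longrightarrow> smooth_family (\<lambda>m q. Y m q * Z m q)"
| shift: "smooth_family Y \<Longrightarrow> smooth_family (\<lambda>m. Y (Suc m))"
| series: "smooth_family Y \<Longrightarrow> smooth_family (\<lambda>m q. prod_series (\<lambda>m. t m q) (\<lambda>m. Y m q) m)"

lemma base_deriv:
  assumes "finite (range Y)" "\<And>m k. Ck_on k \<Omega> (Y m)"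
  shows "smooth_family (\<lambda>m q. frechet_derivative (Y m) (at q) v)"
    and "p \<in> \<Omega> \<Longrightarrow> uniformly_differentiable Y (\<lambda>v m q. frechet_derivative (Y m) (at q) v) p"
proof -
  have "range (\<lambda>m q. frechet_derivative (Y m) (at q) v) = (\<lambda>\<phi> q. frechet_derivative \<phi> (at q) v) ` range Y"
    by auto
  then show "smooth_family (\<lambda>m q. frechet_derivative (Y m) (at q) v)"
    using assms(1) by (intro base Ck_on_deriv assms(2)) simp
  have "(Y m) differentiable (at p)" if "p \<in> \<Omega>" for m
    using assms(2)[of "Suc 0" m] that by simp
  then show "p \<in> \<Omega> \<Longrightarrow> uniformly_differentiable Y (\<lambda>v m q. frechet_derivative (Y m) (at q) v) p"
    by (intro uniformly_differentiable_finite_range assms(1))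
qed

lemma eventually_in_\<Omega>: "p \<in> \<Omega> \<Longrightarrow> \<forall>\<^sub>F q in nhds p. q \<in> \<Omega>"
  using eventually_nhds_in_open[OF open_\<Omega>] .

text \<open>Pointwise boundedness in \<open>m\<close> belongs to the induction because the rules for
  products and series need it.\<close>

lemma smooth_family_deriv:
  assumes "smooth_family Y"
  shows "(\<forall>p\<in>\<Omega>. \<exists>b. \<forall>m. \<bar>Y m p\<bar> \<le> b) \<and>
    (\<exists>D. (\<forall>v. smooth_family (D v)) \<and> (\<forall>p\<in>\<Omega>. uniformly_differentiable Y D p))"
  using assms
proof induction
  case (base Y)
  have "\<exists>b. \<forall>m. \<bar>Y m p\<bar> \<le> b" for p
  proof (intro exI allI)
    fix m
    show "\<bar>Y m p\<bar> \<le> (\<Sum>\<phi>\<in>range Y. \<bar>\<phi> p\<bar>)" by (rule member_le_sum) (use base(1) in auto)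
  qed
  moreover have "\<forall>v. smooth_family (\<lambda>m q. frechet_derivative (Y m) (at q) v)"
    "\<forall>p\<in>\<Omega>. uniformly_differentiable Y (\<lambda>v m q. frechet_derivative (Y m) (at q) v) p"
    using base_deriv[OF base] by simp_all
  ultimately show ?case
    by (intro conjI exI[of _ "\<lambda>v m q. frechet_derivative (Y m) (at q) v"]) blast+
next
  case (add Y Z)
  then obtain D E where D: "\<forall>v. smooth_family (D v)" "\<forall>p\<in>\<Omega>. uniformly_differentiable Y D p"
    and E: "\<forall>v. smooth_family (E v)" "\<forall>p\<in>\<Omega>. uniformly_differentiable Z E p" by blast
  have "\<exists>b. \<forall>m. \<bar>Y m p + Z m p\<bar> \<le> b" if p: "p \<in> \<Omega>" for p
  proof -
    obtain b b' where "\<forall>m. \<bar>Y m p\<bar> \<le> b" "\<forall>m. \<bar>Z m p\<bar> \<le> b'" using add.IH p by meson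
    then have "\<bar>Y m p + Z m p\<bar> \<le> b + b'" for m by (meson abs_triangle_ineq add_mono order_trans)
    then show ?thesis by blast
  qed
  moreover have "\<forall>v. smooth_family (\<lambda>m q. D v m q + E v m q)"
    using D(1) E(1) smooth_family.add by blast
  moreover have "\<forall>p\<in>\<Omega>. uniformly_differentiable (\<lambda>m q. Y m q + Z m q) (\<lambda>v m q. D v m q + E v m q) p"
    using D(2) E(2) uniformly_differentiable_add by blast
  ultimately show ?case by (intro conjI exI[of _ "\<lambda>v m q. D v m q + E v m q"]) blast+
next
  case (mult Y Z)
  then obtain D E where D: "\<forall>v. smooth_family (D v)" "\<forall>p\<in>\<Omega>. uniformly_differentiable Y D p"
    and E: "\<forall>v. smooth_family (E v)" "\<forall>p\<in>\<Omega>. uniformly_differentiable Z E p" by blast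
  have *: "(\<exists>b. \<forall>m. \<bar>Y m p * Z m p\<bar> \<le> b) \<and>
      uniformly_differentiable (\<lambda>m q. Y m q * Z m q) (\<lambda>v m q. Y m q * E v m q + D v m q * Z m q) p"
    if p: "p \<in> \<Omega>" for p
  proof -
    obtain b b' where b: "\<And>m. \<bar>Y m p\<bar> \<le> b" "\<And>m. \<bar>Z m p\<bar> \<le> b'" using mult p by meson
    have "0 \<le> b" using b(1)[of 0] by linarith
    then have "\<bar>Y m p * Z m p\<bar> \<le> b * b'" for m
      unfolding abs_mult using b by (intro mult_mono) auto
    then show ?thesis
      using uniformly_differentiable_mult[of Y D p b Z E b'] D(2) E(2) p b by blast
  qed
  moreover have "\<forall>v. smooth_family (\<lambda>m q. Y m q * E v m q + D v m q * Z m q)"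
    using D(1) E(1) mult.hyps by (intro allI smooth_family.add smooth_family.mult) blast+
  ultimately show ?case
    by (intro conjI exI[of _ "\<lambda>v m q. Y m q * E v m q + D v m q * Z m q"]) blast+
next
  case (shift Y)
  then obtain D where D: "\<forall>v. smooth_family (D v)" "\<forall>p\<in>\<Omega>. uniformly_differentiable Y D p" by blast
  have "uniformly_differentiable (\<lambda>m. Y (Suc m)) (\<lambda>v m. D v (Suc m)) p" if "p \<in> \<Omega>" for p
  proof -
    have u: "uniformly_differentiable Y D p" using D(2) that by blast
    then obtain B where "B \<ge> 0" "\<forall>m v. \<bar>D v m p\<bar> \<le> B * norm v"
      unfolding uniformly_differentiable_def by blast
    then have "\<exists>B\<ge>0. \<forall>m v. \<bar>D v (Suc m) p\<bar> \<le> B * norm v" by blast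
    moreover have "\<forall>\<^sub>F q in nhds p. \<forall>m. \<bar>Y (Suc m) q - Y (Suc m) p - D (q - p) (Suc m) p\<bar> \<le> \<epsilon> * norm (q - p)"
      if "\<epsilon> > 0" for \<epsilon>
    proof -
      have "\<forall>\<^sub>F q in nhds p. \<forall>m. \<bar>Y m q - Y m p - D (q - p) m p\<bar> \<le> \<epsilon> * norm (q - p)"
        using u that unfolding uniformly_differentiable_def by blast
      then show ?thesis by (rule eventually_mono) blast
    qed
    moreover have "\<forall>m. linear (\<lambda>v. D v (Suc m) p)" using u unfolding uniformly_differentiable_def by blast
    ultimately show ?thesis unfolding uniformly_differentiable_def by blast
  qed
  moreover have "\<forall>v. smooth_family (\<lambda>m. D v (Suc m))" using D(1) smooth_family.shift by blast
  moreover have "\<forall>p\<in>\<Omega>. \<exists>b. \<forall>m. \<bar>Y (Suc m) p\<bar> \<le> b" using shift by blast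
  ultimately show ?case by (intro conjI exI[of _ "\<lambda>v m. D v (Suc m)"]) blast+
next
  case (series Y)
  define X where "X m q = prod_series (\<lambda>m. t m q) (\<lambda>m. Y m q) m" for m q
  define E where "E v m q = frechet_derivative (t m) (at q) v" for v m q
  obtain D where D: "\<forall>v. smooth_family (D v)" "\<forall>p\<in>\<Omega>. uniformly_differentiable Y D p" using series by blast
  have E: "smooth_family (E v)" "p \<in> \<Omega> \<Longrightarrow> uniformly_differentiable t E p" for v p
    unfolding E_def using base_deriv[OF t_finite t_smooth] by blast+
  define D' where "D' v m q = prod_series (\<lambda>m. t m q) (\<lambda>m. D v m q + E v m q * X (Suc m) q) m" for v m q
  have X: "smooth_family X" unfolding X_def by (rule smooth_family.series[OF series.hyps])
  have "smooth_family (\<lambda>m q. D v m q + E v m q * X (Suc m) q)" for v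
    using D(1) E(1) smooth_family.shift[OF X] by (intro smooth_family.add smooth_family.mult) blast+
  then have "smooth_family (D' v)" for v
    unfolding D'_def by (rule smooth_family.series)
  moreover have "(\<exists>b. \<forall>m. \<bar>X m p\<bar> \<le> b) \<and> uniformly_differentiable X D' p" if p: "p \<in> \<Omega>" for p
  proof -
    obtain b where b: "\<And>m. \<bar>Y m p\<bar> \<le> b" using series p by blast
    obtain C r where dec: "\<forall>\<^sub>F q in nhds p. decaying (\<lambda>m. t m q) C r" using t_decay[OF p] by blast
    have "\<bar>X m p\<bar> \<le> C / (1 - r) * b" for m
      unfolding X_def by (rule prod_series_summable(2)[OF eventually_nhds_x_imp_x[OF dec] b])
    moreover have "\<forall>\<^sub>F q in nhds p. \<exists>b. \<forall>m. \<bar>Y m q\<bar> \<le> b"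
      using eventually_in_\<Omega>[OF p] by (rule eventually_mono) (use series.IH in blast)
    then have "uniformly_differentiable X D' p"
      unfolding X_def[abs_def] D'_def[abs_def]
      using uniformly_differentiable_prod_series[OF bspec[OF D(2) p] b _ E(2)[OF p] dec] by simp
    ultimately show ?thesis by blast
  qed
  ultimately show ?case unfolding X_def[symmetric] by blast
qed

lemma smooth_family_Ck: "smooth_family Y \<Longrightarrow> Ck_on k \<Omega> (Y m)"
proof (rule Ck_on_coinduct[OF open_\<Omega>, where \<A>="{Y m |Y m. smooth_family Y}"])
  fix \<phi> assume "\<phi> \<in> {Y m |Y m. smooth_family Y}"
  then obtain Y m where Y: "smooth_family Y" "\<phi> = Y m" by blast
  obtain D where D: "\<forall>v. smooth_family (D v)" "\<forall>p\<in>\<Omega>. uniformly_differentiable Y D p"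
    using smooth_family_deriv[OF Y(1)] by blast
  then have "\<forall>x\<in>\<Omega>. (\<phi> has_derivative (\<lambda>v. D v m x)) (at x)"
    unfolding Y(2) using uniformly_differentiable_has_derivative by blast
  then show "\<exists>D. (\<forall>x\<in>\<Omega>. (\<phi> has_derivative (\<lambda>v. D v x)) (at x)) \<and> (\<forall>v. D v \<in> {Y m |Y m. smooth_family Y})"
    using D(1) by (intro exI[of _ "\<lambda>v. D v m"]) blast
qed blast

text \<open>The product rule applied to the recursion of the series. Together with boundedness the
  second claim determines the derivative, because such a recursion has only one bounded
  solution.\<close>

lemma series_deriv:
  assumes fin: "finite (range Y)" and sm: "\<And>m k. Ck_on k \<Omega> (Y m)" and p: "p \<in> \<Omega>"
  defines "X \<equiv> \<lambda>m q. prod_series (\<lambda>m. t m q) (\<lambda>m. Y m q) m"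
  shows "\<exists>b. \<forall>m. \<bar>frechet_derivative (X m) (at p) v\<bar> \<le> b"
    and "frechet_derivative (X m) (at p) v = frechet_derivative (Y m) (at p) v
      + frechet_derivative (t m) (at p) v * X (Suc m) p + t m p * frechet_derivative (X (Suc m)) (at p) v"
proof -
  have Y: "smooth_family Y" by (rule base[OF fin sm])
  have X: "smooth_family X" unfolding X_def by (rule series[OF Y])
  obtain D where D: "\<forall>p\<in>\<Omega>. uniformly_differentiable X D p" using smooth_family_deriv[OF X] by blast
  have eq: "frechet_derivative (X m) (at p) v = D v m p" for m v
    using frechet_derivative_at[OF uniformly_differentiable_has_derivative[OF bspec[OF D p], of m]] by metis
  obtain B where "\<forall>m v. \<bar>D v m p\<bar> \<le> B * norm v"
    using bspec[OF D p] unfolding uniformly_differentiable_def by blast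
  then show "\<exists>b. \<forall>m. \<bar>frechet_derivative (X m) (at p) v\<bar> \<le> b" unfolding eq by blast
  have dY: "(Y m has_derivative (\<lambda>v. frechet_derivative (Y m) (at p) v)) (at p)"
    and dt: "(t m has_derivative (\<lambda>v. frechet_derivative (t m) (at p) v)) (at p)"
    and dX: "(X m' has_derivative (\<lambda>v. frechet_derivative (X m') (at p) v)) (at p)" for m m'
    using Ck_on_has_derivative[OF sm p] Ck_on_has_derivative[OF t_smooth p]
      Ck_on_has_derivative[OF smooth_family_Ck[OF X] p] by blast+
  have rec: "X m q = Y m q + t m q * X (Suc m) q" if q: "q \<in> \<Omega>" for q
  proof -
    obtain b where b: "\<And>m. \<bar>Y m q\<bar> \<le> b" using smooth_family_deriv[OF Y] q by blast
    obtain C r where "\<forall>\<^sub>F x in nhds q. decaying (\<lambda>m. t m x) C r" using t_decay[OF q] by blast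
    then have "decaying (\<lambda>m. t m q) C r" by (rule eventually_nhds_x_imp_x)
    then show ?thesis unfolding X_def by (rule prod_series_rec[OF _ b])
  qed
  have "(X m has_derivative (\<lambda>v. frechet_derivative (Y m) (at p) v +
      (t m p * frechet_derivative (X (Suc m)) (at p) v + frechet_derivative (t m) (at p) v * X (Suc m) p))) (at p)"
  proof (rule has_derivative_transform_within_open[OF _ open_\<Omega> p])
    show "((\<lambda>q. Y m q + t m q * X (Suc m) q) has_derivative (\<lambda>v. frechet_derivative (Y m) (at p) v +
      (t m p * frechet_derivative (X (Suc m)) (at p) v + frechet_derivative (t m) (at p) v * X (Suc m) p))) (at p)"
      by (rule has_derivative_add[OF dY has_derivative_mult[OF dt dX]])
  qed (simp add: rec)
  from frechet_derivative_at[OF this]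
  show "frechet_derivative (X m) (at p) v = frechet_derivative (Y m) (at p) v
      + frechet_derivative (t m) (at p) v * X (Suc m) p + t m p * frechet_derivative (X (Suc m)) (at p) v"
    by (metis (no_types, lifting) add.assoc add.commute)
qed

end

section \<open>Transversality\<close>

text \<open>Decay is decided by the products over windows of one fixed length. These are finitely
  many continuous functions; at \<open>p\<close> their moduli are at most 1/2, and so they stay
  below 3/4 nearby.\<close>

lemma decaying_nearby:
  fixes t :: "nat \<Rightarrow> 'a::metric_space \<Rightarrow> real"
  assumes fin: "finite (range t)" and cont: "\<And>m. isCont (t m) p"
    and dec: "decaying (\<lambda>m. t m p) C r"
  shows "\<exists>C r. \<forall>\<^sub>F q in nhds p. decaying (\<lambda>m. t m q) C r"
proof -
  have C: "0 \<le> C" "0 \<le> r" "r < 1" "\<And>m n. \<bar>\<Prod>i<n. t (m + i) p\<bar> \<le> C * r ^ n"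
    using dec by (auto simp: decaying_def)
  obtain k where k: "r ^ k < 1 / (2 * (C + 1))"
    using real_arch_pow_inv[of "1 / (2 * (C + 1))" r] C by auto
  define N where "N = Suc k"
  have "r ^ N \<le> r ^ k" unfolding N_def using C by (intro power_decreasing) auto
  then have "C * r ^ N \<le> (C + 1) * (1 / (2 * (C + 1)))" using C k by (intro mult_mono) auto
  also have "\<dots> = 1 / 2" using C by (simp add: field_simps)
  finally have half: "C * r ^ N \<le> 1 / 2" .
  define W where "W m q = (\<Prod>i<N. t (m + i) q)" for m q
  have "range W \<subseteq> (\<lambda>fs q. prod_list (map (\<lambda>\<phi>. \<phi> q) fs)) ` {fs. set fs \<subseteq> range t \<and> length fs = N}"
  proof
    fix \<phi> assume "\<phi> \<in> range W"
    then obtain m where m: "\<phi> = W m" by blast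
    have "W m = (\<lambda>q. prod_list (map (\<lambda>\<phi>. \<phi> q) (map (\<lambda>i. t (m + i)) [0..<N])))"
      by (simp add: W_def fun_eq_iff o_def prod.distinct_set_conv_list[symmetric] atLeast0LessThan)
    then show "\<phi> \<in> (\<lambda>fs q. prod_list (map (\<lambda>\<phi>. \<phi> q) fs)) ` {fs. set fs \<subseteq> range t \<and> length fs = N}"
      unfolding m by (rule image_eqI) auto
  qed
  moreover have "finite {fs. set fs \<subseteq> range t \<and> length fs = N}" by (rule finite_lists_length_eq[OF fin])
  ultimately have finW: "finite (range W)" by (rule finite_surj[rotated])
  have near: "\<forall>\<^sub>F q in nhds p. \<bar>\<phi> q\<bar> < y" if "isCont \<phi> p" "\<bar>\<phi> p\<bar> < y" for \<phi> :: "'a \<Rightarrow> real" and y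
  proof -
    have "((\<lambda>q. \<bar>\<phi> q\<bar>) \<longlongrightarrow> \<bar>\<phi> p\<bar>) (at p)"
      using that(1) by (intro tendsto_rabs) (simp add: isCont_def)
    then have "\<forall>\<^sub>F q in at p. \<bar>\<phi> q\<bar> < y" using that(2) by (rule order_tendstoD)
    then show ?thesis using that(2) by (simp add: eventually_nhds_conv_at)
  qed
  have "\<forall>\<^sub>F q in nhds p. \<forall>\<phi>\<in>range W. \<bar>\<phi> q\<bar> < 3 / 4"
  proof (rule eventually_ball_finite[OF finW], rule ballI)
    fix \<phi> assume "\<phi> \<in> range W"
    then obtain m where m: "\<phi> = W m" by blast
    have "isCont (W m) p" unfolding W_def[abs_def] by (intro continuous_intros cont)
    moreover have "\<bar>W m p\<bar> < 3 / 4" using C(4)[where m=m and n=N] half unfolding W_def by linarith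
    ultimately show "\<forall>\<^sub>F q in nhds p. \<bar>\<phi> q\<bar> < 3 / 4" unfolding m by (rule near)
  qed
  moreover define T where "T = (\<Sum>\<phi>\<in>range t. \<bar>\<phi> p\<bar>) + 1"
  have "\<forall>\<^sub>F q in nhds p. \<forall>\<phi>\<in>range t. \<bar>\<phi> q\<bar> < T"
  proof (rule eventually_ball_finite[OF fin], rule ballI)
    fix \<phi> assume phi: "\<phi> \<in> range t"
    then have "isCont \<phi> p" using cont by blast
    moreover have "\<bar>\<phi> p\<bar> \<le> (\<Sum>\<phi>\<in>range t. \<bar>\<phi> p\<bar>)" by (rule member_le_sum[OF phi _ fin]) simp
    then have "\<bar>\<phi> p\<bar> < T" by (simp add: T_def)
    ultimately show "\<forall>\<^sub>F q in nhds p. \<bar>\<phi> q\<bar> < T" by (rule near)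
  qed
  ultimately have ev: "\<forall>\<^sub>F q in nhds p. (\<forall>\<phi>\<in>range W. \<bar>\<phi> q\<bar> < 3 / 4) \<and> (\<forall>\<phi>\<in>range t. \<bar>\<phi> q\<bar> < T)"
    by (rule eventually_conj)
  define U where "U = {q. (\<forall>\<phi>\<in>range W. \<bar>\<phi> q\<bar> < 3 / 4) \<and> (\<forall>\<phi>\<in>range t. \<bar>\<phi> q\<bar> < T)}"
  \<comment> \<open>Shifting the index turns products along a sequence into products along orbits,
    the form in which \<open>product_decay\<close> applies.\<close>
  define S where "S = (\<lambda>(m, q). (Suc m, q :: 'a))"
  have S: "(S ^^ j) (m, q) = (m + j, q)" for j m q by (induction j) (auto simp: S_def)
  obtain C' r' where C': "0 \<le> C'" "0 < r'" "r' < 1"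
    "\<And>x n. x \<in> UNIV \<times> U \<Longrightarrow> \<bar>\<Prod>j<n. (\<lambda>(m, q). t m q) ((S ^^ j) x)\<bar> \<le> C' * r' ^ n"
  proof (rule product_decay[of "UNIV \<times> U" S "\<lambda>(m, q). t m q" T N "3 / 4"])
    show "S x \<in> UNIV \<times> U" if "x \<in> UNIV \<times> U" for x using that by (auto simp: S_def)
    show "\<bar>(\<lambda>(m, q). t m q) x\<bar> \<le> T" if "x \<in> UNIV \<times> U" for x
    proof -
      obtain m q where mq: "x = (m, q)" "q \<in> U" using \<open>x \<in> UNIV \<times> U\<close> by auto
      then have "\<bar>t m q\<bar> < T" unfolding U_def by blast
      then show ?thesis by (simp add: mq(1))
    qed
    show "\<bar>\<Prod>j<N. (\<lambda>(m, q). t m q) ((S ^^ j) x)\<bar> \<le> 3 / 4" if "x \<in> UNIV \<times> U" for x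
    proof -
      obtain m q where mq: "x = (m, q)" "q \<in> U" using \<open>x \<in> UNIV \<times> U\<close> by auto
      then have "\<bar>W m q\<bar> < 3 / 4" unfolding U_def by blast
      then show ?thesis by (simp add: mq(1) S W_def)
    qed
    show "1 \<le> N" by (simp add: N_def)
  qed auto
  have "decaying (\<lambda>m. t m q) C' r'" if "q \<in> U" for q
    using C'(1-3) C'(4)[of "(_, q)"] that by (auto simp: decaying_def S)
  then have "\<forall>\<^sub>F q in nhds p. decaying (\<lambda>m. t m q) C' r'"
    using ev by (auto simp: U_def elim: eventually_mono)
  then show ?thesis by blast
qed

section \<open>The velocity field of a deformation\<close>

context expanding_affine
begin

lemma decaying_orbit: "\<exists>C r. \<forall>x\<in>{a..b}. decaying (\<lambda>m. \<tau> ((f ^^ m) x)) C r"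
proof -
  obtain C r where C: "0 \<le> C" "0 < r" "r < 1"
    "\<And>x n. x \<in> {a..b} \<Longrightarrow> \<bar>\<Prod>j<n. \<tau> ((f ^^ j) x)\<bar> \<le> C * r ^ n"
    by (rule tau_decay) blast
  have "decaying (\<lambda>m. \<tau> ((f ^^ m) x)) C r" if x: "x \<in> {a..b}" for x
    unfolding decaying_def
  proof (intro conjI allI)
    fix m n
    have "(f ^^ (m + i)) x = (f ^^ i) ((f ^^ m) x)" for i by (simp add: funpow_add add.commute[of m])
    then show "\<bar>\<Prod>i<n. \<tau> ((f ^^ (m + i)) x)\<bar> \<le> C * r ^ n" using C(4)[OF funpow_in[OF x, of m], of n] by simp
  qed (use C in auto)
  then show ?thesis by blast
qed

lemma sgn_slope: "i \<le> d \<Longrightarrow> sgn (s i) = (-1) ^ i * sgn (s 0)"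
proof (induction i)
  case (Suc i)
  have "s i * s (Suc i) < 0" by (rule affine_branchesD(3)[OF branches]) (use Suc in simp)
  then have "sgn (s (Suc i)) = - sgn (s i)" by (auto simp: mult_less_0_iff sgn_if)
  then show ?case using Suc by simp
qed simp

text \<open>
  The deformation \<open>f + u * \<psi>\<close>, where \<open>\<psi>\<close> is piecewise affine and takes the values \<open>0, 1, 0, 1, \<dots>\<close>
  at the breakpoints, changes the moduli of all slopes in the same direction. The field
  \<open>displacement\<close> is the velocity of the points with a given itinerary under this deformation.
\<close>

definition zigzag :: "nat \<Rightarrow> real" where "zigzag j = (if odd j then 1 else 0)"

definition branch_perturbation :: "nat \<Rightarrow> real \<Rightarrow> real" where
  "branch_perturbation i x = zigzag i + (zigzag (Suc i) - zigzag i) / (c (Suc i) - c i) * (x - c i)"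

definition perturbation :: "real \<Rightarrow> real" where
  "perturbation x = branch_perturbation (branch_idx x) x"

definition displacement :: "real \<Rightarrow> real" where
  "displacement x = prod_series (\<lambda>m. \<tau> ((f ^^ m) x)) (\<lambda>m. - \<tau> ((f ^^ m) x) * perturbation ((f ^^ m) x)) 0"

lemma perturbation_bound: "\<exists>B. \<forall>x\<in>{a..b}. \<bar>- \<tau> x * perturbation x\<bar> \<le> B"
proof -
  have gap: "c i < c (Suc i)" if "i \<le> d" for i using c_less[of i "Suc i"] that by simp
  have "\<bar>perturbation x\<bar> \<le> 2" if x: "x \<in> {a..b}" for x
  proof -
    let ?i = "branch_idx x"
    define q where "q = (x - c ?i) / (c (Suc ?i) - c ?i)"
    have "0 \<le> q" "q \<le> 1"
      using in_branch_idx[OF x] gap[OF branch_idx_le, of x] by (auto simp: q_def)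
    moreover have "perturbation x = zigzag ?i + (zigzag (Suc ?i) - zigzag ?i) * q"
      by (simp add: perturbation_def branch_perturbation_def q_def)
    ultimately show ?thesis by (auto simp: zigzag_def)
  qed
  moreover obtain T where T: "\<And>x. \<bar>\<tau> x\<bar> \<le> T" by (rule tau_bound) blast
  ultimately have "\<bar>- \<tau> x * perturbation x\<bar> \<le> T * 2" if "x \<in> {a..b}" for x
    unfolding abs_mult abs_minus_cancel using that order_trans[OF abs_ge_zero T[of x]] by (intro mult_mono T) auto
  then show ?thesis by blast
qed

lemma displacement_rec:
  assumes "x \<in> {a..b}"
  shows "displacement x = - \<tau> x * perturbation x + \<tau> x * displacement (f x)"
proof -
  obtain C r where C: "\<forall>x\<in>{a..b}. decaying (\<lambda>m. \<tau> ((f ^^ m) x)) C r" using decaying_orbit by blast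
  obtain B where B: "\<forall>x\<in>{a..b}. \<bar>- \<tau> x * perturbation x\<bar> \<le> B" using perturbation_bound by blast
  have "displacement x = - \<tau> x * perturbation x + \<tau> x *
      prod_series (\<lambda>m. \<tau> ((f ^^ m) x)) (\<lambda>m. - \<tau> ((f ^^ m) x) * perturbation ((f ^^ m) x)) (Suc 0)"
    unfolding displacement_def
    using prod_series_rec[of "\<lambda>m. \<tau> ((f ^^ m) x)" C r "\<lambda>m. - \<tau> ((f ^^ m) x) * perturbation ((f ^^ m) x)" B 0,
        OF bspec[OF C assms]] B funpow_in[OF assms] by simp
  also have "prod_series (\<lambda>m. \<tau> ((f ^^ m) x)) (\<lambda>m. - \<tau> ((f ^^ m) x) * perturbation ((f ^^ m) x)) (Suc 0) = displacement (f x)"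
    unfolding displacement_def prod_series_def by (simp add: funpow_swap1)
  finally show ?thesis .
qed

lemma displacement_bound: "\<exists>A. \<forall>x\<in>{a..b}. \<bar>displacement x\<bar> \<le> A"
proof -
  obtain C r where C: "\<forall>x\<in>{a..b}. decaying (\<lambda>m. \<tau> ((f ^^ m) x)) C r" using decaying_orbit by blast
  obtain B where B: "\<forall>x\<in>{a..b}. \<bar>- \<tau> x * perturbation x\<bar> \<le> B" using perturbation_bound by blast
  have "\<bar>displacement x\<bar> \<le> C / (1 - r) * B" if x: "x \<in> {a..b}" for x
    unfolding displacement_def
    by (rule prod_series_summable(2)[OF bspec[OF C x]]) (use B funpow_in[OF x] in blast)
  then show ?thesis by blast
qed

lemma displacement_transversal: "\<exists>k\<in>{1..d}. displacement (f (c k)) \<noteq> zigzag k"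
proof (rule ccontr)
  assume "\<not> ?thesis"
  then have all: "\<And>k. k \<in> {1..d} \<Longrightarrow> displacement (f (c k)) = zigzag k" by blast
  have gap: "c i < c (Suc i)" if "i \<le> d" for i using c_less[of i "Suc i"] that by simp
  \<comment> \<open>The linearized conjugacy equation on closed branches. Off the critical points it
    is the recursion of \<open>displacement\<close>. At a critical point \<open>\<tau>\<close> makes
    \<open>displacement\<close> vanish, and what remains of the equation is precisely the assumption
    \<open>all\<close>.\<close>
  have eq: "displacement (f x) = branch_perturbation i x + s i * displacement x"
    if i: "i \<le> d" and x: "x \<in> {c i..c (Suc i)}" for i x
  proof -
    have x_ab: "x \<in> {a..b}" using branch_subset[OF i] x by blast
    show ?thesis
    proof (cases "crit x")
      case True
      then have "displacement x = 0" using displacement_rec[OF x_ab] by (simp add: \<tau>_def)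
      moreover obtain l where l: "l \<in> {1..d}" "x = c l" using True unfolding crit_def by blast
      moreover have "l = i \<or> l = Suc i"
      proof (rule ccontr)
        assume "\<not> ?thesis"
        then have "l < i \<or> Suc i < l" by linarith
        then have "c l < c i \<or> c (Suc i) < c l" using c_less[of l i] c_less[of "Suc i" l] l(1) i by fastforce
        then show False using l(2) x by simp
      qed
      then have "branch_perturbation i x = zigzag l"
        unfolding branch_perturbation_def l(2) using gap[OF i] by auto
      ultimately show ?thesis using all by simp
    next
      case False
      have "c i < x \<or> i = 0"
      proof (rule ccontr)
        assume "\<not> ?thesis"
        then have "x = c i" "i \<in> {1..d}" using x i by auto
        then show False using False unfolding crit_def by blast
      qed
      then have idx: "branch_idx x = i" using branch_idx_eq[OF i _ _ x_ab] x by simp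
      have "displacement x = - (1 / s i) * branch_perturbation i x + (1 / s i) * displacement (f x)"
        using displacement_rec[OF x_ab] False by (simp add: \<tau>_def perturbation_def idx)
      then show ?thesis using slope_nonzero[OF i] by (simp add: field_simps)
    qed
  qed
  \<comment> \<open>The perturbation has slope \<open>(-1) ^ i / (c (Suc i) - c i)\<close> on branch
    \<open>i\<close>; divided by \<open>s i\<close> and multiplied by the sign of
    \<open>s 0\<close>, it becomes this positive gain of the difference quotient.\<close>
  define \<kappa> where "\<kappa> i = 1 / ((c (Suc i) - c i) * \<bar>s i\<bar>)" for i
  define \<epsilon> where "\<epsilon> = Min (\<kappa> ` {..d})"
  have "\<kappa> i > 0" if "i \<le> d" for i using gap[OF that] slope_nonzero[OF that] by (simp add: \<kappa>_def)
  then have \<epsilon>: "\<epsilon> > 0" unfolding \<epsilon>_def by (subst Min_gr_iff) auto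
  \<comment> \<open>The sign turns the deformation around if necessary, so that the gain is positive
    on all branches at once.\<close>
  define \<alpha> where "\<alpha> x = sgn (s 0) * displacement x" for x
  obtain A where A: "\<forall>x\<in>{a..b}. \<bar>displacement x\<bar> \<le> A" using displacement_bound by blast
  have s0: "\<bar>sgn (s 0)\<bar> = 1" using slope_nonzero[of 0] by (simp add: sgn_if)
  show False
  proof (rule no_growing_quotients[of \<alpha> A \<epsilon>])
    show "\<bar>\<alpha> x\<bar> \<le> A" if "x \<in> {a..b}" for x
      using A that s0 by (simp add: \<alpha>_def abs_mult)
    show "(\<alpha> y - \<alpha> x) / (y - x) + \<epsilon> \<le> (\<alpha> (f y) - \<alpha> (f x)) / (f y - f x)"
      if i: "i \<le> d" and x: "x \<in> {c i..c (Suc i)}" and y: "y \<in> {c i..c (Suc i)}" and ne: "x \<noteq> y" for i x y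
    proof -
      have s: "s i \<noteq> 0" by (rule slope_nonzero[OF i])
      have fd: "f y - f x = s i * (y - x)" by (rule f_affine[OF i x y])
      define \<Delta> where "\<Delta> = (zigzag (Suc i) - zigzag i) / (c (Suc i) - c i)"
      have bp: "branch_perturbation i w = zigzag i + \<Delta> * (w - c i)" for w
        by (simp add: branch_perturbation_def \<Delta>_def)
      have "displacement (f y) - displacement (f x) = \<Delta> * (y - x) + s i * (displacement y - displacement x)"
        unfolding eq[OF i x] eq[OF i y] bp by (simp add: algebra_simps)
      moreover have "\<alpha> (f y) - \<alpha> (f x) = sgn (s 0) * (displacement (f y) - displacement (f x))"
        by (simp add: \<alpha>_def right_diff_distrib)
      ultimately have "\<alpha> (f y) - \<alpha> (f x) = sgn (s 0) * (\<Delta> * (y - x) + s i * (displacement y - displacement x))"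
        by (simp only:)
      then have "\<alpha> (f y) - \<alpha> (f x) = sgn (s 0) * \<Delta> * (y - x) + s i * (\<alpha> y - \<alpha> x)"
        by (simp add: \<alpha>_def algebra_simps)
      then have "(\<alpha> (f y) - \<alpha> (f x)) / (f y - f x) = sgn (s 0) * \<Delta> / s i + (\<alpha> y - \<alpha> x) / (y - x)"
        unfolding fd using s ne by (simp add: add_divide_distrib)
      moreover have "sgn (s 0) * \<Delta> / s i = \<kappa> i"
      proof -
        have z: "zigzag (Suc i) - zigzag i = (-1) ^ i" by (simp add: zigzag_def)
        have "sgn (s 0) * (-1) ^ i = sgn (s i)" using sgn_slope[OF i] by simp
        then have "sgn (s 0) * \<Delta> / s i = sgn (s i) / ((c (Suc i) - c i) * s i)"
          unfolding \<Delta>_def z by (simp add: field_simps)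
        also have "\<dots> = \<kappa> i" using s unfolding \<kappa>_def by (auto simp: sgn_if abs_if)
        finally show ?thesis .
      qed
      moreover have "\<epsilon> \<le> \<kappa> i" unfolding \<epsilon>_def using i by (intro Min_le) auto
      ultimately show ?thesis by linarith
    qed
  qed (rule \<epsilon>)
qed

end

section \<open>Coded points as functions of the parameters\<close>

lemma numbering_inverse:
  fixes e :: "'n::finite \<Rightarrow> nat"
  assumes "bij_betw e UNIV {..<2 * d + 2}" "i < 2 * d + 2"
  shows "e (inv e i) = i"
proof -
  have "i \<in> range e" using assms by (auto simp: bij_betw_def)
  then show ?thesis by (rule f_inv_into_f)
qed

locale parameter_space =
  fixes a b :: real and d :: nat and e :: "'n::finite \<Rightarrow> nat"
  assumes ab: "a < b" and e: "bij_betw e UNIV {..<2 * d + 2}"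
begin

text \<open>The end points are constants rather than coordinates, so critical point number
  \<open>l\<close> sits in coordinate \<open>l - 1\<close>, and the values at the breakpoints occupy
  the coordinates from \<open>d\<close> on.\<close>

definition bp :: "nat \<Rightarrow> real ^ 'n \<Rightarrow> real" where
  "bp l p = (if l = 0 then a else if l = Suc d then b else p $ inv e (l - 1))"

definition val :: "nat \<Rightarrow> real ^ 'n \<Rightarrow> real" where "val j p = p $ inv e (d + j)"

text \<open>An open set on which all inverse branches depend smoothly on the parameters. It also
  contains parameters of no self-map of {a..b}, because derivatives need a full
  neighbourhood.\<close>

definition regular :: "(real ^ 'n) set" where
  "regular = {p. \<forall>i\<le>d. bp i p < bp (Suc i) p \<and> val i p \<noteq> val (Suc i) p}"

definition inv_slope :: "nat \<Rightarrow> real ^ 'n \<Rightarrow> real" where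
  "inv_slope i p = (bp (Suc i) p - bp i p) * inverse (val (Suc i) p - val i p)"

text \<open>
  A letter is the index of a branch with a flag that marks the right end point of the branch. The
  affine map \<open>y \<mapsto> shift_coeff w p + lin_coeff w p * y\<close> is the inverse of the branch, and constant
  if the flag is set; a code thus ends when it hits a critical point.
\<close>

definition lin_coeff :: "nat \<times> bool \<Rightarrow> real ^ 'n \<Rightarrow> real" where
  "lin_coeff w p = (if snd w then 0 else inv_slope (fst w) p)"

definition shift_coeff :: "nat \<times> bool \<Rightarrow> real ^ 'n \<Rightarrow> real" where
  "shift_coeff w p = (if snd w then bp (Suc (fst w)) p else bp (fst w) p - val (fst w) p * inv_slope (fst w) p)"

text \<open>For the itinerary of a point under the map with parameters \<open>p\<close> this is the
  \<open>m\<close>-th point of its orbit. For other parameters the code is kept, whether or not it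
  is an itinerary of the new map.\<close>

definition coded_point :: "(nat \<Rightarrow> nat \<times> bool) \<Rightarrow> nat \<Rightarrow> real ^ 'n \<Rightarrow> real" where
  "coded_point w m p = prod_series (\<lambda>m. lin_coeff (w m) p) (\<lambda>m. shift_coeff (w m) p) m"

definition code_domain :: "(nat \<Rightarrow> nat \<times> bool) \<Rightarrow> (real ^ 'n) set" where
  "code_domain w = {p \<in> regular. \<exists>C r. decaying (\<lambda>m. lin_coeff (w m) p) C r}"

text \<open>Counterpart of \<open>zigzag\<close> in parameter space: critical points stay fixed, and
  the values at odd-numbered breakpoints rise with speed 1.\<close>

definition direction :: "real ^ 'n" where
  "direction = (\<chi> n. if d \<le> e n \<and> odd (e n - d) then 1 else 0)"

lemma bp_has_derivative:
  "(bp l has_derivative (\<lambda>v. if l = 0 \<or> l = Suc d then 0 else v $ inv e (l - 1))) (at p)"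
proof (cases "l = 0 \<or> l = Suc d")
  case True
  then show ?thesis unfolding bp_def[abs_def] by auto
next
  case False
  then have "bp l = (\<lambda>p. p $ inv e (l - 1))" by (auto simp: bp_def)
  then show ?thesis using False by (simp add: bounded_linear_imp_has_derivative bounded_linear_vec_nth)
qed

lemma val_has_derivative: "(val j has_derivative (\<lambda>v. v $ inv e (d + j))) (at p)"
  unfolding val_def[abs_def] by (intro bounded_linear_imp_has_derivative bounded_linear_vec_nth)

lemma bp_smooth: "open U \<Longrightarrow> Ck_on k U (bp l)"
proof (cases "l = 0 \<or> l = Suc d")
  case True
  then have "bp l = (\<lambda>p. if l = 0 then a else b)" by (auto simp: bp_def)
  then show ?thesis by (simp only: Ck_on_const)
next
  case False
  assume "open U"
  have "bp l = (\<lambda>p. p $ inv e (l - 1))" using False by (auto simp: bp_def)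
  then show ?thesis using Ck_on_bounded_linear[OF bounded_linear_vec_nth \<open>open U\<close>] by simp
qed

lemma val_smooth: "open U \<Longrightarrow> Ck_on k U (val j)"
  unfolding val_def[abs_def] by (rule Ck_on_bounded_linear[OF bounded_linear_vec_nth])

lemma bp_cont: "continuous_on U (bp l)" and val_cont: "continuous_on U (val j)"
  using bp_has_derivative val_has_derivative
  by (meson continuous_at_imp_continuous_on has_derivative_continuous)+

lemma regular_open: "open regular"
proof -
  have "regular = (\<Inter>i\<in>{..d}. {p. bp i p < bp (Suc i) p} \<inter> {p. val i p \<noteq> val (Suc i) p})"
    by (auto simp: regular_def)
  then show ?thesis
    by (simp only:) (intro open_INT ballI open_Int open_Collect_less open_Collect_neq bp_cont val_cont finite_atMost)
qed

lemma inv_slope_smooth: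
  assumes "i \<le> d"
  shows "Ck_on k regular (inv_slope i)"
  unfolding inv_slope_def[abs_def]
  by (intro Ck_on_mult Ck_on_inverse Ck_on_diff regular_open bp_smooth val_smooth)
    (use assms in \<open>force simp: regular_def\<close>)

lemma lin_coeff_smooth: "fst w \<le> d \<Longrightarrow> Ck_on k regular (lin_coeff w)"
  unfolding lin_coeff_def[abs_def] by (cases "snd w") (simp_all add: Ck_on_const inv_slope_smooth)

lemma shift_coeff_smooth: "fst w \<le> d \<Longrightarrow> Ck_on k regular (shift_coeff w)"
  unfolding shift_coeff_def[abs_def]
  by (cases "snd w")
    (auto intro!: Ck_on_mult Ck_on_diff regular_open bp_smooth val_smooth inv_slope_smooth)

lemma finite_letters:
  fixes w :: "nat \<Rightarrow> nat \<times> bool"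
  assumes "\<And>m. fst (w m) \<le> d"
  shows "finite (range (\<lambda>m. \<Phi> (w m)))"
proof -
  have "range (\<lambda>m. \<Phi> (w m)) \<subseteq> \<Phi> ` ({..d} \<times> UNIV)"
  proof
    fix \<phi> assume "\<phi> \<in> range (\<lambda>m. \<Phi> (w m))"
    then obtain m where "\<phi> = \<Phi> (w m)" by blast
    moreover have "w m \<in> {..d} \<times> UNIV" using assms[of m] by (cases "w m") simp
    ultimately show "\<phi> \<in> \<Phi> ` ({..d} \<times> UNIV)" by (rule image_eqI)
  qed
  then show ?thesis by (rule finite_subset[OF _ finite_imageI[OF finite_cartesian_product]]) simp_all
qed

text \<open>The coefficients are finitely many continuous functions, so decay at one parameter
  persists nearby with common constants; this gives both the openness of the domain and locally
  uniform convergence.\<close>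

lemma code_domain_series:
  assumes w: "\<And>m. fst (w m) \<le> d"
  shows "smooth_product_series (code_domain w) (\<lambda>m. lin_coeff (w m))"
proof -
  have fin: "finite (range (\<lambda>m. lin_coeff (w m)))" by (rule finite_letters[OF w])
  have near: "\<exists>C r. \<forall>\<^sub>F q in nhds p. decaying (\<lambda>m. lin_coeff (w m) q) C r" if p: "p \<in> code_domain w" for p
  proof -
    obtain C r where reg: "p \<in> regular" and dec: "decaying (\<lambda>m. lin_coeff (w m) p) C r"
      using p unfolding code_domain_def by blast
    have "isCont (lin_coeff (w m)) p" for m
    proof -
      have "continuous_on regular (lin_coeff (w m))" using lin_coeff_smooth[OF w, of 0 m] by simp
      then show ?thesis using continuous_on_eq_continuous_at[OF regular_open] reg by metis
    qed
    then show ?thesis by (rule decaying_nearby[OF fin _ dec])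
  qed
  have "open (code_domain w)"
    unfolding open_dist eventually_nhds_metric[symmetric]
  proof
    fix p assume p: "p \<in> code_domain w"
    have "\<forall>\<^sub>F q in nhds p. q \<in> regular"
      using p regular_open by (intro eventually_nhds_in_open) (auto simp: code_domain_def)
    moreover obtain C r where "\<forall>\<^sub>F q in nhds p. decaying (\<lambda>m. lin_coeff (w m) q) C r" using near[OF p] by blast
    ultimately show "\<forall>\<^sub>F q in nhds p. q \<in> code_domain w"
      by eventually_elim (auto simp: code_domain_def)
  qed
  moreover have "Ck_on k (code_domain w) (lin_coeff (w m))" for k m
    by (rule Ck_on_subset[OF lin_coeff_smooth[OF w]]) (auto simp: code_domain_def)
  ultimately show ?thesis using fin near by unfold_locales
qed

lemma coded_point_smooth:
  assumes w: "\<And>m. fst (w m) \<le> d"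
  shows "Ck_on k (code_domain w) (coded_point w m)"
proof -
  interpret W: smooth_product_series "code_domain w" "\<lambda>m. lin_coeff (w m)" by (rule code_domain_series[OF w])
  have "Ck_on k (code_domain w) (shift_coeff (w m))" for k m
    by (rule Ck_on_subset[OF shift_coeff_smooth[OF w]]) (auto simp: code_domain_def)
  then have "W.smooth_family (\<lambda>m. shift_coeff (w m))" by (intro W.base finite_letters[OF w])
  from W.smooth_family_Ck[OF W.series[OF this]] show ?thesis unfolding coded_point_def[abs_def] .
qed

lemma bp_direction:
  assumes "l \<le> Suc d"
  shows "(if l = 0 \<or> l = Suc d then 0 else direction $ inv e (l - 1)) = 0"
proof (cases "l = 0 \<or> l = Suc d")
  case False
  then have "e (inv e (l - 1)) = l - 1" "l - 1 < d" using numbering_inverse[OF e, of "l - 1"] assms by auto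
  then show ?thesis by (simp add: direction_def)
qed simp

lemma val_direction: "j \<le> Suc d \<Longrightarrow> direction $ inv e (d + j) = (if odd j then 1 else 0)"
  using numbering_inverse[OF e, of "d + j"] by (simp add: direction_def)

lemma inv_slope_direction:
  assumes p: "p \<in> regular" and i: "i \<le> d"
  shows "frechet_derivative (inv_slope i) (at p) direction =
    - inv_slope i p * ((if odd (Suc i) then 1 else 0) - (if odd i then 1 else 0)) * inverse (val (Suc i) p - val i p)"
proof -
  let ?D = "\<lambda>l v. if l = 0 \<or> l = Suc d then 0 else v $ inv e (l - 1)"
  have ne: "val (Suc i) p - val i p \<noteq> 0" using p i by (auto simp: regular_def)
  have "(inv_slope i has_derivative (\<lambda>v. (bp (Suc i) p - bp i p) *
      (- (inverse (val (Suc i) p - val i p) * (v $ inv e (d + Suc i) - v $ inv e (d + i)) * inverse (val (Suc i) p - val i p)))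
      + (?D (Suc i) v - ?D i v) * inverse (val (Suc i) p - val i p))) (at p)"
    unfolding inv_slope_def[abs_def]
    by (rule has_derivative_mult[OF has_derivative_diff[OF bp_has_derivative bp_has_derivative]
        Deriv.has_derivative_inverse[OF ne has_derivative_diff[OF val_has_derivative val_has_derivative]]])
  from fun_cong[OF frechet_derivative_at[OF this], of direction]
  show ?thesis
    using bp_direction[of "Suc i"] bp_direction[of i] val_direction[of "Suc i"] val_direction[of i] i
    by (simp add: inv_slope_def)
qed

lemma lin_coeff_direction:
  "frechet_derivative (lin_coeff w) (at p) direction =
    (if snd w then 0 else frechet_derivative (inv_slope (fst w)) (at p) direction)"
  unfolding lin_coeff_def[abs_def] by (cases "snd w") (simp_all add: frechet_derivative_const)

lemma shift_coeff_direction: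
  assumes p: "p \<in> regular" and i: "fst w \<le> d"
  shows "frechet_derivative (shift_coeff w) (at p) direction =
    (if snd w then 0 else - ((if odd (fst w) then 1 else 0) * inv_slope (fst w) p
      + val (fst w) p * frechet_derivative (inv_slope (fst w)) (at p) direction))"
proof (cases "snd w")
  case True
  then have "shift_coeff w = bp (Suc (fst w))" by (auto simp: shift_coeff_def)
  then show ?thesis
    using True fun_cong[OF frechet_derivative_at[OF bp_has_derivative[of "Suc (fst w)" p]], of direction]
      bp_direction[of "Suc (fst w)"] i by simp
next
  case False
  let ?D = "\<lambda>l v. if l = 0 \<or> l = Suc d then 0 else v $ inv e (l - 1)"
  have T: "(inv_slope (fst w) has_derivative frechet_derivative (inv_slope (fst w)) (at p)) (at p)"
    using Ck_on_has_derivative[OF inv_slope_smooth[OF i] p] .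
  have "(shift_coeff w has_derivative (\<lambda>v. ?D (fst w) v -
      (val (fst w) p * frechet_derivative (inv_slope (fst w)) (at p) v + v $ inv e (d + fst w) * inv_slope (fst w) p))) (at p)"
    using False unfolding shift_coeff_def[abs_def]
    by (simp only: if_False) (rule has_derivative_diff[OF bp_has_derivative has_derivative_mult[OF val_has_derivative T]])
  from fun_cong[OF frechet_derivative_at[OF this], of direction]
  show ?thesis using False bp_direction[of "fst w"] val_direction[of "fst w"] i by simp
qed

end

section \<open>Itineraries of a map as codes\<close>

locale parametrized_map = parameter_space a b d e + expanding_affine a b d f c s
  for a b :: real and d :: nat and e :: "'n::finite \<Rightarrow> nat" and f c s
begin

abbreviation par :: "real ^ 'n" where "par \<equiv> params e a b d f"

lemma bp_par: "l \<le> Suc d \<Longrightarrow> bp l par = c l"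
proof -
  assume l: "l \<le> Suc d"
  show ?thesis
  proof (cases "l = 0 \<or> l = Suc d")
    case False
    then have "e (inv e (l - 1)) = l - 1" "l - 1 < d" using numbering_inverse[OF e, of "l - 1"] l by auto
    then show ?thesis using False breakpoint_eq[OF branches l] by (simp add: bp_def params_def)
  qed (auto simp: bp_def c_ends)
qed

lemma val_par: "j \<le> Suc d \<Longrightarrow> val j par = f (c j)"
  using numbering_inverse[OF e, of "d + j"] breakpoint_eq[OF branches, of j] by (simp add: val_def params_def)

lemma slope_par: "i \<le> d \<Longrightarrow> val (Suc i) par - val i par = s i * (bp (Suc i) par - bp i par)"
  using f_affine[of i "c i" "c (Suc i)"] c_le[of i "Suc i"] by (simp add: bp_par val_par)

lemma bp_less_par: "i \<le> d \<Longrightarrow> bp i par < bp (Suc i) par"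
  using c_less[of i "Suc i"] by (simp add: bp_par)

lemma par_regular: "par \<in> regular"
proof -
  have "val i par \<noteq> val (Suc i) par" if "i \<le> d" for i
    using slope_par[OF that] slope_nonzero[OF that] bp_less_par[OF that] by auto
  then show ?thesis using bp_less_par by (simp add: regular_def)
qed

lemma inv_slope_par: "i \<le> d \<Longrightarrow> inv_slope i par = 1 / s i"
  using bp_less_par[of i] slope_nonzero[of i] by (simp add: inv_slope_def slope_par field_simps)

definition letter :: "real \<Rightarrow> nat \<times> bool" where "letter x = (branch_idx x, crit x)"

lemma letter_le: "fst (letter x) \<le> d" by (simp add: letter_def branch_idx_le)

lemma lin_coeff_par: "lin_coeff (letter x) par = \<tau> x"
  using inv_slope_par[OF branch_idx_le, of x] by (simp add: lin_coeff_def letter_def \<tau>_def)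

lemma letter_inverts:
  assumes x: "x \<in> {a..b}"
  shows "x = shift_coeff (letter x) par + lin_coeff (letter x) par * f x"
proof (cases "crit x")
  case True
  then show ?thesis
    using crit_idx[OF True] bp_par[of "Suc (branch_idx x)"] by (simp add: shift_coeff_def lin_coeff_def letter_def)
next
  case False
  let ?i = "branch_idx x"
  have i: "?i \<le> d" by (rule branch_idx_le)
  have "f x - f (c ?i) = s ?i * (x - c ?i)"
    by (rule f_affine[OF i _ in_branch_idx[OF x]]) (use c_le[of ?i "Suc ?i"] i in simp)
  then have "(1 / s ?i) * (f x - f (c ?i)) = x - c ?i" using slope_nonzero[OF i] by simp
  then show ?thesis
    using False i bp_par[of ?i] val_par[of ?i] inv_slope_par[OF i]
    by (simp add: shift_coeff_def lin_coeff_def letter_def algebra_simps)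
qed

lemma decaying_par: "\<exists>C r. \<forall>x\<in>{a..b}. decaying (\<lambda>m. lin_coeff (letter ((f ^^ m) x)) par) C r"
  unfolding lin_coeff_par by (rule decaying_orbit)

lemma par_code_domain: "x \<in> {a..b} \<Longrightarrow> par \<in> code_domain (\<lambda>m. letter ((f ^^ m) x))"
  using decaying_par par_regular unfolding code_domain_def by blast

text \<open>By \<open>letter_inverts\<close> the orbit itself is a bounded solution of the recursion
  for coded points, hence the only one.\<close>

lemma coded_point_par:
  assumes x: "x \<in> {a..b}"
  shows "coded_point (\<lambda>m. letter ((f ^^ m) x)) m par = (f ^^ m) x"
proof -
  obtain C r where C: "\<forall>x\<in>{a..b}. decaying (\<lambda>m. lin_coeff (letter ((f ^^ m) x)) par) C r" using decaying_par by blast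
  define B where "B = (\<Sum>\<phi>\<in>range (\<lambda>m. shift_coeff (letter ((f ^^ m) x))). \<bar>\<phi> par\<bar>)"
  have fin: "finite (range (\<lambda>m. shift_coeff (letter ((f ^^ m) x))))"
    by (rule finite_letters) (rule letter_le)
  have "\<bar>shift_coeff (letter ((f ^^ m) x)) par\<bar> \<le> B" for m
    unfolding B_def by (rule member_le_sum[where f="\<lambda>\<phi>. \<bar>\<phi> par\<bar>"]) (use fin in auto)
  moreover have "\<bar>(f ^^ m) x\<bar> \<le> \<bar>a\<bar> + \<bar>b\<bar>" for m using funpow_in[OF x, of m] by auto
  moreover have "(f ^^ m) x = shift_coeff (letter ((f ^^ m) x)) par + lin_coeff (letter ((f ^^ m) x)) par * (f ^^ Suc m) x" for m
    using letter_inverts[OF funpow_in[OF x]] by simp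
  ultimately show ?thesis
    unfolding coded_point_def
    using prod_series_unique[of "\<lambda>m. lin_coeff (letter ((f ^^ m) x)) par" C r "\<lambda>m. shift_coeff (letter ((f ^^ m) x)) par" B
        "\<lambda>m. (f ^^ m) x" "\<bar>a\<bar> + \<bar>b\<bar>" m] bspec[OF C x] by simp
qed

text \<open>The inverse branch is differentiated with the image point \<open>f x\<close> held fixed:
  raising the graph at speed \<open>perturbation x\<close> moves the preimage at minus that speed
  divided by the slope. A marked letter stands for a breakpoint, which does not move.\<close>

lemma letter_direction:
  assumes x: "x \<in> {a..b}"
  shows "frechet_derivative (shift_coeff (letter x)) (at par) direction
      + frechet_derivative (lin_coeff (letter x)) (at par) direction * f x = - \<tau> x * perturbation x"
proof (cases "crit x")
  case True
  then have "snd (letter x)" by (simp add: letter_def)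
  then show ?thesis
    using shift_coeff_direction[OF par_regular letter_le, of x] lin_coeff_direction[of "letter x" par] True
    by (simp add: \<tau>_def)
next
  case False
  let ?i = "branch_idx x"
  have i: "?i \<le> d" by (rule branch_idx_le)
  define \<Delta>z where "\<Delta>z = zigzag (Suc ?i) - zigzag ?i"
  define T' where "T' = frechet_derivative (inv_slope ?i) (at par) direction"
  have z: "(if odd j then 1 else 0) = zigzag j" for j by (simp add: zigzag_def)
  have len: "c (Suc ?i) - c ?i \<noteq> 0" using c_less[of ?i "Suc ?i"] i by simp
  have s: "s ?i \<noteq> 0" by (rule slope_nonzero[OF i])
  have \<tau>: "\<tau> x = 1 / s ?i" using False by (simp add: \<tau>_def)
  have T': "T' = - (1 / s ?i) * \<Delta>z * inverse (s ?i * (c (Suc ?i) - c ?i))"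
    using inv_slope_direction[OF par_regular i] slope_par[OF i] bp_par[of ?i] bp_par[of "Suc ?i"] i
    unfolding z T'_def \<Delta>z_def by (simp add: inv_slope_par[OF i])
  have fx: "f x - f (c ?i) = s ?i * (x - c ?i)"
    by (rule f_affine[OF i _ in_branch_idx[OF x]]) (use c_le[of ?i "Suc ?i"] i in simp)
  have "T' * (f x - f (c ?i)) = - (1 / s ?i) * (\<Delta>z / (c (Suc ?i) - c ?i) * (x - c ?i))"
    unfolding T' fx using s len by (simp add: divide_inverse)
  moreover have "frechet_derivative (shift_coeff (letter x)) (at par) direction = - (zigzag ?i * (1 / s ?i) + f (c ?i) * T')"
    using shift_coeff_direction[OF par_regular letter_le, of x] False val_par[of ?i] i
    unfolding z T'_def by (simp add: letter_def inv_slope_par[OF i])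
  moreover have "frechet_derivative (lin_coeff (letter x)) (at par) direction = T'"
    using lin_coeff_direction[of "letter x" par] False unfolding T'_def by (simp add: letter_def)
  moreover have "perturbation x = zigzag ?i + \<Delta>z / (c (Suc ?i) - c ?i) * (x - c ?i)"
    by (simp add: perturbation_def branch_perturbation_def \<Delta>z_def)
  ultimately show ?thesis unfolding \<tau> by (simp add: algebra_simps)
qed

text \<open>Both sides start bounded solutions of the same recursion along the orbit of
  \<open>x\<close>; its source term comes from \<open>letter_direction\<close>.\<close>

lemma coded_point_direction:
  assumes x: "x \<in> {a..b}"
  shows "frechet_derivative (coded_point (\<lambda>m. letter ((f ^^ m) x)) 0) (at par) direction = displacement x"
proof -
  let ?w = "\<lambda>m. letter ((f ^^ m) x)"
  have w: "fst (?w m) \<le> d" for m by (rule letter_le)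
  interpret W: smooth_product_series "code_domain ?w" "\<lambda>m. lin_coeff (?w m)" by (rule code_domain_series[OF w])
  have sm: "Ck_on k (code_domain ?w) (shift_coeff (?w m))" for k m
    by (rule Ck_on_subset[OF shift_coeff_smooth[OF w]]) (auto simp: code_domain_def)
  have fin: "finite (range (\<lambda>m. shift_coeff (?w m)))" by (rule finite_letters[OF w])
  note der = W.series_deriv[OF fin sm par_code_domain[OF x], where v=direction, folded coded_point_def[abs_def]]
  define D where "D m = frechet_derivative (coded_point ?w m) (at par) direction" for m
  obtain B' where B': "\<And>m. \<bar>D m\<bar> \<le> B'"
    using der(1) unfolding D_def coded_point_def[abs_def] by blast
  have D: "D m = - \<tau> ((f ^^ m) x) * perturbation ((f ^^ m) x) + \<tau> ((f ^^ m) x) * D (Suc m)" for m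
    using der(2)[of m] letter_direction[OF funpow_in[OF x], of m] coded_point_par[OF x, of "Suc m"]
    unfolding D_def coded_point_def[abs_def] by (simp add: lin_coeff_par)
  obtain C r where C: "\<forall>x\<in>{a..b}. decaying (\<lambda>m. \<tau> ((f ^^ m) x)) C r" using decaying_orbit by blast
  obtain B where B: "\<forall>x\<in>{a..b}. \<bar>- \<tau> x * perturbation x\<bar> \<le> B" using perturbation_bound by blast
  have "D 0 = prod_series (\<lambda>m. \<tau> ((f ^^ m) x)) (\<lambda>m. - \<tau> ((f ^^ m) x) * perturbation ((f ^^ m) x)) 0"
    by (rule prod_series_unique[OF bspec[OF C x] _ D B', where B=B]) (use B funpow_in[OF x] in blast)
  then show ?thesis unfolding D_def displacement_def .
qed

end

section \<open>Kneading equations and the conjugacy class\<close>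

lemma local_equation_transfer:
  assumes U: "\<exists>U \<phi>. open U \<and> p \<in> U \<and> (\<forall>k. Ck_on k U \<phi>) \<and>
      (\<forall>x\<in>U. \<exists>v. frechet_derivative \<phi> (at x) v \<noteq> 0) \<and> M \<inter> U = {x \<in> U. \<phi> x = 0}"
    and W: "open W" "p \<in> W" "N \<inter> W = M \<inter> W"
  shows "\<exists>U \<phi>. open U \<and> p \<in> U \<and> (\<forall>k. Ck_on k U \<phi>) \<and>
      (\<forall>x\<in>U. \<exists>v. frechet_derivative \<phi> (at x) v \<noteq> 0) \<and> N \<inter> U = {x \<in> U. \<phi> x = 0}"
proof -
  obtain U \<phi> where U: "open U" "p \<in> U" "\<forall>k. Ck_on k U \<phi>"
    "\<forall>x\<in>U. \<exists>v. frechet_derivative \<phi> (at x) v \<noteq> 0" "M \<inter> U = {x \<in> U. \<phi> x = 0}"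
    using U by (elim exE conjE) (rule that)
  have "N \<inter> (U \<inter> W) = (M \<inter> U) \<inter> W" using W(3) by blast
  then have "N \<inter> (U \<inter> W) = {x \<in> U \<inter> W. \<phi> x = 0}" unfolding U(5) by blast
  moreover have "\<forall>k. Ck_on k (U \<inter> W) \<phi>" by (intro allI Ck_on_subset[OF spec[OF U(3)]]) simp
  moreover have "open (U \<inter> W)" using U(1) W(1) by (rule open_Int)
  moreover have "p \<in> U \<inter> W" using U(2) W(2) by (rule IntI)
  moreover have "\<forall>x\<in>U \<inter> W. \<exists>v. frechet_derivative \<phi> (at x) v \<noteq> 0" using U(4) by simp
  ultimately show ?thesis by (intro exI[of _ "U \<inter> W"] exI[of _ \<phi>] conjI)
qed

lemma smooth_hypersurface_Int:
  assumes "smooth_hypersurface M" "open W"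
  shows "smooth_hypersurface (M \<inter> W)"
  unfolding smooth_hypersurface_def
proof
  fix p assume p: "p \<in> M \<inter> W"
  show "\<exists>U \<phi>. open U \<and> p \<in> U \<and> (\<forall>k. Ck_on k U \<phi>) \<and>
      (\<forall>x\<in>U. \<exists>v. frechet_derivative \<phi> (at x) v \<noteq> 0) \<and> (M \<inter> W) \<inter> U = {x \<in> U. \<phi> x = 0}"
    by (rule local_equation_transfer[OF bspec[OF assms(1)[unfolded smooth_hypersurface_def]] assms(2)]) (use p in auto)
qed

text \<open>Near a point of one piece its open set excludes the other piece, so the local equation
  of a single piece suffices.\<close>

lemma smooth_hypersurface_Un:
  assumes M: "smooth_hypersurface M" "M \<subseteq> W" "open W"
    and N: "smooth_hypersurface N" "N \<subseteq> V" "open V" and disj: "W \<inter> V = {}"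
  shows "smooth_hypersurface (M \<union> N)"
  unfolding smooth_hypersurface_def
proof
  fix p assume p: "p \<in> M \<union> N"
  show "\<exists>U \<phi>. open U \<and> p \<in> U \<and> (\<forall>k. Ck_on k U \<phi>) \<and>
      (\<forall>x\<in>U. \<exists>v. frechet_derivative \<phi> (at x) v \<noteq> 0) \<and> (M \<union> N) \<inter> U = {x \<in> U. \<phi> x = 0}"
  proof (cases "p \<in> M")
    case True
    show ?thesis
      by (rule local_equation_transfer[OF bspec[OF M(1)[unfolded smooth_hypersurface_def] True] M(3)])
        (use True M(2) N(2) disj in blast)+
  next
    case False
    then have "p \<in> N" using p by blast
    show ?thesis
      by (rule local_equation_transfer[OF bspec[OF N(1)[unfolded smooth_hypersurface_def] \<open>p \<in> N\<close>] N(3)])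
        (use \<open>p \<in> N\<close> M(2) N(2) disj in blast)+
  qed
qed

text \<open>
  The defining function is \<open>\<Sum>i\<in>A. d\<Phi> i * \<Phi> i\<close> with \<open>d\<Phi> i\<close> the derivative of \<open>\<Phi> i\<close> along \<open>v\<close>:
  on the common zero set its derivative along \<open>v\<close> is the sum of the squares of the \<open>d\<Phi> i\<close>.
\<close>

lemma merged_hypersurface:
  fixes \<Phi> :: "nat \<Rightarrow> 'a::euclidean_space \<Rightarrow> real"
  assumes \<Omega>: "open \<Omega>" and sm: "\<And>i k. i \<in> A \<Longrightarrow> Ck_on k \<Omega> (\<Phi> i)" and fin: "finite A"
  shows "\<exists>M. smooth_hypersurface M \<and> (\<forall>p\<in>\<Omega>. (\<forall>i\<in>A. \<Phi> i p = 0) \<longrightarrow>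
    (\<exists>i\<in>A. frechet_derivative (\<Phi> i) (at p) v \<noteq> 0) \<longrightarrow> p \<in> M)"
proof -
  define d\<Phi> where "d\<Phi> i p = frechet_derivative (\<Phi> i) (at p) v" for i p
  define \<Psi> where "\<Psi> p = (\<Sum>i\<in>A. d\<Phi> i p * \<Phi> i p)" for p
  have d_sm: "Ck_on k \<Omega> (d\<Phi> i)" if "i \<in> A" for i k
    unfolding d\<Phi>_def[abs_def] by (rule Ck_on_deriv[OF sm[OF that]])
  have \<Psi>_sm: "Ck_on k \<Omega> \<Psi>" for k
    unfolding \<Psi>_def[abs_def] by (intro Ck_on_sum Ck_on_mult \<Omega> sm d_sm)
  define d\<Psi> where "d\<Psi> p = frechet_derivative \<Psi> (at p) v" for p
  \<comment> \<open>The zero set of \<open>\<Psi>\<close> may be singular and larger than the common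
    zero set, so only its points with nonzero derivative along \<open>v\<close> are kept.\<close>
  define M where "M = {p \<in> \<Omega>. \<Psi> p = 0 \<and> d\<Psi> p \<noteq> 0}"
  have cont: "continuous_on \<Omega> d\<Psi>"
    using Ck_on_deriv[OF \<Psi>_sm[of "Suc 0"], of v] unfolding d\<Psi>_def[abs_def] by simp
  define U where "U = {p \<in> \<Omega>. d\<Psi> p \<noteq> 0}"
  have U: "open U"
  proof -
    have "U = \<Omega> \<inter> d\<Psi> -` (- {0})" by (auto simp: U_def)
    then show ?thesis using continuous_open_preimage[OF cont \<Omega>, of "- {0}"] by (simp add: open_Compl)
  qed
  have "smooth_hypersurface M"
    unfolding smooth_hypersurface_def
  proof
    fix p assume "p \<in> M"
    then have "p \<in> U" by (auto simp: M_def U_def)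
    moreover have "\<forall>k. Ck_on k U \<Psi>" using Ck_on_subset[OF \<Psi>_sm] by (auto simp: U_def)
    moreover have "\<forall>x\<in>U. \<exists>v. frechet_derivative \<Psi> (at x) v \<noteq> 0" by (auto simp: U_def d\<Psi>_def)
    moreover have "M \<inter> U = {x \<in> U. \<Psi> x = 0}" by (auto simp: U_def M_def)
    ultimately show "\<exists>U \<phi>. open U \<and> p \<in> U \<and> (\<forall>k. Ck_on k U \<phi>) \<and>
      (\<forall>x\<in>U. \<exists>v. frechet_derivative \<phi> (at x) v \<noteq> 0) \<and> M \<inter> U = {x \<in> U. \<phi> x = 0}"
      using U by blast
  qed
  moreover have "p \<in> M" if p: "p \<in> \<Omega>" and z: "\<forall>i\<in>A. \<Phi> i p = 0" and nz: "\<exists>i\<in>A. d\<Phi> i p \<noteq> 0" for p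
  proof -
    have "(\<Psi> has_derivative (\<lambda>u. \<Sum>i\<in>A. d\<Phi> i p * frechet_derivative (\<Phi> i) (at p) u
        + frechet_derivative (d\<Phi> i) (at p) u * \<Phi> i p)) (at p)"
      unfolding \<Psi>_def[abs_def]
      by (intro has_derivative_sum has_derivative_mult Ck_on_has_derivative[OF sm p] Ck_on_has_derivative[OF d_sm p])
    from fun_cong[OF frechet_derivative_at[OF this], of v]
    have "d\<Psi> p = (\<Sum>i\<in>A. d\<Phi> i p * d\<Phi> i p)"
      unfolding d\<Psi>_def using z by (simp add: d\<Phi>_def)
    moreover have "(\<Sum>i\<in>A. d\<Phi> i p * d\<Phi> i p) > 0"
    proof -
      obtain i where "i \<in> A" "d\<Phi> i p \<noteq> 0" using nz by blast
      then show ?thesis by (intro sum_pos2[OF fin]) (auto simp: zero_less_mult_iff linorder_neq_iff)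
    qed
    moreover have "\<Psi> p = 0" unfolding \<Psi>_def using z by simp
    ultimately show ?thesis using p by (simp add: M_def)
  qed
  ultimately show ?thesis unfolding d\<Phi>_def by blast
qed

text \<open>A conjugacy preserves these signs or, if decreasing, negates and renumbers them. They
  determine the codes of the critical values; the sign 0 records when a critical point is
  hit.\<close>

definition order_pattern :: "real \<Rightarrow> real \<Rightarrow> nat \<Rightarrow> (real \<Rightarrow> real) \<Rightarrow> nat \<Rightarrow> nat \<Rightarrow> nat \<Rightarrow> real" where
  "order_pattern a b d f j k l = sgn ((f ^^ j) (breakpoint a b d f k) - breakpoint a b d f l)"

definition same_pattern :: "real \<Rightarrow> real \<Rightarrow> nat \<Rightarrow> (real \<Rightarrow> real) \<Rightarrow> (real \<Rightarrow> real) \<Rightarrow> bool" where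
  "same_pattern a b d f g \<longleftrightarrow>
     (\<forall>j. \<forall>k\<in>{1..d}. \<forall>l\<in>{1..d}. order_pattern a b d f j k l = order_pattern a b d g j k l)"

text \<open>The signs tell which critical points lie to the left of an orbit point and whether it
  coincides with one, which is all that a letter contains. The code starts at the critical value, so
  the letter at \<open>m\<close> uses the signs at time \<open>Suc m\<close>.\<close>

lemma same_pattern_letter:
  fixes e :: "'n::finite \<Rightarrow> nat"
  assumes F: "parametrized_map a b d e f c s" and G: "parametrized_map a b d e g c' s'"
    and same: "same_pattern a b d f g" and k: "k \<in> {1..d}"
  shows "parametrized_map.letter d c ((f ^^ m) (f (c k))) = parametrized_map.letter d c' ((g ^^ m) (g (c' k)))"
proof -
  interpret F: parametrized_map a b d e f c s by (rule F)
  interpret G: parametrized_map a b d e g c' s' by (rule G)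
  define x y where "x = (f ^^ m) (f (c k))" and "y = (g ^^ m) (g (c' k))"
  have xy: "x = (f ^^ Suc m) (c k)" "y = (g ^^ Suc m) (c' k)"
    by (simp_all only: x_def y_def funpow_Suc_right comp_apply)
  have s: "sgn (x - c l) = sgn (y - c' l)" if l: "l \<in> {1..d}" for l
  proof -
    have "order_pattern a b d f (Suc m) k l = order_pattern a b d g (Suc m) k l"
      using same k l unfolding same_pattern_def by blast
    moreover have "k \<le> Suc d" "l \<le> Suc d" using k l by auto
    ultimately show ?thesis
      unfolding order_pattern_def xy by (simp only: breakpoint_eq[OF F.branches] breakpoint_eq[OF G.branches])
  qed
  have lt: "c l < x \<longleftrightarrow> c' l < y" and eq: "x = c l \<longleftrightarrow> y = c' l" if "l \<in> {1..d}" for l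
    using sgn_greater[of "x - c l"] sgn_greater[of "y - c' l"] sgn_0_0[of "x - c l"] sgn_0_0[of "y - c' l"] s[OF that]
    by simp_all
  have "{l \<in> {1..d}. c l < x} = {l \<in> {1..d}. c' l < y}" using lt by blast
  moreover have "F.crit x \<longleftrightarrow> G.crit y" unfolding F.crit_def G.crit_def using eq by blast
  ultimately show ?thesis
    unfolding F.letter_def G.letter_def F.branch_idx_def G.branch_idx_def x_def[symmetric] y_def[symmetric] by simp
qed

lemma exp_family_parametrized:
  fixes e :: "'n::finite \<Rightarrow> nat"
  assumes "a < b" "bij_betw e UNIV {..<2 * d + 2}" "f \<in> exp_family a b d"
  obtains c s where "parametrized_map a b d e f c s"
proof -
  obtain c s where "expanding_affine a b d f c s" by (rule exp_familyD[OF assms(1,3)])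
  then have "parametrized_map a b d e f c s"
    using assms(1,2) by (intro parametrized_map.intro parameter_space.intro)
  then show ?thesis by (rule that)
qed

text \<open>All such \<open>g\<close> share the codes of \<open>f\<close>, so one list of functions
  \<open>\<Phi> k\<close> serves them all. Transversality is invoked at each \<open>g\<close> with
  its own displacement field; the index \<open>k\<close> that it yields may vary, which is why the
  functions are merged.\<close>

lemma pattern_hypersurface:
  fixes e :: "'n::finite \<Rightarrow> nat"
  assumes ab: "a < b" and e: "bij_betw e UNIV {..<2 * d + 2}" and f: "f \<in> exp_family a b d"
  shows "\<exists>M. smooth_hypersurface M \<and>
    (\<forall>g\<in>exp_family a b d. same_pattern a b d f g \<longrightarrow> params e a b d g \<in> M)"
proof -
  obtain c s where F: "parametrized_map a b d e f c s" by (rule exp_family_parametrized[OF ab e f])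
  interpret F: parametrized_map a b d e f c s by (rule F)
  define w where "w k m = F.letter ((f ^^ m) (f (c k)))" for k m
  define \<Omega> where "\<Omega> = F.regular \<inter> (\<Inter>k\<in>{1..d}. F.code_domain (w k))"
  \<comment> \<open>The defect of the kneading equation. At \<open>g\<close> its derivative along
    \<open>direction\<close> is the velocity of the coded critical value minus the speed
    \<open>zigzag k\<close> of the value itself.\<close>
  define \<Phi> where "\<Phi> k p = F.coded_point (w k) 0 p - F.val k p" for k p
  have w: "fst (w k m) \<le> d" for k m unfolding w_def by (rule F.letter_le)
  have "open (F.code_domain (w k))" for k
    using F.code_domain_series[of "w k", OF w] unfolding smooth_product_series_def by blast
  then have \<Omega>: "open \<Omega>" unfolding \<Omega>_def by (intro open_Int F.regular_open open_INT) auto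
  have code_sm: "Ck_on n \<Omega> (F.coded_point (w k) 0)" if "k \<in> {1..d}" for k n
    by (rule Ck_on_subset[OF F.coded_point_smooth[of "w k", OF w]]) (use that in \<open>auto simp: \<Omega>_def\<close>)
  have sm: "Ck_on n \<Omega> (\<Phi> k)" if "k \<in> {1..d}" for k n
    unfolding \<Phi>_def[abs_def] by (intro Ck_on_diff \<Omega> code_sm[OF that] F.val_smooth)
  obtain M where M: "smooth_hypersurface M" "\<forall>p\<in>\<Omega>. (\<forall>k\<in>{1..d}. \<Phi> k p = 0) \<longrightarrow>
      (\<exists>k\<in>{1..d}. frechet_derivative (\<Phi> k) (at p) F.direction \<noteq> 0) \<longrightarrow> p \<in> M"
    using merged_hypersurface[of \<Omega> "{1..d}" \<Phi> F.direction, OF \<Omega> sm finite_atLeastAtMost] by blast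
  have "params e a b d g \<in> M" if g: "g \<in> exp_family a b d" and same: "same_pattern a b d f g" for g
  proof -
    obtain c' s' where G: "parametrized_map a b d e g c' s'" by (rule exp_family_parametrized[OF ab e g])
    interpret G: parametrized_map a b d e g c' s' by (rule G)
    have wg: "w k = (\<lambda>m. G.letter ((g ^^ m) (g (c' k))))" if "k \<in> {1..d}" for k
      unfolding w_def using same_pattern_letter[OF F G same that] by blast
    have gc: "g (c' k) \<in> {a..b}" if "k \<in> {1..d}" for k
      using G.c_in[of k] that by (intro G.f_in) simp
    have dom: "G.par \<in> \<Omega>"
      unfolding \<Omega>_def using G.par_regular G.par_code_domain gc wg by auto
    have zero: "\<Phi> k G.par = 0" if "k \<in> {1..d}" for k
      unfolding \<Phi>_def wg[OF that] using G.coded_point_par[OF gc[OF that], of 0] G.val_par[of k] that by simp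
    have der: "frechet_derivative (\<Phi> k) (at G.par) F.direction = G.displacement (g (c' k)) - G.zigzag k" if k: "k \<in> {1..d}" for k
    proof -
      have "(\<Phi> k has_derivative (\<lambda>v. frechet_derivative (F.coded_point (w k) 0) (at G.par) v - v $ inv e (d + k))) (at G.par)"
        unfolding \<Phi>_def[abs_def]
        by (rule has_derivative_diff[OF Ck_on_has_derivative[OF code_sm[OF k] dom] F.val_has_derivative])
      from fun_cong[OF frechet_derivative_at[OF this], of F.direction]
      show ?thesis
        using G.coded_point_direction[OF gc[OF k]] F.val_direction[of k] k
        unfolding wg[OF k] G.zigzag_def by simp
    qed
    obtain k where "k \<in> {1..d}" "G.displacement (g (c' k)) \<noteq> G.zigzag k"
      using G.displacement_transversal by blast
    then have "\<exists>k\<in>{1..d}. frechet_derivative (\<Phi> k) (at G.par) F.direction \<noteq> 0" using der by fastforce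
    then show ?thesis using M(2) dom zero by blast
  qed
  then show ?thesis using M(1) by blast
qed

lemma funpow_conj:
  assumes "\<And>x. x \<in> X \<Longrightarrow> h (f x) = g (h x)" "\<And>x. x \<in> X \<Longrightarrow> f x \<in> X" "x \<in> X"
  shows "h ((f ^^ j) x) = (g ^^ j) (h x)"
proof -
  have "(f ^^ j) x \<in> X \<and> h ((f ^^ j) x) = (g ^^ j) (h x)"
    by (induction j) (use assms in auto)
  then show ?thesis ..
qed

lemma conjugate_pattern:
  assumes ab: "a < b" and f: "f \<in> exp_family a b d" and g: "g \<in> conjugacy_class a b d f"
  shows "same_pattern a b d f g \<or>
    (\<forall>j. \<forall>k\<in>{1..d}. \<forall>l\<in>{1..d}. order_pattern a b d g j k l = - order_pattern a b d f j (Suc d - k) (Suc d - l))"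
proof -
  obtain h where g': "g \<in> exp_family a b d" and conj: "conjugacy {a..b} f {a..b} g h"
    using g unfolding conjugacy_class_def by blast
  obtain c s where F: "expanding_affine a b d f c s" and bf: "\<And>i. i \<le> Suc d \<Longrightarrow> breakpoint a b d f i = c i"
    by (rule exp_familyD[OF ab f]) blast
  obtain c' s' where G: "expanding_affine a b d g c' s'" and bg: "\<And>i. i \<le> Suc d \<Longrightarrow> breakpoint a b d g i = c' i"
    by (rule exp_familyD[OF ab g']) blast
  interpret F: expanding_affine a b d f c s by (rule F)
  have hf: "h (f x) = g (h x)" if "x \<in> {a..b}" for x using conj that unfolding conjugacy_def by blast
  have pow: "(g ^^ j) (h x) = h ((f ^^ j) x)" if "x \<in> {a..b}" for j x
    using funpow_conj[of "{a..b}" h f g x j] hf F.f_in that by simp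
  show ?thesis
    using F G conj
  proof (cases rule: conjugacy_breakpoints)
    case mono
    have sg: "sgn (h x - h y) = sgn (x - y)" if "x \<in> {a..b}" "y \<in> {a..b}" for x y
      using strict_mono_onD[OF mono(1), of x y] strict_mono_onD[OF mono(1), of y x] that
      by (cases x y rule: linorder_cases) (simp_all add: sgn_if)
    have "order_pattern a b d f j k l = order_pattern a b d g j k l" if kl: "k \<in> {1..d}" "l \<in> {1..d}" for j k l
    proof -
      have "(g ^^ j) (c' k) - c' l = h ((f ^^ j) (c k)) - h (c l)"
        using pow[of "c k" j] F.c_in[of k] mono(2)[of k] mono(2)[of l] kl by simp
      then show ?thesis
        unfolding order_pattern_def using bf bg kl sg[OF F.funpow_in F.c_in, of "c k" l j] F.c_in[of k] by simp
    qed
    then show ?thesis unfolding same_pattern_def by blast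
  next
    case anti
    have sg: "sgn (h x - h y) = - sgn (x - y)" if "x \<in> {a..b}" "y \<in> {a..b}" for x y
      using monotone_onD[OF anti(1), of x y] monotone_onD[OF anti(1), of y x] that
      by (cases x y rule: linorder_cases) (simp_all add: sgn_if)
    have "order_pattern a b d g j k l = - order_pattern a b d f j (Suc d - k) (Suc d - l)"
      if kl: "k \<in> {1..d}" "l \<in> {1..d}" for j k l
    proof -
      have "h (c (Suc d - k)) = c' k" "h (c (Suc d - l)) = c' l"
        using anti(2)[of "Suc d - k"] anti(2)[of "Suc d - l"] kl by auto
      then have "(g ^^ j) (c' k) - c' l = h ((f ^^ j) (c (Suc d - k))) - h (c (Suc d - l))"
        using pow[of "c (Suc d - k)" j] F.c_in[of "Suc d - k"] by simp
      then show ?thesis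
        unfolding order_pattern_def
        using bf bg kl sg[OF F.funpow_in F.c_in, of "c (Suc d - k)" "Suc d - l" j] F.c_in[of "Suc d - k"] by simp
    qed
    then show ?thesis by blast
  qed
qed

section \<open>Separation of the two orientations\<close>

context parameter_space
begin

text \<open>Adds up increments over the branches, with \<open>x\<close> clamped to each. In this
  form the map is jointly continuous in \<open>p\<close> and \<open>x\<close> without a case
  distinction, and it makes sense off {a..b}, where iterates for general parameters may
  lead.\<close>

definition family_map :: "real ^ 'n \<Rightarrow> real \<Rightarrow> real" where
  "family_map p x = val 0 p + (\<Sum>i\<le>d. (val (Suc i) p - val i p) / (bp (Suc i) p - bp i p) *
     (max (bp i p) (min x (bp (Suc i) p)) - bp i p))"

lemma family_map_cont:
  assumes "continuous_on regular x"
  shows "continuous_on regular (\<lambda>p. family_map p (x p))"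
  unfolding family_map_def
  by (intro continuous_intros bp_cont val_cont assms) (force simp: regular_def)

lemma family_map_funpow_cont:
  "continuous_on regular x \<Longrightarrow> continuous_on regular (\<lambda>p. (family_map p ^^ j) (x p))"
  by (induction j) (auto intro: family_map_cont)

end

context parametrized_map
begin

lemma family_map_par:
  assumes x: "x \<in> {a..b}"
  shows "family_map par x = f x"
proof -
  define y where "y i = min x (c i)" for i
  have term_eq: "(val (Suc i) par - val i par) / (bp (Suc i) par - bp i par) *
      (max (bp i par) (min x (bp (Suc i) par)) - bp i par) = f (y (Suc i)) - f (y i)" if i: "i \<le> d" for i
  proof -
    have lt: "c i < c (Suc i)" using c_less[of i "Suc i"] i by simp
    have q: "(val (Suc i) par - val i par) / (bp (Suc i) par - bp i par) = s i"
      using slope_par[OF i] bp_less_par[OF i] by simp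
    show ?thesis
    proof (cases "c i \<le> x")
      case True
      then have "y i \<in> {c i..c (Suc i)}" "y (Suc i) \<in> {c i..c (Suc i)}" using lt by (auto simp: y_def)
      then have "f (y (Suc i)) - f (y i) = s i * (y (Suc i) - y i)" by (rule f_affine[OF i])
      then show ?thesis unfolding q using True lt i by (simp add: bp_par y_def)
    next
      case False
      then show ?thesis using lt i by (simp add: bp_par y_def)
    qed
  qed
  have "family_map par x = f a + (\<Sum>i<Suc d. f (y (Suc i)) - f (y i))"
  proof -
    have "(\<Sum>i\<le>d. (val (Suc i) par - val i par) / (bp (Suc i) par - bp i par) *
        (max (bp i par) (min x (bp (Suc i) par)) - bp i par)) = (\<Sum>i\<le>d. f (y (Suc i)) - f (y i))"
      by (rule sum.cong[OF refl], rule term_eq) simp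
    then show ?thesis unfolding family_map_def lessThan_Suc_atMost using val_par[of 0] c_ends(1) by simp
  qed
  also have "(\<Sum>i<Suc d. f (y (Suc i)) - f (y i)) = f (y (Suc d)) - f (y 0)"
    by (rule sum_lessThan_telescope)
  finally show ?thesis using x c_ends by (simp add: y_def)
qed

lemma family_map_funpow_par: "x \<in> {a..b} \<Longrightarrow> (family_map par ^^ j) x = (f ^^ j) x"
  by (induction j) (simp_all add: family_map_par funpow_in del: atLeastAtMost_iff)

lemma sgn_family_map:
  assumes "k \<in> {1..d}" "l \<in> {1..d}"
  shows "sgn ((family_map par ^^ j) (bp k par) - bp l par) = order_pattern a b d f j k l"
  using assms family_map_funpow_par[OF c_in[of k], of j] breakpoint_eq[OF branches]
  by (simp add: order_pattern_def bp_par)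

end

text \<open>Serves to find the sign of \<open>Q\<close>, as the order pattern gives only the signs
  of the two differences added there.\<close>

lemma sgn_add: "sgn (x + y :: real) = sgn (sgn x + sgn y)" if "sgn x + sgn y \<noteq> 0"
  using that by (auto simp: sgn_if split: if_splits)

text \<open>
  The maps conjugate to \<open>f\<close> by decreasing homeomorphisms have the reversed order pattern. Unless the
  pattern is symmetric, the sign of one continuous function separates the two halves of the class.
\<close>

lemma conjugacy_class_hypersurface:
  fixes e :: "'n::finite \<Rightarrow> nat"
  assumes ab: "a < b" and e: "bij_betw e UNIV {..<2 * d + 2}" and f: "f \<in> exp_family a b d"
  shows "\<exists>M. smooth_hypersurface M \<and> params e a b d ` conjugacy_class a b d f \<subseteq> M"
proof -
  interpret parameter_space a b d e using ab e by (rule parameter_space.intro)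
  let ?\<sigma> = "order_pattern a b d"
  let ?rev = "\<lambda>g. \<forall>j. \<forall>k\<in>{1..d}. \<forall>l\<in>{1..d}. ?\<sigma> g j k l = - ?\<sigma> f j (Suc d - k) (Suc d - l)"
  have cases: "same_pattern a b d f g \<or> ?rev g" if "g \<in> conjugacy_class a b d f" for g
    using conjugate_pattern[OF ab f that] .
  have in_E: "g \<in> exp_family a b d" if "g \<in> conjugacy_class a b d f" for g
    using that unfolding conjugacy_class_def by blast
  obtain M where M: "smooth_hypersurface M"
    "\<And>g. g \<in> exp_family a b d \<Longrightarrow> same_pattern a b d f g \<Longrightarrow> params e a b d g \<in> M"
    using pattern_hypersurface[OF ab e f] by blast
  show ?thesis
  proof (cases "\<forall>j. \<forall>k\<in>{1..d}. \<forall>l\<in>{1..d}. ?\<sigma> f j k l + ?\<sigma> f j (Suc d - k) (Suc d - l) = 0")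
    case True
    \<comment> \<open>A symmetric pattern is its own reversal, so the whole class lies on the
      hypersurface of one pattern.\<close>
    have "same_pattern a b d f g" if "?rev g" for g
      unfolding same_pattern_def
    proof (intro allI ballI)
      fix j k l assume kl: "k \<in> {1..d}" "l \<in> {1..d}"
      have "?\<sigma> f j k l + ?\<sigma> f j (Suc d - k) (Suc d - l) = 0" using True kl by blast
      moreover have "?\<sigma> g j k l = - ?\<sigma> f j (Suc d - k) (Suc d - l)" using that kl by blast
      ultimately show "?\<sigma> f j k l = ?\<sigma> g j k l" by simp
    qed
    then have "params e a b d ` conjugacy_class a b d f \<subseteq> M" using M(2) cases in_E by blast
    then show ?thesis using M(1) by blast
  next
    case False
    then obtain j k l where kl: "k \<in> {1..d}" "l \<in> {1..d}"
      and nz: "?\<sigma> f j k l + ?\<sigma> f j (Suc d - k) (Suc d - l) \<noteq> 0" by blast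
    define k' l' where "k' = Suc d - k" and "l' = Suc d - l"
    have kl': "k' \<in> {1..d}" "l' \<in> {1..d}" "Suc d - k' = k" "Suc d - l' = l"
      using kl by (auto simp: k'_def l'_def)
    define \<delta> where "\<delta> = ?\<sigma> f j k l + ?\<sigma> f j k' l'"
    \<comment> \<open>The bracket has the sign of \<open>\<delta>\<close> at maps with the pattern
      of \<open>f\<close> and the opposite sign at maps with the reversed pattern. The factor
      \<open>\<delta>\<close> turns these into positive and negative values, whatever the sign of
      \<open>\<delta>\<close>.\<close>
    define Q where "Q p = \<delta> * (((family_map p ^^ j) (bp k p) - bp l p) + ((family_map p ^^ j) (bp k' p) - bp l' p))" for p
    have Q_cont: "continuous_on regular Q"
      unfolding Q_def by (intro continuous_intros family_map_funpow_cont bp_cont)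
    define W V where "W = {p \<in> regular. Q p > 0}" and "V = {p \<in> regular. Q p < 0}"
    have "W = regular \<inter> Q -` {0<..}" "V = regular \<inter> Q -` {..<0}" by (auto simp: W_def V_def)
    then have WV: "open W" "open V" "W \<inter> V = {}"
      using continuous_open_preimage[OF Q_cont regular_open, of "{0<..}"]
        continuous_open_preimage[OF Q_cont regular_open, of "{..<0}"] by (auto simp: W_def V_def)
    have sQ: "sgn (Q (params e a b d g)) = sgn \<delta> * sgn (?\<sigma> g j k l + ?\<sigma> g j k' l') \<and> params e a b d g \<in> regular"
      if g: "g \<in> exp_family a b d" and ne: "?\<sigma> g j k l + ?\<sigma> g j k' l' \<noteq> 0" for g
    proof -
      obtain c s where G: "parametrized_map a b d e g c s" by (rule exp_family_parametrized[OF ab e g])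
      interpret G: parametrized_map a b d e g c s by (rule G)
      show ?thesis
        unfolding Q_def sgn_mult using G.par_regular ne
        by (simp add: sgn_add G.sgn_family_map[OF kl] G.sgn_family_map[OF kl'(1,2)])
    qed
    have \<delta>: "\<delta> \<noteq> 0" using nz by (simp add: \<delta>_def k'_def l'_def)
    have inW: "params e a b d g \<in> M \<inter> W" if g: "g \<in> exp_family a b d" and same: "same_pattern a b d f g" for g
    proof -
      have "?\<sigma> g j k l + ?\<sigma> g j k' l' = \<delta>"
        using same kl kl'(1,2) unfolding same_pattern_def \<delta>_def by simp
      then have "sgn (Q (params e a b d g)) = sgn \<delta> * sgn \<delta>" "params e a b d g \<in> regular"
        using sQ[OF g] \<delta> by simp_all
      then have "Q (params e a b d g) > 0" using \<delta> by (auto simp: sgn_if split: if_splits)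
      then show ?thesis using M(2)[OF g same] \<open>params e a b d g \<in> regular\<close> by (simp add: W_def)
    qed
    have inV: "params e a b d g \<in> V" if g: "g \<in> exp_family a b d" and rev: "?rev g" for g
    proof -
      have "?\<sigma> g j k l = - ?\<sigma> f j k' l'" "?\<sigma> g j k' l' = - ?\<sigma> f j k l"
        using rev kl kl' unfolding k'_def[symmetric] l'_def[symmetric]
        by (metis k'_def l'_def)+
      then have eq: "?\<sigma> g j k l + ?\<sigma> g j k' l' = - \<delta>" by (simp add: \<delta>_def)
      then have "sgn (Q (params e a b d g)) = - (sgn \<delta> * sgn \<delta>)" "params e a b d g \<in> regular"
        using sQ[OF g] \<delta> by (simp_all add: sgn_minus)
      then have "Q (params e a b d g) < 0" using \<delta> by (auto simp: sgn_if split: if_splits)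
      then show ?thesis using \<open>params e a b d g \<in> regular\<close> by (simp add: V_def)
    qed
    have MW: "smooth_hypersurface (M \<inter> W)" by (rule smooth_hypersurface_Int[OF M(1) WV(1)])
    show ?thesis
    proof (cases "\<exists>g0\<in>conjugacy_class a b d f. ?rev g0")
      case False
      then have "params e a b d ` conjugacy_class a b d f \<subseteq> M" using M(2) cases in_E by blast
      then show ?thesis using M(1) by blast
    next
      case True
      then obtain g0 where g0: "g0 \<in> conjugacy_class a b d f" "?rev g0" by blast
      \<comment> \<open>One reversed map of the class serves as base for the second half, because
        all reversed maps have its pattern.\<close>
      obtain M' where M': "smooth_hypersurface M'"
        "\<And>g. g \<in> exp_family a b d \<Longrightarrow> same_pattern a b d g0 g \<Longrightarrow> params e a b d g \<in> M'"
        using pattern_hypersurface[OF ab e in_E[OF g0(1)]] by blast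
      have MV: "smooth_hypersurface (M' \<inter> V)" by (rule smooth_hypersurface_Int[OF M'(1) WV(2)])
      have inM': "params e a b d g \<in> M' \<inter> V" if g: "g \<in> exp_family a b d" and rev: "?rev g" for g
      proof -
        have "same_pattern a b d g0 g" unfolding same_pattern_def using g0(2) rev by simp
        then show ?thesis using M'(2)[OF g] inV[OF g rev] by blast
      qed
      have "smooth_hypersurface (M \<inter> W \<union> M' \<inter> V)"
        by (rule smooth_hypersurface_Un[OF MW _ WV(1) MV _ WV(2,3)]) auto
      moreover have "params e a b d ` conjugacy_class a b d f \<subseteq> M \<inter> W \<union> M' \<inter> V"
        using cases in_E inW inM' by blast
      ultimately show ?thesis by blast
    qed
  qed
qed

theorem theoremC:
  fixes a b :: real and d :: nat and f :: "real \<Rightarrow> real" and e :: "'n::finite \<Rightarrow> nat"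
  assumes "a < b"
    and "bij_betw e UNIV {..<2 * d + 2}"
    and "f \<in> exp_family a b d"
  shows "(\<exists>S. codim1_submanifold_of (params e a b d ` exp_family a b d) S \<and>
              params e a b d ` conjugacy_class a b d f \<subseteq> S) \<and>
         (\<forall>g\<in>conjugacy_class a b d f. \<forall>h. conjugacy {a..b} f {a..b} g h \<longrightarrow>
            (\<forall>i\<in>essential_branches a b d f.
               \<bar>slope a b d g (corresponding_branch a b d h i)\<bar> \<ge> \<bar>slope a b d f i\<bar>) \<longrightarrow>
            (\<forall>i\<in>essential_branches a b d f.
               slope a b d f i = slope a b d g (corresponding_branch a b d h i)))"
proof
  obtain M where M: "smooth_hypersurface M" "params e a b d ` conjugacy_class a b d f \<subseteq> M"
    using conjugacy_class_hypersurface[OF assms] by blast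
  have "conjugacy_class a b d f \<subseteq> exp_family a b d" unfolding conjugacy_class_def by blast
  then have "params e a b d ` conjugacy_class a b d f \<subseteq> M \<inter> params e a b d ` exp_family a b d" using M(2) by blast
  then show "\<exists>S. codim1_submanifold_of (params e a b d ` exp_family a b d) S \<and>
      params e a b d ` conjugacy_class a b d f \<subseteq> S"
    unfolding codim1_submanifold_of_def using M(1) by blast
  show "\<forall>g\<in>conjugacy_class a b d f. \<forall>h. conjugacy {a..b} f {a..b} g h \<longrightarrow>
      (\<forall>i\<in>essential_branches a b d f.
         \<bar>slope a b d g (corresponding_branch a b d h i)\<bar> \<ge> \<bar>slope a b d f i\<bar>) \<longrightarrow>
      (\<forall>i\<in>essential_branches a b d f.
         slope a b d f i = slope a b d g (corresponding_branch a b d h i))"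
  proof (intro ballI allI impI)
    fix g h i
    assume "g \<in> conjugacy_class a b d f" "conjugacy {a..b} f {a..b} g h"
      "\<forall>i\<in>essential_branches a b d f. \<bar>slope a b d g (corresponding_branch a b d h i)\<bar> \<ge> \<bar>slope a b d f i\<bar>"
      "i \<in> essential_branches a b d f"
    then show "slope a b d f i = slope a b d g (corresponding_branch a b d h i)"
      using essential_slopes_rigid[OF assms(1,3)] unfolding conjugacy_class_def by blast
  qed
qed

end
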